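(* Suppose $\sigma\in L^{\infty}(\mathbb{D}(0,R))$ is real-valued and has a radial limit $\tilde\sigma$. Let $\inf\sigma<\alpha<\beta<\sup\sigma$ with either $\alpha>0$ or $\beta<0$, and suppose $|\{\theta\in[0,2\pi):\tilde{\sigma}(\theta)=\alpha\}|=|\{\theta\in[0,2\pi):\tilde{\sigma}(\theta)=\beta\}|=0$. Then $$\lim_{N\to\infty}\frac{\#\{0\leq j\leq N:\alpha<\lambda_{j}^{N}(\sigma)<\beta\}}{N+1}=\frac{\left|\{\theta\in[0,2\pi):\alpha<\tilde{\sigma}(\theta)<\beta\}\right|}{2\pi}.$$
   Context: Let $\{c_n\}_{n\ge 0}$ be a sequence with $c_n>0$ for all $n$, such that $\{c_{n+1}/c_n\}$ is monotonic, and let $R=\lim_{n\to\infty}c_{n+1}/c_n\in(0,\infty]$ ($R=\infty$ if the limit diverges). Assume $\{c_n\}$ is the moment sequence of an absolutely continuous finite (positive) measure $d\mu(r)=\mu(r)\,dr$ with $\operatorname{supp}(\mu)=[0,R]$ ($[0,\infty)$ if $R=\infty$), i.e. $c_n=\int_0^R r^n\mu(r)\,dr$. If $R=\infty$, assume additionally that for every $m\in\mathbb{N}$, $\frac{c_{2l+m+1}}{\sqrt{c_{2l+2m+1}}\sqrt{c_{2l+1}}}\to 1$ as $l\to\infty$. $\mathbb{D}(0,R)=\{z\in\mathbb{C}:|z|<R\}$ (all of $\mathbb{C}$ if $R=\infty$), and $d\nu(z)=\mu(|z|)\frac{dz}{2\pi}$, where $dz$ is area measure. $\mathcal{H}_c$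 is the space of analytic functions $f(z)=\sum_{n\ge0}a_nz^n$, $|z|<R$, with $\|f\|_c^2=\sum_{n\ge0}|a_n|^2c_{2n+1}<\infty$; it is a closed subspace of $L^2(\mathbb{D}(0,R),\nu)$ with the same norm, with orthonormal basis $z^n/\sqrt{c_{2n+1}}$, $n\ge 0$. Let $P:L^2(\mathbb{D}(0,R),\nu)\to\mathcal{H}_c$ be the orthogonal projection. For $\sigma\in L^\infty(\mathbb{D}(0,R))$ the Toeplitz operator $T_\sigma:\mathcal{H}_c\to\mathcal{H}_c$ is $T_\sigma f=P(\sigma f)$. Let $\mathcal{K}_N=\operatorname{span}\{z^n/\sqrt{c_{2n+1}}:n=0,1,\dots,N\}$ and let $P_N$ be the orthogonal projection onto $\mathcal{K}_N$. For real $\sigma$, $\lambda_0^N(\sigma),\dots,\lambda_N^N(\sigma)$ are the eigenvalues, counted with multiplicity, of the self-adjoint operator $P_NT_\sigma P_N$ regarded as an operator on the $(N+1)$-dimensional space $\mathcal{K}_N$. Symbols $\sigma$ are understood as bounded measurable functions, so that pointwise limits, $\inf\sigma$ and $\sup\sigma$ make sense. A real-valued $\sigma\in L^\infty(\mathbb{D}(0,R))$ has a radial limit if $\tilde\sigma(\theta):=\lim_{r\to R^-}\sigma(re^{i\theta})$ exists for almost every $\theta\in[0,2\pi)$. $|E|$ denotes Lebesgue measure of $E\subseteq[0,2\pi)$. *)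

theory Defs
  imports "HOL-Analysis.Analysis" "HOL-Library.Function_Algebras"
begin

definition disc :: "ereal \<Rightarrow> complex set" where
  "disc R = {z. ereal (cmod z) < R}"

text \<open>The filter of \<open>r \<rightarrow> R\<close> from below, for a radius that may be infinite.\<close>

definition to_radius :: "ereal \<Rightarrow> real filter" where
  "to_radius R = (if R = \<infinity> then at_top else at_left (real_of_ereal R))"

definition measure_support :: "'a::topological_space measure \<Rightarrow> 'a set" where
  "measure_support M = {x. \<forall>U. open U \<longrightarrow> x \<in> U \<longrightarrow> emeasure M U > 0}"

text \<open>The area measure weighted by \<open>\<mu> \<bar>z\<bar> / (2 \<pi>)\<close> on the disc. The reference measure is
  Lebesgue's (completed) one, so that merely Lebesgue measurable symbols are admitted.\<close>

definition disc_measure :: "(real \<Rightarrow> real) \<Rightarrow> ereal \<Rightarrow> complex measure" where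
  "disc_measure \<mu> R = density (lebesgue_on (disc R)) (\<lambda>z. ennreal (\<mu> (cmod z) / (2 * pi)))"

text \<open>Functions on the disc are total functions vanishing outside of it. This makes an element of
  the space below determined by its values on the disc.\<close>

definition Hc :: "(nat \<Rightarrow> real) \<Rightarrow> ereal \<Rightarrow> (complex \<Rightarrow> complex) set" where
  "Hc c R = {f. (\<forall>z. z \<notin> disc R \<longrightarrow> f z = 0) \<and>
     (\<exists>a. (\<forall>z\<in>disc R. (\<lambda>n. a n * z ^ n) sums f z) \<and>
          summable (\<lambda>n. (cmod (a n))\<^sup>2 * c (2 * n + 1)))}"

text \<open>The orthogonal projection of the square integrable function \<open>g\<close> onto a linear space \<open>S\<close> of
  square integrable functions. It is used for \<open>S\<close> closed and such that \<open>M\<close>-a.e. equal elements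
  of \<open>S\<close> are equal, in which case the projection is a unique element of \<open>S\<close> and not just an
  equivalence class.\<close>

definition orth_proj ::
  "complex measure \<Rightarrow> (complex \<Rightarrow> complex) set \<Rightarrow> (complex \<Rightarrow> complex) \<Rightarrow> complex \<Rightarrow> complex" where
  "orth_proj M S g =
     (THE f. f \<in> S \<and> (\<forall>h\<in>S. (\<integral>z. (g z - f z) * cnj (h z) \<partial>M) = 0))"

definition toeplitz ::
  "(nat \<Rightarrow> real) \<Rightarrow> (real \<Rightarrow> real) \<Rightarrow> ereal \<Rightarrow> (complex \<Rightarrow> real) \<Rightarrow>
    (complex \<Rightarrow> complex) \<Rightarrow> complex \<Rightarrow> complex" where
  "toeplitz c \<mu> R \<sigma> f =
     orth_proj (disc_measure \<mu> R) (Hc c R) (\<lambda>z. complex_of_real (\<sigma> z) * f z)"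

text \<open>The complex vector space structure on functions; the library's \<^const>\<open>span\<close> and
  \<^const>\<open>dim\<close> are those of real vector spaces.\<close>

definition cscale :: "complex \<Rightarrow> (complex \<Rightarrow> complex) \<Rightarrow> complex \<Rightarrow> complex" where
  "cscale x f = (\<lambda>z. x * f z)"

global_interpretation cfun: vector_space cscale
  by unfold_locales (auto simp: cscale_def algebra_simps fun_eq_iff)

definition onb :: "(nat \<Rightarrow> real) \<Rightarrow> ereal \<Rightarrow> nat \<Rightarrow> complex \<Rightarrow> complex" where
  "onb c R n = (\<lambda>z. if z \<in> disc R then z ^ n / complex_of_real (sqrt (c (2 * n + 1))) else 0)"

definition KN :: "(nat \<Rightarrow> real) \<Rightarrow> ereal \<Rightarrow> nat \<Rightarrow> (complex \<Rightarrow> complex) set" where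
  "KN c R N = cfun.span (onb c R ` {0..N})"

definition PN ::
  "(nat \<Rightarrow> real) \<Rightarrow> (real \<Rightarrow> real) \<Rightarrow> ereal \<Rightarrow> nat \<Rightarrow> (complex \<Rightarrow> complex) \<Rightarrow> complex \<Rightarrow> complex" where
  "PN c \<mu> R N = orth_proj (disc_measure \<mu> R) (KN c R N)"

definition truncated_toeplitz ::
  "(nat \<Rightarrow> real) \<Rightarrow> (real \<Rightarrow> real) \<Rightarrow> ereal \<Rightarrow> (complex \<Rightarrow> real) \<Rightarrow> nat \<Rightarrow>
    (complex \<Rightarrow> complex) \<Rightarrow> complex \<Rightarrow> complex" where
  "truncated_toeplitz c \<mu> R \<sigma> N = PN c \<mu> R N \<circ> toeplitz c \<mu> R \<sigma> \<circ> PN c \<mu> R N"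

text \<open>\<open>ev 0, \<dots>, ev N\<close> are the eigenvalues, repeated according to multiplicity, of the self-adjoint
  operator \<open>A\<close> on the \<open>(N + 1)\<close>-dimensional complex space \<open>V\<close>: every complex number occurs in the
  list as often as the dimension of its eigenspace (zero for a non-eigenvalue). For self-adjoint
  \<open>A\<close> there is exactly one such list up to order.\<close>

definition eigenvalues_with_mult ::
  "((complex \<Rightarrow> complex) \<Rightarrow> complex \<Rightarrow> complex) \<Rightarrow> (complex \<Rightarrow> complex) set \<Rightarrow> nat \<Rightarrow>
    (nat \<Rightarrow> real) \<Rightarrow> bool" where
  "eigenvalues_with_mult A V N ev \<longleftrightarrow>
     (\<forall>x. card {j\<in>{0..N}. complex_of_real (ev j) = x} = cfun.dim {f\<in>V. A f = cscale x f})"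

end

theory Submission
  imports Defs
begin

text \<open>Let \<open>e\<^sub>k\<close> be the normalised monomials and \<open>\<sigma>'\<close> the radial limit. The statement says that the
  eigenvalue distribution of the compression of multiplication by \<open>\<sigma>\<close> to the span of
  \<open>e\<^sub>0, \<dots>, e\<^sub>N\<close> converges to the distribution of \<open>\<sigma>'\<close> with respect to normalised arc length, tested
  on an interval whose end points carry no mass. Two facts about the weight make this a theorem of
  Szego type.

  First, the mass of \<open>e\<^sub>k\<close> moves to the boundary circle, so \<open>\<integral> f (\<sigma>) \<bar>e\<^sub>k\<bar>\<^sup>2\<close> tends to the angular mean of
  \<open>f (\<sigma>')\<close> (\<open>disc_average_tendsto\<close>). Second, multiplication by \<open>(z / \<bar>z\<bar>)\<^sup>m\<close> takes \<open>e\<^sub>k\<close> asymptotically to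
  \<open>e\<^sub>k\<^sub>+\<^sub>m\<close> (\<open>monom_shift_approximable\<close>). As the trigonometric polynomials are dense in \<open>L\<^sup>2\<close> of the circle,
  the functions \<open>\<sigma> e\<^sub>k\<close> are, up to a small error in norm and away from both ends of \<open>0, \<dots>, N\<close>,
  polynomials of degree at most \<open>N\<close> (\<open>symbol_near_shifts\<close>). In other words, multiplication by \<open>\<sigma>\<close> almost
  preserves the truncated space, in the mean Hilbert-Schmidt sense.

  These facts are combined without any computation of traces of powers
  (\<open>eigenvalue_sum_near_weighted_average\<close>). If \<open>v\<close> is a normalised eigenvector with eigenvalue \<open>\<lambda>\<close>, then
  \<open>\<sigma>\<close> has mean \<open>\<lambda>\<close> with respect to \<open>\<bar>v\<bar>\<^sup>2\<close>, and its variance is the squared norm of the part of \<open>\<sigma> v\<close>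
  outside of the truncated space. The sum of all the variances is the squared Hilbert-Schmidt norm
  just seen to be \<open>o(N)\<close>. So for a Lipschitz function \<open>f\<close> the sum of \<open>f (\<lambda>)\<close> over the eigenvalues is
  within \<open>o(N)\<close> of \<open>\<Sum> \<integral> f (\<sigma>) \<bar>v\<bar>\<^sup>2 = \<Sum> \<integral> f (\<sigma>) \<bar>e\<^sub>k\<bar>\<^sup>2\<close>, and the mean of the latter converges by the
  first fact (\<open>eigenvalue_mean_tendsto\<close>). Indicators of intervals are squeezed between Lipschitz
  functions.

  Around this core, polar coordinates for the weighted area measure are derived, and the defining
  projections are shown to exist, so that the truncated operator is the compression of
  multiplication by \<open>\<sigma>\<close> (\<open>truncated_toeplitz_weak\<close>). The eigenbasis comes from the
  hypothesis on the eigenvalue list (\<open>orthonormal_eigenbasis\<close>).\<close>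

section \<open>Polar coordinates in the plane\<close>

text \<open>The substitution \<open>s = tan t\<close> is made on the compact intervals from \<open>- arctan n\<close> to
  \<open>arctan n\<close>, whose images \<open>[-n, n]\<close> exhaust the line; monotone convergence gives the limit.\<close>

lemma nn_integral_tan_substitution:
  fixes G :: "real \<Rightarrow> ennreal"
  assumes G [measurable]: "G \<in> borel_measurable borel"
  shows "(\<integral>\<^sup>+s. G s \<partial>lborel) =
    (\<integral>\<^sup>+t. G (tan t) * ennreal (1 / (cos t)\<^sup>2) * indicator {-(pi/2)<..<pi/2} t \<partial>lborel)"
proof -
  have [measurable]: "(cos :: real \<Rightarrow> real) \<in> borel_measurable borel"
    "(tan :: real \<Rightarrow> real) \<in> borel_measurable borel"
    unfolding tan_def[abs_def]
    by (intro borel_measurable_divide borel_measurable_continuous_onI continuous_intros)+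
  have eq: "(\<integral>\<^sup>+s. G s * indicator {- real (Suc n)..real (Suc n)} s \<partial>lborel) =
    (\<integral>\<^sup>+t. G (tan t) * ennreal (1 / (cos t)\<^sup>2) * indicator {- arctan (Suc n)..arctan (Suc n)} t \<partial>lborel)"
    for n :: nat
  proof -
    have c: "cos t \<noteq> 0" if "t \<in> {- arctan (Suc n)..arctan (Suc n)}" for t
      using that arctan_ubound[of "Suc n"] cos_gt_zero_pi[of t] by fastforce
    have "arctan (Suc n) > 0" by simp
    then have "- arctan (Suc n) < arctan (Suc n)" by linarith
    from nn_integral_substitution_aux[OF G _ _ _ _ this, of tan "\<lambda>t. 1 / (cos t)\<^sup>2"]
    have "(\<integral>\<^sup>+s. G s * indicator {tan (- arctan (Suc n))..tan (arctan (Suc n))} s \<partial>lborel) =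
    (\<integral>\<^sup>+t. G (tan t) * ennreal (1 / (cos t)\<^sup>2) * indicator {- arctan (Suc n)..arctan (Suc n)} t \<partial>lborel)"
      using c by (force intro!: DERIV_tan[THEN DERIV_cong] continuous_intros simp: inverse_eq_divide)
    then show ?thesis by (simp add: tan_arctan)
  qed
  have U1: "(\<Union>n. {- real (Suc n)..real (Suc n)}) = UNIV"
  proof -
    have "\<exists>n. x \<in> {- real (Suc n)..real (Suc n)}" for x
    proof -
      obtain n :: nat where "\<bar>x\<bar> \<le> real n" using real_arch_simple by blast
      then show ?thesis by (intro exI[of _ n]) auto
    qed
    then show ?thesis by blast
  qed
  have U2: "(\<Union>n. {- arctan (Suc n)..arctan (Suc n)}) = {-(pi/2)<..<pi/2}"
  proof safe
    fix x n assume "x \<in> {- arctan (Suc n)..arctan (Suc n)}"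
    then show "x \<in> {-(pi/2)<..<pi/2}" using arctan_ubound[of "Suc n"] by auto
  next
    fix x assume x: "x \<in> {-(pi/2)<..<pi/2}"
    obtain n :: nat where "\<bar>tan x\<bar> \<le> real n" using real_arch_simple by blast
    then have "- real (Suc n) \<le> tan x" "tan x \<le> real (Suc n)" by auto
    then have "arctan (- real (Suc n)) \<le> arctan (tan x)" "arctan (tan x) \<le> arctan (real (Suc n))"
      using arctan_le_iff by blast+
    then have "x \<in> {- arctan (Suc n)..arctan (Suc n)}"
      using x arctan_minus[of "real (Suc n)"] by (simp add: arctan_tan)
    then show "x \<in> (\<Union>n. {- arctan (Suc n)..arctan (Suc n)})" by blast
  qed
  have lim: "(\<lambda>n. \<integral>\<^sup>+x. f x * indicator (A n) x \<partial>lborel) \<longlonglongrightarrow> (\<integral>\<^sup>+x. f x * indicator (\<Union>n. A n) x \<partial>lborel)"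
    if [measurable]: "f \<in> borel_measurable borel" "\<And>n. A n \<in> sets borel" and "incseq A"
    for f :: "real \<Rightarrow> ennreal" and A
  proof (rule nn_integral_LIMSEQ)
    show "incseq (\<lambda>n x. f x * indicator (A n) x)"
      using \<open>incseq A\<close> by (auto simp: incseq_def le_fun_def intro!: mult_left_mono split: split_indicator)
    fix x
    show "(\<lambda>n. f x * indicator (A n) x) \<longlonglongrightarrow> f x * indicator (\<Union>n. A n) x"
    proof (cases "x \<in> (\<Union>n. A n)")
      case True
      then obtain k where "x \<in> A k" by blast
      then have "\<forall>n\<ge>k. x \<in> A n" using \<open>incseq A\<close> by (auto simp: incseq_def)
      then show ?thesis
        using True by (intro tendsto_eventually eventually_sequentiallyI[of k]) (auto simp: indicator_def)
    qed simp
  qed auto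
  have "(\<lambda>n. \<integral>\<^sup>+s. G s * indicator {- real (Suc n)..real (Suc n)} s \<partial>lborel) \<longlonglongrightarrow>
    (\<integral>\<^sup>+s. G s * indicator (\<Union>n. {- real (Suc n)..real (Suc n)}) s \<partial>lborel)"
    by (rule lim) (auto simp: incseq_def)
  moreover have "(\<lambda>n. \<integral>\<^sup>+t. G (tan t) * ennreal (1 / (cos t)\<^sup>2) * indicator {- arctan (Suc n)..arctan (Suc n)} t \<partial>lborel) \<longlonglongrightarrow>
    (\<integral>\<^sup>+t. G (tan t) * ennreal (1 / (cos t)\<^sup>2) * indicator (\<Union>n. {- arctan (Suc n)..arctan (Suc n)}) t \<partial>lborel)"
    by (rule lim) (auto simp: incseq_def intro: order_trans arctan_monotone' )
  ultimately show ?thesis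
    unfolding eq U1 U2 using LIMSEQ_unique by fastforce
qed

text \<open>Four one-dimensional steps: \<open>x = - y s\<close> for fixed \<open>y\<close>, an exchange of the integrals,
  \<open>s = tan t\<close>, and \<open>y = r cos t\<close>. Here \<open>t\<close> is the angle with the imaginary axis, hence the final
  shift by \<open>pi / 2\<close>.\<close>

lemma nn_integral_half_plane:
  fixes F :: "real \<Rightarrow> real \<Rightarrow> ennreal"
  assumes F [measurable]: "case_prod F \<in> borel_measurable borel"
  shows "(\<integral>\<^sup>+y. (\<integral>\<^sup>+x. F x y \<partial>lborel) * indicator {0<..} y \<partial>lborel) =
    (\<integral>\<^sup>+t. (\<integral>\<^sup>+r. F (r * cos t) (r * sin t) * (ennreal r * indicator {0<..} r) \<partial>lborel) * indicator {0<..<pi} t \<partial>lborel)"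
proof -
  have F' [measurable]: "(\<lambda>p. F (fst p) (snd p)) \<in> borel_measurable (borel \<Otimes>\<^sub>M borel)"
    using F by (simp add: borel_prod case_prod_unfold)
  have Fm [measurable]: "(\<lambda>x. F (f x) (g x)) \<in> borel_measurable N"
    if [measurable]: "f \<in> borel_measurable N" "g \<in> borel_measurable N" for f g and N :: "'z measure"
    using measurable_compose[OF measurable_Pair[OF that] F'] by simp
  define H where "H s = (\<integral>\<^sup>+y. F (- (y * s)) y * (ennreal y * indicator {0<..} y) \<partial>lborel)" for s
  have [measurable]: "H \<in> borel_measurable borel" unfolding H_def by measurable
  have "(\<integral>\<^sup>+y. (\<integral>\<^sup>+x. F x y \<partial>lborel) * indicator {0<..} y \<partial>lborel) =
    (\<integral>\<^sup>+y. (\<integral>\<^sup>+s. F (- (y * s)) y * (ennreal y * indicator {0<..} y) \<partial>lborel) \<partial>lborel)"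
  proof (rule nn_integral_cong)
    fix y :: real
    show "(\<integral>\<^sup>+x. F x y \<partial>lborel) * indicator {0<..} y =
      (\<integral>\<^sup>+s. F (- (y * s)) y * (ennreal y * indicator {0<..} y) \<partial>lborel)"
    proof (cases "y > 0")
      case True
      have "(\<integral>\<^sup>+x. F x y \<partial>lborel) = ennreal y * (\<integral>\<^sup>+s. F (- (y * s)) y \<partial>lborel)"
        using True by (subst nn_integral_real_affine[where c = "-y" and t = 0]) auto
      also have "\<dots> = (\<integral>\<^sup>+s. F (- (y * s)) y * ennreal y \<partial>lborel)"
        by (subst nn_integral_multc) (auto simp: mult.commute)
      finally show ?thesis using True by simp
    qed simp
  qed
  also have "\<dots> = (\<integral>\<^sup>+s. H s \<partial>lborel)"
    unfolding H_def by (rule lborel_pair.Fubini') measurable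
  also have "\<dots> = (\<integral>\<^sup>+t. H (tan t) * ennreal (1 / (cos t)\<^sup>2) * indicator {-(pi/2)<..<pi/2} t \<partial>lborel)"
    by (rule nn_integral_tan_substitution) simp
  also have "\<dots> = (\<integral>\<^sup>+t. (\<integral>\<^sup>+r. F (- (r * sin t)) (r * cos t) * (ennreal r * indicator {0<..} r) \<partial>lborel) * indicator {-(pi/2)<..<pi/2} t \<partial>lborel)"
  proof (rule nn_integral_cong)
    fix t :: real
    show "H (tan t) * ennreal (1 / (cos t)\<^sup>2) * indicator {-(pi/2)<..<pi/2} t =
      (\<integral>\<^sup>+r. F (- (r * sin t)) (r * cos t) * (ennreal r * indicator {0<..} r) \<partial>lborel) * indicator {-(pi/2)<..<pi/2} t"
    proof (cases "t \<in> {-(pi/2)<..<pi/2}")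
      case True
      then have c: "cos t > 0" by (auto intro: cos_gt_zero_pi)
      have "H (tan t) = ennreal (cos t) * (\<integral>\<^sup>+r. F (- (cos t * r * tan t)) (cos t * r) * (ennreal (cos t * r) * indicator {0<..} (cos t * r)) \<partial>lborel)"
        unfolding H_def using c by (subst nn_integral_real_affine[where c = "cos t" and t = 0]) auto
      also have "(\<lambda>r. F (- (cos t * r * tan t)) (cos t * r) * (ennreal (cos t * r) * indicator {0<..} (cos t * r))) =
        (\<lambda>r. ennreal (cos t) * (F (- (r * sin t)) (r * cos t) * (ennreal r * indicator {0<..} r)))"
        using c by (auto simp: fun_eq_iff tan_def zero_less_mult_iff mult_ac ennreal_mult split: split_indicator)
      also have "(\<integral>\<^sup>+r. ennreal (cos t) * (F (- (r * sin t)) (r * cos t) * (ennreal r * indicator {0<..} r)) \<partial>lborel) =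
         ennreal (cos t) * (\<integral>\<^sup>+r. (F (- (r * sin t)) (r * cos t) * (ennreal r * indicator {0<..} r)) \<partial>lborel)"
        by (rule nn_integral_cmult) measurable
      finally have "H (tan t) * ennreal (1 / (cos t)\<^sup>2) = ennreal (cos t) * ennreal (cos t) * ennreal (1 / (cos t)\<^sup>2) * (\<integral>\<^sup>+r. (F (- (r * sin t)) (r * cos t) * (ennreal r * indicator {0<..} r)) \<partial>lborel)"
        by (simp add: mult_ac)
      also have "ennreal (cos t) * ennreal (cos t) * ennreal (1 / (cos t)\<^sup>2) = 1"
        using c by (simp add: power2_eq_square flip: ennreal_mult)
      finally show ?thesis by simp
    qed simp
  qed
  also have "\<dots> = (\<integral>\<^sup>+t. (\<integral>\<^sup>+r. F (r * cos t) (r * sin t) * (ennreal r * indicator {0<..} r) \<partial>lborel) * indicator {0<..<pi} t \<partial>lborel)"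
    by (subst (2) nn_integral_real_affine[where c = 1 and t = "pi/2"])
      (auto simp: cos_add sin_add intro!: nn_integral_cong split: split_indicator)
  finally show ?thesis .
qed

lemma lborel_complex_eq_distr:
  "(lborel :: complex measure) = distr (lborel \<Otimes>\<^sub>M lborel) borel (\<lambda>(x, y). Complex x y)"
proof (rule lborel_eqI)
  have C [measurable]: "(\<lambda>(x, y). Complex x y) \<in> borel_measurable (lborel \<Otimes>\<^sub>M lborel)"
    unfolding Complex_eq by measurable
  fix l u :: complex
  assume le: "\<And>b. b \<in> Basis \<Longrightarrow> l \<bullet> b \<le> u \<bullet> b"
  from le[of 1] le[of \<i>] have le': "Re l \<le> Re u" "Im l \<le> Im u"
    by (auto simp: Basis_complex_def inner_complex_def)
  have "emeasure (distr (lborel \<Otimes>\<^sub>M lborel) borel (\<lambda>(x, y). Complex x y)) (box l u) =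
    emeasure (lborel \<Otimes>\<^sub>M lborel) ({Re l<..<Re u} \<times> {Im l<..<Im u})"
    by (subst emeasure_distr)
      (auto simp: box_def Basis_complex_def inner_complex_def space_pair_measure intro!: arg_cong[where f = "emeasure _"])
  also have "\<dots> = ennreal (Re u - Re l) * ennreal (Im u - Im l)"
    using le' by (subst lborel.emeasure_pair_measure_Times) auto
  also have "\<dots> = ennreal (\<Prod>b\<in>Basis. (u - l) \<bullet> b)"
    using le' by (simp add: Basis_complex_def inner_complex_def ennreal_mult complex_eq_iff)
  finally show "emeasure (distr (lborel \<Otimes>\<^sub>M lborel) borel (\<lambda>(x, y). Complex x y)) (box l u) =
    ennreal (\<Prod>b\<in>Basis. (u - l) \<bullet> b)" .
qed simp

text \<open>The lower half plane is the image of the upper one under \<open>z \<mapsto> - z\<close>, which shifts the angle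
  by \<open>pi\<close>; the real axis is a null set.\<close>

lemma nn_integral_polar:
  fixes F :: "complex \<Rightarrow> ennreal"
  assumes F [measurable]: "F \<in> borel_measurable borel"
  shows "(\<integral>\<^sup>+z. F z \<partial>lborel) =
    (\<integral>\<^sup>+t. (\<integral>\<^sup>+r. F (rcis r t) * (ennreal r * indicator {0<..} r) \<partial>lborel) * indicator {0..<2 * pi} t \<partial>lborel)"
proof -
  have C [measurable]: "(\<lambda>(x, y). Complex x y) \<in> borel_measurable (borel \<Otimes>\<^sub>M borel)"
    unfolding Complex_eq by measurable
  have C' [measurable]: "(\<lambda>x. Complex (f x) (g x)) \<in> borel_measurable N"
    if [measurable]: "f \<in> borel_measurable N" "g \<in> borel_measurable N" for f g and N :: "'z measure"
    unfolding Complex_eq by measurable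
  define P where "P t = (\<integral>\<^sup>+r. F (rcis r t) * (ennreal r * indicator {0<..} r) \<partial>lborel)" for t
  have [measurable]: "P \<in> borel_measurable borel"
    unfolding P_def rcis_def cis_conv_exp by measurable
  have "(\<integral>\<^sup>+z. F z \<partial>lborel) = (\<integral>\<^sup>+p. F (case p of (x, y) \<Rightarrow> Complex x y) \<partial>(lborel \<Otimes>\<^sub>M lborel))"
    by (subst lborel_complex_eq_distr, subst nn_integral_distr) auto
  also have "\<dots> = (\<integral>\<^sup>+y. (\<integral>\<^sup>+x. F (Complex x y) \<partial>lborel) \<partial>lborel)"
    by (subst lborel_pair.nn_integral_snd[symmetric]) auto
  also have "\<dots> = (\<integral>\<^sup>+y. (\<integral>\<^sup>+x. F (Complex x y) \<partial>lborel) * indicator {0<..} y + (\<integral>\<^sup>+x. F (Complex x y) \<partial>lborel) * indicator {..<0} y \<partial>lborel)"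
    by (rule nn_integral_cong_AE, rule AE_mp[OF AE_lborel_singleton[of 0]])
      (auto split: split_indicator)
  also have "\<dots> = (\<integral>\<^sup>+y. (\<integral>\<^sup>+x. F (Complex x y) \<partial>lborel) * indicator {0<..} y \<partial>lborel) +
      (\<integral>\<^sup>+y. (\<integral>\<^sup>+x. F (Complex x y) \<partial>lborel) * indicator {..<0} y \<partial>lborel)"
    by (rule nn_integral_add) auto
  also have "(\<integral>\<^sup>+y. (\<integral>\<^sup>+x. F (Complex x y) \<partial>lborel) * indicator {..<0} y \<partial>lborel) =
      (\<integral>\<^sup>+y. (\<integral>\<^sup>+x. F (Complex (-x) (-y)) \<partial>lborel) * indicator {0<..} y \<partial>lborel)"
    by (subst nn_integral_real_affine[where c = "-1" and t = 0], simp, simp,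
        subst nn_integral_real_affine[where c = "-1" and t = 0])
      (auto intro!: nn_integral_cong split: split_indicator)
  also have "(\<integral>\<^sup>+y. (\<integral>\<^sup>+x. F (Complex (-x) (-y)) \<partial>lborel) * indicator {0<..} y \<partial>lborel) =
    (\<integral>\<^sup>+t. (\<integral>\<^sup>+r. F (- rcis r t) * (ennreal r * indicator {0<..} r) \<partial>lborel) * indicator {0<..<pi} t \<partial>lborel)"
    by (subst nn_integral_half_plane)
      (auto simp: case_prod_unfold borel_prod[symmetric] complex_eq_iff
        intro!: nn_integral_cong arg_cong2[where f = "(*)"] arg_cong[where f = F])
  also have "\<dots> = (\<integral>\<^sup>+t. P t * indicator {pi<..<2*pi} t \<partial>lborel)"
    unfolding P_def
    by (subst (2) nn_integral_real_affine[where c = 1 and t = "pi"], (unfold rcis_def cis_conv_exp, measurable)[1], simp)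
      (auto simp: rcis_def complex_eq_iff intro!: nn_integral_cong arg_cong2[where f = "(*)"] arg_cong[where f = F]
       split: split_indicator)
  also have "(\<integral>\<^sup>+y. (\<integral>\<^sup>+x. F (Complex x y) \<partial>lborel) * indicator {0<..} y \<partial>lborel) =
    (\<integral>\<^sup>+t. P t * indicator {0<..<pi} t \<partial>lborel)"
    unfolding P_def
    by (subst nn_integral_half_plane)
      (auto simp: case_prod_unfold borel_prod[symmetric] complex_eq_iff
        intro!: nn_integral_cong arg_cong2[where f = "(*)"] arg_cong[where f = F])
  also have "(\<integral>\<^sup>+t. P t * indicator {0<..<pi} t \<partial>lborel) + (\<integral>\<^sup>+t. P t * indicator {pi<..<2*pi} t \<partial>lborel) =
    (\<integral>\<^sup>+t. P t * indicator {0<..<pi} t + P t * indicator {pi<..<2*pi} t \<partial>lborel)"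
    by (rule nn_integral_add[symmetric]) auto
  also have "\<dots> = (\<integral>\<^sup>+t. P t * indicator {0..<2 * pi} t \<partial>lborel)"
    by (rule nn_integral_cong_AE, rule AE_mp[OF AE_lborel_singleton[of 0]],
        rule AE_mp[OF AE_lborel_singleton[of pi]])
      (auto split: split_indicator)
  finally show ?thesis unfolding P_def .
qed

section \<open>Radial weights as product measures\<close>

text \<open>For a weight \<open>\<mu>\<close> that is only Lebesgue measurable this makes \<open>\<mu> \<bar>z\<bar>\<close> Lebesgue measurable
  on the plane, and insensitive to changes of \<open>\<mu>\<close> on a null set of radii.\<close>

lemma cmod_vimage_null_sets:
  assumes "N \<in> null_sets (lborel :: real measure)"
  shows "cmod -` N \<in> null_sets (lborel :: complex measure)"
proof -
  have [measurable]: "N \<in> sets borel" using assms by auto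
  have V [measurable]: "cmod -` N \<in> sets borel"
    using measurable_sets[of cmod borel borel N] by simp
  have N: "AE r in lborel. r \<notin> N" by (rule AE_not_in[OF assms])
  have "(\<integral>\<^sup>+r. indicator (cmod -` N) (rcis r t) * (ennreal r * indicator {0<..} r) \<partial>lborel) = 0" for t
  proof -
    have "(\<integral>\<^sup>+r. indicator (cmod -` N) (rcis r t) * (ennreal r * indicator {0<..} r) \<partial>lborel) = (\<integral>\<^sup>+(r::real). 0 \<partial>lborel)"
      using N by (intro nn_integral_cong_AE) (auto elim!: eventually_mono split: split_indicator)
    then show ?thesis by simp
  qed
  then have "emeasure lborel (cmod -` N) = 0"
    using nn_integral_polar[of "indicator (cmod -` N)"] by simp
  then show ?thesis by auto
qed

lemma cmod_lebesgue_measurable: "cmod \<in> lebesgue \<rightarrow>\<^sub>M lebesgue"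
proof (rule completion.measurable_completion2)
  show m: "cmod \<in> lebesgue \<rightarrow>\<^sub>M lborel" by (simp add: measurable_completion)
  show "null_sets lborel \<subseteq> null_sets (distr lebesgue lborel cmod)"
  proof
    fix N :: "real set" assume N: "N \<in> null_sets lborel"
    then have "cmod -` N \<in> null_sets lebesgue"
      by (intro null_sets_completionI cmod_vimage_null_sets)
    with N m show "N \<in> null_sets (distr lebesgue lborel cmod)"
      by (subst null_sets_distr_iff) (auto simp del: space_completion intro!: null_setsI)
  qed
qed

lemma borel_measurable_rcis [measurable]:
  assumes "f \<in> borel_measurable N" "g \<in> borel_measurable N"
  shows "(\<lambda>x. rcis (f x) (g x)) \<in> borel_measurable N"
  using assms unfolding rcis_def cis_conv_exp by measurable

text \<open>The quotient condition is the form in which the growth of the moments enters: it says that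
  the shift \<open>z\<^sup>k \<mapsto> z\<^sup>k\<^sup>+\<^sup>m\<close> between normalised monomials is asymptotically multiplication by a
  unimodular function. It is assumed for every radius; for a finite radius it follows from the
  convergence of \<open>c (n + 1) / c n\<close>.\<close>

locale radial_weight =
  fixes c :: "nat \<Rightarrow> real" and \<mu> :: "real \<Rightarrow> real" and R :: ereal
  assumes c_pos: "\<And>n. c n > 0"
    and R_pos: "0 < R"
    and mu_meas: "\<mu> \<in> borel_measurable lebesgue"
    and mu_nonneg: "\<And>r. \<mu> r \<ge> 0"
    and mu_supp: "measure_support (density lebesgue (\<lambda>r. ennreal (\<mu> r))) = {r. 0 \<le> r \<and> ereal r \<le> R}"
    and moments: "\<And>n. has_bochner_integral (lebesgue_on {r. 0 \<le> r \<and> ereal r \<le> R})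
                    (\<lambda>r. r ^ n * \<mu> r) (c n)"
    and c_quotient: "\<And>m. (\<lambda>l. c (2 * l + m + 1) /
                    (sqrt (c (2 * l + 2 * m + 1)) * sqrt (c (2 * l + 1)))) \<longlonglongrightarrow> 1"
begin

abbreviation "M \<equiv> disc_measure \<mu> R"

text \<open>A Borel version of the weight: products of completed measures are not complete, so the
  product structure below lives on the Borel sets.\<close>

definition "\<mu>\<^sub>B = (SOME g. g \<in> borel_measurable borel \<and> (AE r in lborel. \<mu> r = g r) \<and> (\<forall>r. g r \<ge> 0))"

lemma mu_borel:
  shows mu_borel_meas [measurable]: "\<mu>\<^sub>B \<in> borel_measurable borel"
    and mu_borel_AE: "AE r in lborel. \<mu> r = \<mu>\<^sub>B r"
    and mu_borel_nonneg: "\<mu>\<^sub>B r \<ge> 0"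
proof -
  obtain g where g: "g \<in> borel_measurable lborel" "AE r in lborel. \<mu> r = g r"
    using completion_ex_borel_measurable_real[OF mu_meas] by blast
  have "(\<lambda>r. max 0 (g r)) \<in> borel_measurable borel" using g(1) by simp
  moreover have "AE r in lborel. \<mu> r = max 0 (g r)"
    using g(2) by eventually_elim (metis max.absorb2 mu_nonneg)
  ultimately have "\<exists>g. g \<in> borel_measurable borel \<and> (AE r in lborel. \<mu> r = g r) \<and> (\<forall>r. g r \<ge> 0)"
    by (intro exI[of _ "\<lambda>r. max 0 (g r)"]) auto
  from someI_ex[OF this]
  show "\<mu>\<^sub>B \<in> borel_measurable borel" "AE r in lborel. \<mu> r = \<mu>\<^sub>B r" "\<mu>\<^sub>B r \<ge> 0"
    unfolding \<mu>\<^sub>B_def by blast+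
qed

text \<open>In polar coordinates the weighted area measure on the disc is the product of this radial
  measure with the normalised arc length \<open>unif\<close>. The factor \<open>r\<close> is the Jacobian, which is why
  the radial moments of order \<open>n\<close> are \<open>c (n + 1)\<close>.\<close>

definition rad :: "real measure" where
  "rad = density lborel (\<lambda>r. ennreal (r * \<mu>\<^sub>B r) * indicator {r. 0 < r \<and> ereal r < R} r)"

definition unif :: "real measure" where
  "unif = density lborel (\<lambda>t. ennreal (1 / (2 * pi)) * indicator {0..<2 * pi} t)"

lemma sets_rad [measurable_cong, simp]: "sets rad = sets borel" by (simp add: rad_def)
lemma space_rad [simp]: "space rad = UNIV" by (simp add: rad_def)
lemma sets_unif [measurable_cong, simp]: "sets unif = sets borel" by (simp add: unif_def)
lemma space_unif [simp]: "space unif = UNIV" by (simp add: unif_def)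

lemma radii_sets [measurable]: "{r. 0 < r \<and> ereal r < R} \<in> sets borel"
  "{r. 0 \<le> r \<and> ereal r \<le> R} \<in> sets borel"
  by measurable

lemma disc_open: "open (disc R)"
proof -
  have "disc R = (\<lambda>z. ereal (cmod z)) -` {..<R}" by (auto simp: disc_def)
  then show ?thesis by (auto intro!: open_vimage continuous_intros)
qed

lemma disc_sets [measurable]: "disc R \<in> sets borel" using disc_open by auto

lemma emeasure_unif_space: "emeasure unif UNIV = 1"
  by (simp add: unif_def emeasure_density nn_integral_cmult_indicator flip: ennreal_mult)

sublocale unif: finite_measure unif
  by standard (simp add: emeasure_unif_space)

text \<open>The closed interval of the moment hypothesis and the open one of \<open>rad\<close> differ by at most
  the two points \<open>0\<close> and \<open>R\<close>.\<close>

lemma nn_integral_moment: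
  "(\<integral>\<^sup>+r. ennreal (r ^ n * \<mu>\<^sub>B r) * indicator {r. 0 < r \<and> ereal r < R} r \<partial>lborel) = ennreal (c n)"
proof -
  let ?I = "{r. 0 \<le> r \<and> ereal r \<le> R}"
  have "ennreal (c n) = (\<integral>\<^sup>+r. ennreal (r ^ n * \<mu> r) \<partial>lebesgue_on ?I)"
    using moments[of n] mu_nonneg
    by (subst nn_integral_eq_integral) (auto simp: has_bochner_integral_iff AE_restrict_space_iff)
  also have "\<dots> = (\<integral>\<^sup>+r. ennreal (r ^ n * \<mu> r) * indicator ?I r \<partial>lborel)"
    by (subst nn_integral_restrict_space) (auto simp: nn_integral_completion)
  also have "\<dots> = (\<integral>\<^sup>+r. ennreal (r ^ n * \<mu>\<^sub>B r) * indicator {r. 0 < r \<and> ereal r < R} r \<partial>lborel)"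
  proof (rule nn_integral_cong_AE)
    show "AE r in lborel. ennreal (r ^ n * \<mu> r) * indicator ?I r = ennreal (r ^ n * \<mu>\<^sub>B r) * indicator {r. 0 < r \<and> ereal r < R} r"
      using mu_borel_AE AE_lborel_singleton[of 0] AE_lborel_singleton[of "real_of_ereal R"]
      by eventually_elim (cases R; use R_pos in \<open>auto split: split_indicator\<close>)
  qed
  finally show ?thesis ..
qed

lemma nn_integral_rad_power: "(\<integral>\<^sup>+r. ennreal (r ^ n) \<partial>rad) = ennreal (c (n + 1))"
  unfolding rad_def
  by (subst nn_integral_density)
    (auto simp: nn_integral_moment[of "Suc n", symmetric] mult_ac mu_borel_nonneg intro!: nn_integral_cong
      split: split_indicator simp flip: ennreal_mult)

sublocale rad: finite_measure rad
  by standard (use nn_integral_rad_power[of 0] in simp)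

lemma AE_rad: "AE r in rad. 0 < r \<and> ereal r < R"
  unfolding rad_def by (subst AE_density) (auto split: split_indicator)

lemma has_bochner_integral_rad_power: "has_bochner_integral rad (\<lambda>r. r ^ n) (c (n + 1))"
  using nn_integral_rad_power[of n] c_pos[of "n+1"] AE_rad
  by (intro has_bochner_integral_nn_integral) (auto elim!: eventually_mono)

sublocale polar: pair_sigma_finite rad unif ..

lemma space_M [simp]: "space M = disc R"
  by (simp add: disc_measure_def space_restrict_space)

lemma sets_M: "sets M = sets (lebesgue_on (disc R))"
  by (simp add: disc_measure_def)

lemma weight_measurable [measurable]:
  "(\<lambda>z. ennreal (\<mu> (cmod z) / (2 * pi))) \<in> borel_measurable (lebesgue_on (disc R))"
proof -
  have "(\<lambda>z. \<mu> (cmod z)) \<in> borel_measurable lebesgue"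
    using measurable_compose[OF cmod_lebesgue_measurable mu_meas] .
  then show ?thesis by (intro measurable_restrict_space1) simp
qed

lemma borel_imp_M: "f \<in> borel_measurable borel \<Longrightarrow> f \<in> borel_measurable M"
proof -
  assume "f \<in> borel_measurable borel"
  then have "f \<in> borel_measurable (lebesgue_on (disc R))"
    by (intro measurable_restrict_space1 measurable_completion) simp
  then show ?thesis using sets_M by (simp cong: measurable_cong_sets)
qed

lemma id_M: "(\<lambda>z. z) \<in> M \<rightarrow>\<^sub>M borel"
  by (rule borel_imp_M) simp

lemma mu_borel_AE_cmod: "AE z in lborel. \<mu> (cmod z) = \<mu>\<^sub>B (cmod z)"
proof -
  from mu_borel_AE obtain N
    where N: "\<And>r. r \<in> space lborel - N \<Longrightarrow> \<mu> r = \<mu>\<^sub>B r" "N \<in> null_sets lborel"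
    by (rule AE_E3) blast
  have "AE z in lborel. z \<notin> cmod -` N"
    by (intro AE_not_in cmod_vimage_null_sets N)
  then show ?thesis
    by eventually_elim (use N in auto)
qed

text \<open>The comparison is made on Borel sets because \<open>M\<close> measures all Lebesgue sets of the disc
  and the product only Borel sets of the parameters. The weight is exchanged for its Borel
  version on the way, and the Jacobian becomes part of \<open>rad\<close>.\<close>

lemma distr_polar:
  "distr M borel (\<lambda>z. z) = distr (rad \<Otimes>\<^sub>M unif) borel (\<lambda>p. rcis (fst p) (snd p))"
proof (rule measure_eqI)
  fix A :: "complex set" assume "A \<in> sets (distr M borel (\<lambda>z. z))"
  then have A [measurable]: "A \<in> sets borel" by simp
  have AM: "A \<inter> disc R \<in> sets (lebesgue_on (disc R))"
    using A by (auto simp: sets_restrict_space_iff)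
  define f where "f z = ennreal (\<mu>\<^sub>B (cmod z) / (2 * pi)) * indicator (A \<inter> disc R) z" for z
  have [measurable]: "f \<in> borel_measurable borel" unfolding f_def by measurable
  have "emeasure (distr M borel (\<lambda>z. z)) A = emeasure M (A \<inter> disc R)"
    using id_M by (subst emeasure_distr) auto
  also have "\<dots> = (\<integral>\<^sup>+z. ennreal (\<mu> (cmod z) / (2 * pi)) * indicator (A \<inter> disc R) z \<partial>lebesgue_on (disc R))"
    unfolding disc_measure_def using AM by (subst emeasure_density) auto
  also have "\<dots> = (\<integral>\<^sup>+z. ennreal (\<mu> (cmod z) / (2 * pi)) * indicator (A \<inter> disc R) z * indicator (disc R) z \<partial>lborel)"
    by (subst nn_integral_restrict_space) (auto simp: nn_integral_completion)
  also have "\<dots> = (\<integral>\<^sup>+z. f z \<partial>lborel)"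
    using mu_borel_AE_cmod
    by (intro nn_integral_cong_AE) (auto simp: f_def elim!: eventually_mono split: split_indicator)
  also have "\<dots> = (\<integral>\<^sup>+t. (\<integral>\<^sup>+r. f (rcis r t) * (ennreal r * indicator {0<..} r) \<partial>lborel) * indicator {0..<2 * pi} t \<partial>lborel)"
    by (rule nn_integral_polar) simp
  also have "\<dots> = (\<integral>\<^sup>+t. (ennreal (1 / (2 * pi)) * indicator {0..<2 * pi} t) * (\<integral>\<^sup>+r. indicator A (rcis r t) \<partial>rad) \<partial>lborel)"
  proof (rule nn_integral_cong)
    fix t :: real
    have "(\<integral>\<^sup>+r. f (rcis r t) * (ennreal r * indicator {0<..} r) \<partial>lborel) =
      (\<integral>\<^sup>+r. ennreal (1 / (2 * pi)) * (ennreal (r * \<mu>\<^sub>B r) * indicator {r. 0 < r \<and> ereal r < R} r * indicator A (rcis r t)) \<partial>lborel)"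
      by (intro nn_integral_cong)
        (auto simp: f_def disc_def mu_borel_nonneg mult_ac split: split_indicator simp flip: ennreal_mult)
    also have "\<dots> = ennreal (1 / (2 * pi)) * (\<integral>\<^sup>+r. ennreal (r * \<mu>\<^sub>B r) * indicator {r. 0 < r \<and> ereal r < R} r * indicator A (rcis r t) \<partial>lborel)"
      by (rule nn_integral_cmult) measurable
    also have "(\<integral>\<^sup>+r. ennreal (r * \<mu>\<^sub>B r) * indicator {r. 0 < r \<and> ereal r < R} r * indicator A (rcis r t) \<partial>lborel) =
       (\<integral>\<^sup>+r. indicator A (rcis r t) \<partial>rad)"
      unfolding rad_def by (subst nn_integral_density) (auto simp: mult_ac)
    finally show "(\<integral>\<^sup>+r. f (rcis r t) * (ennreal r * indicator {0<..} r) \<partial>lborel) * indicator {0..<2 * pi} t =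
      (ennreal (1 / (2 * pi)) * indicator {0..<2 * pi} t) * (\<integral>\<^sup>+r. indicator A (rcis r t) \<partial>rad)"
      by (simp add: mult_ac)
  qed
  also have "\<dots> = (\<integral>\<^sup>+t. (\<integral>\<^sup>+r. indicator A (rcis r t) \<partial>rad) \<partial>unif)"
    unfolding unif_def by (subst nn_integral_density) auto
  also have "\<dots> = (\<integral>\<^sup>+p. indicator A (rcis (fst p) (snd p)) \<partial>(rad \<Otimes>\<^sub>M unif))"
    by (subst polar.nn_integral_snd[symmetric]) (simp, simp)
  also have "\<dots> = emeasure (distr (rad \<Otimes>\<^sub>M unif) borel (\<lambda>p. rcis (fst p) (snd p))) A"
    by (simp add: nn_integral_distr flip: nn_integral_indicator)
  finally show "emeasure (distr M borel (\<lambda>z. z)) A = emeasure (distr (rad \<Otimes>\<^sub>M unif) borel (\<lambda>p. rcis (fst p) (snd p))) A" .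
qed simp


end

section \<open>Moments and concentration at the boundary\<close>

lemma borel_measurable_cnj [measurable (raw)]:
  "f \<in> borel_measurable N \<Longrightarrow> (\<lambda>x. cnj (f x)) \<in> borel_measurable N"
  by (rule borel_measurable_continuous_on[of cnj]) (auto intro: continuous_intros)

context radial_weight begin

lemma integral_M_polar:
  fixes F :: "complex \<Rightarrow> 'b::{banach, second_countable_topology}"
  assumes F: "F \<in> borel_measurable borel"
  shows "(\<integral>z. F z \<partial>M) = (\<integral>p. F (rcis (fst p) (snd p)) \<partial>(rad \<Otimes>\<^sub>M unif))"
proof -
  have "(\<integral>z. F z \<partial>M) = (\<integral>z. F z \<partial>distr M borel (\<lambda>z. z))"
    by (rule integral_distr[symmetric]) (use F id_M in auto)
  also have "\<dots> = (\<integral>p. F (rcis (fst p) (snd p)) \<partial>(rad \<Otimes>\<^sub>M unif))"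
    unfolding distr_polar by (rule integral_distr) (use F in measurable)
  finally show ?thesis .
qed

lemma integrable_M_polar:
  fixes F :: "complex \<Rightarrow> 'b::{banach, second_countable_topology}"
  assumes F: "F \<in> borel_measurable borel"
  shows "integrable M F \<longleftrightarrow> integrable (rad \<Otimes>\<^sub>M unif) (\<lambda>p. F (rcis (fst p) (snd p)))"
proof -
  have "integrable M F \<longleftrightarrow> integrable (distr M borel (\<lambda>z. z)) F"
    by (rule integrable_distr_eq[symmetric]) (use F id_M in auto)
  also have "\<dots> \<longleftrightarrow> integrable (rad \<Otimes>\<^sub>M unif) (\<lambda>p. F (rcis (fst p) (snd p)))"
    unfolding distr_polar by (rule integrable_distr_eq) (use F in measurable)
  finally show ?thesis .
qed

lemma has_bochner_integral_cmod_power: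
  "has_bochner_integral M (\<lambda>z. cmod z ^ n) (c (n + 1))"
proof (rule has_bochner_integral_nn_integral)
  show "(\<lambda>z. cmod z ^ n) \<in> borel_measurable M" by (rule borel_imp_M) measurable
  have "(\<integral>\<^sup>+z. ennreal (cmod z ^ n) \<partial>M) = (\<integral>\<^sup>+z. ennreal (cmod z ^ n) \<partial>distr M borel (\<lambda>z. z))"
    by (rule nn_integral_distr[symmetric]) (use id_M in auto)
  also have "\<dots> = (\<integral>\<^sup>+p. ennreal (\<bar>fst p\<bar> ^ n) \<partial>(rad \<Otimes>\<^sub>M unif))"
    unfolding distr_polar by (subst nn_integral_distr) auto
  also have "\<dots> = (\<integral>\<^sup>+r. (\<integral>\<^sup>+t. ennreal (\<bar>r\<bar> ^ n) \<partial>unif) \<partial>rad)"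
    by (subst unif.nn_integral_fst[symmetric]) auto
  also have "\<dots> = (\<integral>\<^sup>+r. ennreal (r ^ n) \<partial>rad)"
    using AE_rad by (intro nn_integral_cong_AE) (auto simp: emeasure_unif_space elim!: eventually_mono)
  finally show "(\<integral>\<^sup>+z. ennreal (cmod z ^ n) \<partial>M) = ennreal (c (n + 1))"
    by (simp add: nn_integral_rad_power)
qed (auto simp: c_pos less_imp_le)

sublocale M: finite_measure M
proof
  have "integrable M (\<lambda>z. 1 :: real)"
    using has_bochner_integral_cmod_power[of 0] by (simp add: has_bochner_integral_iff)
  then show "emeasure M (space M) \<noteq> \<infinity>"
    by (simp add: integrable_iff_bounded)
qed

lemma integral_unif_cis:
  assumes "m \<noteq> 0"
  shows "(\<integral>t. cis (of_int m * t) \<partial>unif) = 0"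
proof -
  have "(\<integral>t. cis (of_int m * t) \<partial>unif) =
    (\<integral>t. (1 / (2 * pi) * indicator {0..<2 * pi} t) *\<^sub>R cis (of_int m * t) \<partial>lborel)"
  proof -
    have U: "unif = density lborel (\<lambda>t. ennreal (1 / (2 * pi) * indicator {0..<2 * pi} t))"
      unfolding unif_def by (intro arg_cong[where f = "density lborel"]) (auto split: split_indicator)
    show ?thesis
      unfolding U by (subst integral_density) (auto simp: cis_conv_exp)
  qed
  also have "\<dots> = (\<integral>t. indicator {0..2 * pi} t *\<^sub>R (cis (of_int m * t) / (2 * pi)) \<partial>lborel)"
    by (rule integral_cong_AE, (unfold cis_conv_exp, measurable)[1], (unfold cis_conv_exp, measurable)[1],
        rule AE_mp[OF AE_lborel_singleton[of "2*pi"]])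
      (auto simp: scaleR_conv_of_real split: split_indicator)
  also have "\<dots> = cis (of_int m * (2 * pi)) / (\<i> * of_int m * (2 * pi)) - cis (of_int m * 0) / (\<i> * of_int m * (2 * pi))"
  proof (rule integral_FTC_atLeastAtMost)
    fix x :: real
    have "((\<lambda>x. exp (\<i> * of_int m * of_real x) / (\<i> * of_int m * (2 * pi))) has_vector_derivative
       exp (\<i> * of_int m * of_real x) / (2 * pi)) (at x within {0..2*pi})"
      using assms by (auto intro!: derivative_eq_intros has_vector_derivative_real_field)
    then show "((\<lambda>x. cis (of_int m * x) / (\<i> * of_int m * (2 * pi))) has_vector_derivative
       cis (of_int m * x) / (2 * pi)) (at x within {0..2*pi})"
      by (simp add: cis_conv_exp mult_ac)
  qed (auto simp: cis_conv_exp intro!: continuous_intros)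
  also have "cis (of_int m * (2 * pi)) = 1"
    by (metis Ints_of_int cis_multiple_2pi mult.commute)
  finally show ?thesis by simp
qed

text \<open>Off the diagonal the angular integral of a nontrivial character vanishes.\<close>

lemma integral_monomials:
  "(\<integral>z. z ^ j * cnj z ^ k \<partial>M) = (if j = k then of_real (c (2 * k + 1)) else 0)"
proof (cases "j = k")
  case True
  have "(\<integral>z. z ^ j * cnj z ^ k \<partial>M) = (\<integral>z. complex_of_real (cmod z ^ (2 * k)) \<partial>M)"
    using True by (intro Bochner_Integration.integral_cong)
      (auto simp: power_mult simp flip: power_mult_distrib complex_norm_square)
  also have "\<dots> = of_real (c (2 * k + 1))"
    using has_bochner_integral_cmod_power[of "2 * k"]
    by (simp add: has_bochner_integral_iff del: of_real_power)
  finally show ?thesis using True by simp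
next
  case False
  define F where "F r t = complex_of_real (r ^ (j + k)) * cis (of_int (int j - int k) * t)" for r t :: real
  have [measurable]: "case_prod F \<in> borel_measurable (rad \<Otimes>\<^sub>M unif)"
    unfolding F_def cis_conv_exp by measurable
  have rcis: "rcis r t ^ j * cnj (rcis r t) ^ k = F r t" for r t
    by (simp add: F_def rcis_def power_mult_distrib power_add cis_cnj cis_mult Complex.DeMoivre algebra_simps)
  have [measurable]: "(\<lambda>z. z ^ j * cnj z ^ k) \<in> borel_measurable borel" by measurable
  have "integrable M (\<lambda>z. z ^ j * cnj z ^ k)"
    using has_bochner_integral_cmod_power[of "j + k"]
    by (rule Bochner_Integration.integrable_bound[OF has_bochner_integral_iff[THEN iffD1, THEN conjunct1]])
      (auto simp: norm_mult norm_power power_add intro!: borel_imp_M)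
  then have "integrable (rad \<Otimes>\<^sub>M unif) (case_prod F)"
    by (subst (asm) integrable_M_polar) (auto simp: rcis case_prod_unfold)
  then have "(\<integral>r. (\<integral>t. F r t \<partial>unif) \<partial>rad) = (\<integral>p. case_prod F p \<partial>(rad \<Otimes>\<^sub>M unif))"
    by (rule polar.integral_fst)
  moreover have "(\<integral>t. F r t \<partial>unif) = 0" for r
    unfolding F_def using False integral_unif_cis[of "int j - int k"] by simp
  moreover have "(\<integral>z. z ^ j * cnj z ^ k \<partial>M) = (\<integral>p. case_prod F p \<partial>(rad \<Otimes>\<^sub>M unif))"
    by (subst integral_M_polar) (auto simp: rcis case_prod_unfold)
  ultimately show ?thesis using False by simp
qed

text \<open>The interval between \<open>\<rho>\<close> and \<open>R\<close> contains a point of the support, so it has positive mass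
  \<open>\<kappa>\<close>, and on it \<open>r\<^sup>n \<ge> \<rho>\<^sup>n\<close>. This bound yields both the convergence of the power series on the
  whole disc and the concentration of the normalised monomials at its boundary.\<close>

lemma moment_lower_bound:
  assumes "0 \<le> \<rho>" "ereal \<rho> < R"
  obtains \<kappa> where "\<kappa> > 0" "\<And>n. c n \<ge> \<kappa> * \<rho> ^ n"
proof -
  obtain x where x: "ereal \<rho> < ereal x" "ereal x < R"
    using assms(2) ereal_dense2[of "ereal \<rho>" R] by auto
  define U where "U = {r. \<rho> < r \<and> ereal r < R}"
  have "U = {\<rho><..} \<inter> ereal -` {..<R}" by (auto simp: U_def)
  then have U: "open U" by (auto intro!: open_vimage continuous_intros)
  then have [measurable]: "U \<in> sets borel" by simp
  have "x \<in> measure_support (density lebesgue (\<lambda>r. ennreal (\<mu> r)))"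
    unfolding mu_supp using x assms by auto
  then have "emeasure (density lebesgue (\<lambda>r. ennreal (\<mu> r))) U > 0"
    using U x unfolding measure_support_def U_def by auto
  then have pos: "(\<integral>\<^sup>+r. ennreal (\<mu> r) * indicator U r \<partial>lborel) > 0"
    using mu_meas by (subst (asm) emeasure_density) (auto simp: nn_integral_completion)
  define K where "K = (\<integral>\<^sup>+r. ennreal (\<mu>\<^sub>B r) * indicator U r \<partial>lborel)"
  have "K = (\<integral>\<^sup>+r. ennreal (\<mu> r) * indicator U r \<partial>lborel)"
    unfolding K_def using mu_borel_AE by (intro nn_integral_cong_AE) (auto elim!: eventually_mono)
  with pos have K: "K > 0" by simp
  have le: "ennreal (\<rho> ^ n) * K \<le> ennreal (c n)" for n
  proof -
    have "ennreal (\<rho> ^ n) * K = (\<integral>\<^sup>+r. ennreal (\<rho> ^ n) * (ennreal (\<mu>\<^sub>B r) * indicator U r) \<partial>lborel)"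
      unfolding K_def by (rule nn_integral_cmult[symmetric]) measurable
    also have "\<dots> \<le> (\<integral>\<^sup>+r. ennreal (r ^ n * \<mu>\<^sub>B r) * indicator {r. 0 < r \<and> ereal r < R} r \<partial>lborel)"
      using assms
      by (intro nn_integral_mono)
        (auto simp: U_def mu_borel_nonneg split: split_indicator simp flip: ennreal_mult
          intro!: ennreal_leI mult_right_mono power_mono)
    finally show ?thesis by (simp add: nn_integral_moment)
  qed
  have fin: "K < \<infinity>" using le[of 0] by (auto simp: less_top[symmetric] top_unique)
  define \<kappa> where "\<kappa> = enn2real K"
  have K\<kappa>: "K = ennreal \<kappa>" using fin by (simp add: \<kappa>_def)
  have "\<kappa> > 0" using K by (simp add: K\<kappa>)
  moreover have "c n \<ge> \<kappa> * \<rho> ^ n" for n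
    using le[of n] c_pos[of n] \<open>\<kappa> > 0\<close> assms(1) by (simp add: K\<kappa> mult.commute flip: ennreal_mult)
  ultimately show ?thesis by (rule that)
qed

text \<open>The probability measures with densities \<open>r\<^sup>2\<^sup>k / c (2 k + 1)\<close> concentrate at \<open>R\<close>: for
  \<open>\<rho> < \<rho>' < R\<close> their mass below \<open>\<rho>\<close> is at most a constant times \<open>(\<rho> / \<rho>')\<^sup>2\<^sup>k\<close>. The limit of \<open>\<phi>\<close>
  is required only almost everywhere, so that \<open>\<phi>\<close> may be a Borel version of the function of
  interest.\<close>

lemma radial_average_tendsto:
  fixes \<phi> :: "real \<Rightarrow> real"
  assumes \<phi> [measurable]: "\<phi> \<in> borel_measurable borel" and B: "\<And>r. \<bar>\<phi> r\<bar> \<le> B"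
    and lim: "\<And>\<epsilon>. \<epsilon> > 0 \<Longrightarrow> \<exists>\<rho>. ereal \<rho> < R \<and> (AE r in rad. \<rho> < r \<longrightarrow> \<bar>\<phi> r - L\<bar> \<le> \<epsilon>)"
  shows "(\<lambda>k. (\<integral>r. \<phi> r * r ^ (2 * k) \<partial>rad) / c (2 * k + 1)) \<longlonglongrightarrow> L"
proof (rule LIMSEQ_I)
  fix e :: real assume "e > 0"
  then obtain \<rho>0 where \<rho>0: "ereal \<rho>0 < R" "AE r in rad. \<rho>0 < r \<longrightarrow> \<bar>\<phi> r - L\<bar> \<le> e / 2"
    using lim[of "e / 2"] by auto
  define \<rho> where "\<rho> = max 0 \<rho>0"
  have \<rho>: "\<rho> \<ge> 0" "ereal \<rho> < R" "AE r in rad. \<rho> < r \<longrightarrow> \<bar>\<phi> r - L\<bar> \<le> e / 2"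
    using \<rho>0 R_pos by (auto simp: \<rho>_def max_def zero_ereal_def)
  obtain \<rho>' where \<rho>': "\<rho> < \<rho>'" "ereal \<rho>' < R"
    using \<rho>(2) ereal_dense2[of "ereal \<rho>" R] by auto
  obtain \<kappa> where \<kappa>: "\<kappa> > 0" "\<And>n. c n \<ge> \<kappa> * \<rho>' ^ n"
    using moment_lower_bound[of \<rho>'] \<rho> \<rho>' by auto
  define D where "D = (B + \<bar>L\<bar>) * c 1"
  have B0: "B \<ge> 0" using B[of 0] by linarith
  have D0: "D \<ge> 0" unfolding D_def using B0 c_pos[of 1] by simp
  have int [simp]: "integrable rad (\<lambda>r. r ^ n)" and val: "(\<integral>r. r ^ n \<partial>rad) = c (n + 1)" for n
    using has_bochner_integral_rad_power[of n] by (auto simp: has_bochner_integral_iff)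
  have bound: "\<bar>(\<integral>r. \<phi> r * r ^ (2 * k) \<partial>rad) / c (2 * k + 1) - L\<bar> \<le> e / 2 + D / (\<kappa> * \<rho>') * ((\<rho> / \<rho>') ^ 2) ^ k" for k
  proof -
    have i1: "integrable rad (\<lambda>r. \<phi> r * r ^ (2 * k))"
    proof (rule Bochner_Integration.integrable_bound)
      show "integrable rad (\<lambda>r. B * r ^ (2 * k))" by simp
      show "AE r in rad. norm (\<phi> r * r ^ (2 * k)) \<le> norm (B * r ^ (2 * k))"
        using B B0 by (auto simp: abs_mult intro!: mult_right_mono)
    qed simp
    have "(\<integral>r. \<phi> r * r ^ (2 * k) \<partial>rad) - L * c (2 * k + 1) = (\<integral>r. (\<phi> r - L) * r ^ (2 * k) \<partial>rad)"
      using i1 by (simp add: left_diff_distrib val)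
    also have "\<bar>\<dots>\<bar> \<le> (\<integral>r. e / 2 * r ^ (2 * k) + (B + \<bar>L\<bar>) * \<rho> ^ (2 * k) \<partial>rad)"
    proof (rule integral_abs_bound[THEN order_trans, OF integral_mono_AE])
      show "integrable rad (\<lambda>r. \<bar>(\<phi> r - L) * r ^ (2 * k)\<bar>)"
        using i1 by (simp add: left_diff_distrib)
      show "integrable rad (\<lambda>r. e / 2 * r ^ (2 * k) + (B + \<bar>L\<bar>) * \<rho> ^ (2 * k))" by simp
      show "AE r in rad. \<bar>(\<phi> r - L) * r ^ (2 * k)\<bar> \<le> e / 2 * r ^ (2 * k) + (B + \<bar>L\<bar>) * \<rho> ^ (2 * k)"
        using AE_rad \<rho>(3)
      proof eventually_elim
        case (elim r)
        show ?case
        proof (cases "\<rho> < r")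
          case True
          then have "\<bar>(\<phi> r - L) * r ^ (2 * k)\<bar> \<le> e / 2 * r ^ (2 * k)"
            using elim by (auto simp: abs_mult intro!: mult_right_mono)
          also have "\<dots> \<le> e / 2 * r ^ (2 * k) + (B + \<bar>L\<bar>) * \<rho> ^ (2 * k)"
            using B0 \<rho>(1) by simp
          finally show ?thesis .
        next
          case False
          have "\<bar>\<phi> r - L\<bar> \<le> B + \<bar>L\<bar>" using B[of r] by linarith
          then have "\<bar>(\<phi> r - L) * r ^ (2 * k)\<bar> \<le> (B + \<bar>L\<bar>) * \<rho> ^ (2 * k)"
            using elim False by (auto simp: abs_mult intro!: mult_mono power_mono)
          then show ?thesis using \<open>e > 0\<close> by (simp add: add_increasing)
        qed
      qed
    qed
    also have "\<dots> = e / 2 * c (2 * k + 1) + D * \<rho> ^ (2 * k)"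
      using val[of 0] by (simp add: val D_def)
    finally have "\<bar>(\<integral>r. \<phi> r * r ^ (2 * k) \<partial>rad) - L * c (2 * k + 1)\<bar> / c (2 * k + 1) \<le>
      (e / 2 * c (2 * k + 1) + D * \<rho> ^ (2 * k)) / c (2 * k + 1)"
      using c_pos[of "2 * k + 1"] by (intro divide_right_mono) auto
    also have "\<dots> = e / 2 + D * \<rho> ^ (2 * k) / c (2 * k + 1)"
      using c_pos[of "2 * k + 1"] by (simp add: field_simps)
    also have "D * \<rho> ^ (2 * k) / c (2 * k + 1) \<le> D * \<rho> ^ (2 * k) / (\<kappa> * \<rho>' ^ (2 * k + 1))"
      using \<kappa>(2)[of "2*k+1"] \<kappa>(1) D0 \<rho>(1) \<rho>' c_pos[of "2*k+1"] by (intro divide_left_mono) auto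
    also have "\<dots> = D / (\<kappa> * \<rho>') * ((\<rho> / \<rho>') ^ 2) ^ k"
      by (simp add: power_mult power_divide)
    also have "\<bar>(\<integral>r. \<phi> r * r ^ (2 * k) \<partial>rad) - L * c (2 * k + 1)\<bar> / c (2 * k + 1) =
      \<bar>((\<integral>r. \<phi> r * r ^ (2 * k) \<partial>rad) - L * c (2 * k + 1)) / c (2 * k + 1)\<bar>"
      using c_pos[of "2*k+1"] by simp
    also have "((\<integral>r. \<phi> r * r ^ (2 * k) \<partial>rad) - L * c (2 * k + 1)) / c (2 * k + 1) = (\<integral>r. \<phi> r * r ^ (2 * k) \<partial>rad) / c (2 * k + 1) - L"
      using c_pos[of "2*k+1"] by (simp add: field_simps)
    finally show ?thesis by simp
  qed
  have "\<rho> / \<rho>' < 1" "\<rho> / \<rho>' \<ge> 0" using \<rho> \<rho>' by auto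
  then have "(\<rho> / \<rho>') ^ 2 < 1" "(\<rho> / \<rho>') ^ 2 \<ge> 0" by (auto simp: power_less_one_iff abs_square_less_1)
  then have "(\<lambda>k. ((\<rho> / \<rho>') ^ 2) ^ k) \<longlonglongrightarrow> 0" by (rule LIMSEQ_realpow_zero[rotated])
  then have "(\<lambda>k. e / 2 + D / (\<kappa> * \<rho>') * ((\<rho> / \<rho>') ^ 2) ^ k) \<longlonglongrightarrow> e / 2 + D / (\<kappa> * \<rho>') * 0"
    by (intro tendsto_add tendsto_mult tendsto_const)
  then have "\<forall>\<^sub>F k in sequentially. e / 2 + D / (\<kappa> * \<rho>') * ((\<rho> / \<rho>') ^ 2) ^ k < e"
    by (rule order_tendstoD(2)) (use \<open>e > 0\<close> in simp)
  then obtain k0 where k0: "\<And>k. k \<ge> k0 \<Longrightarrow> e / 2 + D / (\<kappa> * \<rho>') * ((\<rho> / \<rho>') ^ 2) ^ k < e"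
    unfolding eventually_sequentially by blast
  show "\<exists>k0. \<forall>k\<ge>k0. norm ((\<integral>r. \<phi> r * r ^ (2 * k) \<partial>rad) / c (2 * k + 1) - L) < e"
  proof (intro exI[of _ k0] allI impI)
    fix k assume "k \<ge> k0"
    from bound[of k] k0[OF this]
    show "norm ((\<integral>r. \<phi> r * r ^ (2 * k) \<partial>rad) / c (2 * k + 1) - L) < e"
      unfolding real_norm_def by (rule order_le_less_trans)
  qed
qed

end

section \<open>Averages of a symbol with radial limits\<close>

context radial_weight begin

lemma AE_unif_iff: "(AE t in unif. P t) \<longleftrightarrow> (AE t in lebesgue_on {0..<2 * pi}. P t)"
  unfolding unif_def
  by (subst AE_density) (auto simp: AE_restrict_space_iff AE_completion_iff split: split_indicator
      intro!: AE_cong)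

lemma integral_unif:
  fixes g :: "real \<Rightarrow> real"
  assumes [measurable]: "g \<in> borel_measurable borel"
  shows "(\<integral>t. g t \<partial>unif) = (\<integral>t. g t \<partial>lebesgue_on {0..<2 * pi}) / (2 * pi)"
proof -
  have U: "unif = density lborel (\<lambda>t. ennreal (1 / (2 * pi) * indicator {0..<2 * pi} t))"
    unfolding unif_def by (intro arg_cong[where f = "density lborel"]) (auto split: split_indicator)
  have "(\<integral>t. g t \<partial>unif) = (\<integral>t. (indicator {0..<2 * pi} t *\<^sub>R g t) / (2 * pi) \<partial>lborel)"
    unfolding U by (subst integral_density) auto
  also have "\<dots> = (\<integral>t. indicator {0..<2 * pi} t *\<^sub>R g t \<partial>lborel) / (2 * pi)"
    by (rule integral_divide_zero)
  finally show ?thesis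
    by (simp add: integral_restrict_space integral_completion)
qed

text \<open>A common form of the two cases of \<open>to_radius\<close>.\<close>

lemma to_radius_eventuallyD:
  assumes "\<forall>\<^sub>F r in to_radius R. P r"
  shows "\<exists>\<rho>. ereal \<rho> < R \<and> (\<forall>r. \<rho> < r \<and> ereal r < R \<longrightarrow> P r)"
proof (cases R)
  case (real x)
  then have "\<forall>\<^sub>F r in at_left x. P r" using assms by (simp add: to_radius_def)
  then obtain b where "b < x" "\<forall>y>b. y < x \<longrightarrow> P y"
    using eventually_at_left[of "x - 1" x P] by auto
  then show ?thesis using real by (intro exI[of _ b]) auto
next
  case PInf
  then have "\<forall>\<^sub>F r in at_top. P r" using assms by (simp add: to_radius_def)
  then show ?thesis using PInf by (auto simp: eventually_at_top_dense)
qed (use R_pos in auto)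

text \<open>In polar coordinates the average over the disc is an angular integral of radial averages,
  and these converge to the radial limit. Fubini needs a Borel function, so \<open>F\<close> is replaced by a
  Borel version; for almost every angle the two agree at almost every radius, so the radial
  averages have the same limit. Measurability of \<open>F'\<close> is not automatic, since a single circle
  \<open>\<bar>z\<bar> = r\<close> is a null set; it is obtained from the radial averages, which are measurable in the
  angle.\<close>

lemma disc_average_tendsto:
  fixes F :: "complex \<Rightarrow> real" and F' :: "real \<Rightarrow> real"
  assumes F: "F \<in> borel_measurable (lebesgue_on (disc R))"
    and B: "\<And>z. z \<in> disc R \<Longrightarrow> \<bar>F z\<bar> \<le> B"
    and lim: "AE t in lebesgue_on {0..<2 * pi}. ((\<lambda>r. F (rcis r t)) \<longlongrightarrow> F' t) (to_radius R)"
  shows radial_limit_measurable: "F' \<in> borel_measurable (lebesgue_on {0..<2 * pi})"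
    and "(\<lambda>k. (\<integral>z. F z * cmod z ^ (2 * k) \<partial>M) / c (2 * k + 1))
           \<longlonglongrightarrow> (\<integral>t. F' t \<partial>lebesgue_on {0..<2 * pi}) / (2 * pi)"
proof -
  have "0 \<in> disc R" using R_pos by (simp add: disc_def zero_ereal_def)
  then have B0: "B \<ge> 0" using B[of 0] by linarith
  have "(\<lambda>z. indicator (disc R) z *\<^sub>R F z) \<in> borel_measurable lebesgue"
    using F by (subst (asm) borel_measurable_restrict_space_iff) auto
  then obtain g where g: "g \<in> borel_measurable lborel" "AE z in lborel. indicator (disc R) z *\<^sub>R F z = g z"
    using completion_ex_borel_measurable_real by blast
  \<comment> \<open>A Borel version of \<open>F\<close>, clipped so that the bound holds everywhere.\<close>
  define G where "G z = max (- B) (min B (g z))" for z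
  have G [measurable]: "G \<in> borel_measurable borel" using g(1) unfolding G_def by simp
  have GB: "\<bar>G z\<bar> \<le> B" for z using B0 by (auto simp: G_def)
  have "AE z in lborel. z \<in> disc R \<longrightarrow> F z = G z"
    using g(2) by eventually_elim (use B in \<open>fastforce simp: G_def\<close>)
  then obtain N where N: "\<And>z. z \<in> space lborel - N \<Longrightarrow> z \<in> disc R \<longrightarrow> F z = G z" "N \<in> null_sets lborel"
    by (rule AE_E3) blast
  have [measurable]: "N \<in> sets borel" using N(2) by auto
  have NM: "AE z in M. z \<notin> N"
    unfolding disc_measure_def using AE_not_in[OF N(2)]
    by (subst AE_density) (auto simp: AE_restrict_space_iff AE_completion_iff elim!: eventually_mono)
  then have "AE z in distr M borel (\<lambda>z. z). z \<notin> N"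
    using id_M by (subst AE_distr_iff) auto
  then have "AE p in rad \<Otimes>\<^sub>M unif. rcis (fst p) (snd p) \<notin> N"
    unfolding distr_polar by (subst (asm) AE_distr_iff) auto
  then have "AE r in rad. AE t in unif. rcis r t \<notin> N"
    by (rule polar.AE_pair[where Q = "\<lambda>p. rcis (fst p) (snd p) \<notin> N", simplified])
  moreover have "{p \<in> space (rad \<Otimes>\<^sub>M unif). rcis (fst p) (snd p) \<notin> N} \<in> sets (rad \<Otimes>\<^sub>M unif)"
    by measurable
  ultimately have Nt: "AE t in unif. AE r in rad. rcis r t \<notin> N"
    using polar.AE_commute[of "\<lambda>r t. rcis r t \<notin> N"] by blast
  define h where "h k t = (\<integral>r. G (rcis r t) * r ^ (2 * k) \<partial>rad) / c (2 * k + 1)" for k t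
  have h [measurable]: "h k \<in> borel_measurable borel" for k unfolding h_def by measurable
  have conv: "AE t in unif. (\<lambda>k. h k t) \<longlonglongrightarrow> F' t"
    using Nt lim[folded AE_unif_iff]
  proof eventually_elim
    case (elim t)
    show ?case unfolding h_def
    proof (rule radial_average_tendsto)
      fix e :: real assume "e > 0"
      then have "\<forall>\<^sub>F r in to_radius R. dist (F (rcis r t)) (F' t) < e"
        using elim(2) by (rule tendstoD[rotated])
      from to_radius_eventuallyD[OF this]
      obtain \<rho> where \<rho>: "ereal \<rho> < R" "\<And>r. \<rho> < r \<Longrightarrow> ereal r < R \<Longrightarrow> dist (F (rcis r t)) (F' t) < e"
        by blast
      have "AE r in rad. \<rho> < r \<longrightarrow> \<bar>G (rcis r t) - F' t\<bar> \<le> e"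
        using elim(1) AE_rad
      proof eventually_elim
        case (elim r)
        then have "F (rcis r t) = G (rcis r t)"
          using N(1)[of "rcis r t"] by (auto simp: disc_def)
        then show ?case using \<rho>(2)[of r] elim by (auto simp: dist_real_def)
      qed
      then show "\<exists>\<rho>. ereal \<rho> < R \<and> (AE r in rad. \<rho> < r \<longrightarrow> \<bar>G (rcis r t) - F' t\<bar> \<le> e)"
        using \<rho>(1) by blast
    qed (use GB in auto)
  qed
  define H where "H t = lim (\<lambda>k. h k t)" for t
  have H [measurable]: "H \<in> borel_measurable borel" unfolding H_def by measurable
  have HF: "AE t in unif. H t = F' t"
    using conv by eventually_elim (simp add: H_def limI)
  have "AE t in lebesgue. indicator {0..<2 * pi} t *\<^sub>R H t = indicator {0..<2 * pi} t *\<^sub>R F' t"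
    using HF[unfolded AE_unif_iff] by (auto simp: AE_restrict_space_iff elim!: eventually_mono split: split_indicator)
  moreover have "(\<lambda>t. indicator {0..<2 * pi} t *\<^sub>R H t) \<in> borel_measurable lebesgue"
    by (rule measurable_completion) simp
  ultimately have "(\<lambda>t. indicator {0..<2 * pi} t *\<^sub>R F' t) \<in> borel_measurable lebesgue"
    by (rule borel_measurable_AE[rotated])
  then show F': "F' \<in> borel_measurable (lebesgue_on {0..<2 * pi})"
    by (subst borel_measurable_restrict_space_iff) auto
  have hB: "\<bar>h k t\<bar> \<le> B" for k t
  proof -
    have "\<bar>\<integral>r. G (rcis r t) * r ^ (2 * k) \<partial>rad\<bar> \<le> (\<integral>r. B * r ^ (2 * k) \<partial>rad)"
      using has_bochner_integral_rad_power[of "2 * k"] GB B0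
      by (intro integral_abs_bound[THEN order_trans] integral_mono_AE')
        (auto simp: has_bochner_integral_iff abs_mult intro!: mult_right_mono)
    then show ?thesis
      using has_bochner_integral_rad_power[of "2 * k"] c_pos[of "2 * k + 1"]
      by (simp add: h_def has_bochner_integral_iff field_simps)
  qed
  have "(\<lambda>k. \<integral>t. h k t \<partial>unif) \<longlonglongrightarrow> (\<integral>t. H t \<partial>unif)"
  proof (rule integral_dominated_convergence[where w = "\<lambda>_. B"])
    show "AE t in unif. (\<lambda>k. h k t) \<longlonglongrightarrow> H t"
      using conv HF by eventually_elim simp
  qed (use hB in auto)
  also have "(\<integral>t. H t \<partial>unif) = (\<integral>t. F' t \<partial>lebesgue_on {0..<2 * pi}) / (2 * pi)"
  proof -
    have "(\<integral>t. H t \<partial>lebesgue_on {0..<2 * pi}) = (\<integral>t. F' t \<partial>lebesgue_on {0..<2 * pi})"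
      by (rule integral_cong_AE[OF _ F' HF[unfolded AE_unif_iff]])
        (intro measurable_restrict_space1 measurable_completion, simp)
    then show ?thesis by (simp add: integral_unif)
  qed
  also have "(\<lambda>k. \<integral>t. h k t \<partial>unif) = (\<lambda>k. (\<integral>z. F z * cmod z ^ (2 * k) \<partial>M) / c (2 * k + 1))"
  proof
    fix k
    have FM: "F \<in> borel_measurable M"
      using F sets_M by (simp cong: measurable_cong_sets)
    have GM: "G \<in> borel_measurable M" "cmod \<in> borel_measurable M"
      by (rule borel_imp_M, simp)+
    have "(\<integral>z. F z * cmod z ^ (2 * k) \<partial>M) = (\<integral>z. G z * cmod z ^ (2 * k) \<partial>M)"
    proof (rule integral_cong_AE)
      show "AE z in M. F z * cmod z ^ (2 * k) = G z * cmod z ^ (2 * k)"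
        using NM AE_space[of M] by eventually_elim (use N(1) in auto)
    qed (use FM GM in measurable)
    also have "\<dots> = (\<integral>p. G (rcis (fst p) (snd p)) * cmod (rcis (fst p) (snd p)) ^ (2 * k) \<partial>(rad \<Otimes>\<^sub>M unif))"
      by (rule integral_M_polar) simp
    also have "\<dots> = (\<integral>p. (case p of (r, t) \<Rightarrow> G (rcis r t) * r ^ (2 * k)) \<partial>(rad \<Otimes>\<^sub>M unif))"
      by (intro Bochner_Integration.integral_cong) (auto simp: case_prod_unfold power_even_abs)
    also have "\<dots> = (\<integral>t. (\<integral>r. G (rcis r t) * r ^ (2 * k) \<partial>rad) \<partial>unif)"
    proof (rule polar.integral_snd[symmetric])
      have "integrable M (\<lambda>z. G z * cmod z ^ (2 * k))"
      proof (rule Bochner_Integration.integrable_bound)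
        show "integrable M (\<lambda>z. B * cmod z ^ (2 * k))"
          using has_bochner_integral_cmod_power[of "2 * k"] by (simp add: has_bochner_integral_iff)
        show "AE z in M. norm (G z * cmod z ^ (2 * k)) \<le> norm (B * cmod z ^ (2 * k))"
          using GB B0 by (auto simp: abs_mult intro!: mult_right_mono)
      qed (use GM in measurable)
      then show "integrable (rad \<Otimes>\<^sub>M unif) (\<lambda>(r, t). G (rcis r t) * r ^ (2 * k))"
        by (subst (asm) integrable_M_polar) (auto simp: case_prod_unfold power_even_abs)
    qed
    finally show "(\<integral>t. h k t \<partial>unif) = (\<integral>z. F z * cmod z ^ (2 * k) \<partial>M) / c (2 * k + 1)"
      by (simp add: h_def)
  qed
  finally show "(\<lambda>k. (\<integral>z. F z * cmod z ^ (2 * k) \<partial>M) / c (2 * k + 1))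
           \<longlonglongrightarrow> (\<integral>t. F' t \<partial>lebesgue_on {0..<2 * pi}) / (2 * pi)" .
qed

end

section \<open>Orthonormal families and eigenvalue sums\<close>

definition square_integrable :: "'a measure \<Rightarrow> ('a \<Rightarrow> complex) \<Rightarrow> bool" where
  "square_integrable M f \<longleftrightarrow> f \<in> borel_measurable M \<and> integrable M (\<lambda>z. (cmod (f z))\<^sup>2)"

definition L2_inner :: "'a measure \<Rightarrow> ('a \<Rightarrow> complex) \<Rightarrow> ('a \<Rightarrow> complex) \<Rightarrow> complex" where
  "L2_inner M f g = (\<integral>z. f z * cnj (g z) \<partial>M)"

definition L2_normsq :: "'a measure \<Rightarrow> ('a \<Rightarrow> complex) \<Rightarrow> real" where
  "L2_normsq M f = (\<integral>z. (cmod (f z))\<^sup>2 \<partial>M)"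

definition orthonormal_on :: "'a measure \<Rightarrow> 'i set \<Rightarrow> ('i \<Rightarrow> 'a \<Rightarrow> complex) \<Rightarrow> bool" where
  "orthonormal_on M I e \<longleftrightarrow> (\<forall>i\<in>I. square_integrable M (e i)) \<and>
     (\<forall>i\<in>I. \<forall>j\<in>I. L2_inner M (e i) (e j) = (if i = j then 1 else 0))"

lemma square_integrable_measurable: "square_integrable M f \<Longrightarrow> f \<in> borel_measurable M"
  by (simp add: square_integrable_def)

lemma square_integrable_bound:
  assumes "square_integrable M g" "f \<in> borel_measurable M"
    and "AE z in M. cmod (f z) \<le> K * cmod (g z)"
  shows "square_integrable M f"
  unfolding square_integrable_def
proof
  show "integrable M (\<lambda>z. (cmod (f z))\<^sup>2)"
  proof (rule Bochner_Integration.integrable_bound)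
    show "integrable M (\<lambda>z. K\<^sup>2 * (cmod (g z))\<^sup>2)"
      using assms(1) by (simp add: square_integrable_def)
    show "AE z in M. norm ((cmod (f z))\<^sup>2) \<le> norm (K\<^sup>2 * (cmod (g z))\<^sup>2)"
      using assms(3)
      by eventually_elim (simp add: power_mono flip: power_mult_distrib)
  qed (use assms(2) in measurable)
qed fact

lemma square_integrable_mult_bounded:
  assumes "square_integrable M g" "s \<in> borel_measurable M" "AE z in M. cmod (s z) \<le> K"
  shows "square_integrable M (\<lambda>z. s z * g z)"
  using assms(3)
  by (intro square_integrable_bound[OF assms(1), of _ K] borel_measurable_times assms(2)
      square_integrable_measurable[OF assms(1)])
    (auto simp: norm_mult intro!: mult_right_mono elim!: eventually_mono)

lemma square_integrable_cmult:
  "square_integrable M f \<Longrightarrow> square_integrable M (\<lambda>z. a * f z)"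
  by (rule square_integrable_mult_bounded[where K = "cmod a"]) auto

lemma integrable_L2_inner:
  assumes "square_integrable M f" "square_integrable M g"
  shows "integrable M (\<lambda>z. f z * cnj (g z))"
proof (rule Bochner_Integration.integrable_bound)
  show "integrable M (\<lambda>z. (cmod (f z))\<^sup>2 + (cmod (g z))\<^sup>2)"
    using assms by (simp add: square_integrable_def)
  show "AE z in M. norm (f z * cnj (g z)) \<le> norm ((cmod (f z))\<^sup>2 + (cmod (g z))\<^sup>2)"
  proof (rule AE_I2)
    fix z
    have "0 \<le> (cmod (f z) - cmod (g z))\<^sup>2 + (cmod (f z))\<^sup>2 + (cmod (g z))\<^sup>2" by simp
    then show "norm (f z * cnj (g z)) \<le> norm ((cmod (f z))\<^sup>2 + (cmod (g z))\<^sup>2)"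
      by (simp add: norm_mult power2_diff)
  qed
qed (use assms in \<open>auto simp: square_integrable_def\<close>)

lemma square_integrable_add:
  assumes "square_integrable M f" "square_integrable M g"
  shows "square_integrable M (\<lambda>z. f z + g z)"
  unfolding square_integrable_def
proof
  show m: "(\<lambda>z. f z + g z) \<in> borel_measurable M"
    using assms by (intro borel_measurable_add square_integrable_measurable)
  show "integrable M (\<lambda>z. (cmod (f z + g z))\<^sup>2)"
  proof (rule Bochner_Integration.integrable_bound)
    show "integrable M (\<lambda>z. 2 * (cmod (f z))\<^sup>2 + 2 * (cmod (g z))\<^sup>2)"
      using assms by (simp add: square_integrable_def)
    show "AE z in M. norm ((cmod (f z + g z))\<^sup>2) \<le> norm (2 * (cmod (f z))\<^sup>2 + 2 * (cmod (g z))\<^sup>2)"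
    proof (rule AE_I2)
      fix z
      have "(cmod (f z + g z))\<^sup>2 \<le> (cmod (f z) + cmod (g z))\<^sup>2"
        by (intro power_mono norm_triangle_ineq) simp
      moreover have "0 \<le> (cmod (f z) - cmod (g z))\<^sup>2" by simp
      ultimately show "norm ((cmod (f z + g z))\<^sup>2) \<le> norm (2 * (cmod (f z))\<^sup>2 + 2 * (cmod (g z))\<^sup>2)"
        by (simp add: power2_diff power2_sum)
    qed
  qed (use m in measurable)
qed

lemma square_integrable_diff:
  assumes "square_integrable M f" "square_integrable M g"
  shows "square_integrable M (\<lambda>z. f z - g z)"
  using square_integrable_add[OF assms(1) square_integrable_cmult[OF assms(2), of "-1"]] by simp

lemma square_integrable_zero: "square_integrable M (\<lambda>z. 0)"
  by (simp add: square_integrable_def)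

lemma square_integrable_sum:
  assumes "\<And>i. i \<in> I \<Longrightarrow> square_integrable M (f i)"
  shows "square_integrable M (\<lambda>z. \<Sum>i\<in>I. f i z)"
  using assms
  by (induction I rule: infinite_finite_induct)
    (auto intro: square_integrable_add square_integrable_zero)

lemmas square_integrable_intros =
  square_integrable_add square_integrable_diff square_integrable_cmult square_integrable_sum

lemma L2_inner_add_left:
  "square_integrable M f \<Longrightarrow> square_integrable M g \<Longrightarrow> square_integrable M h \<Longrightarrow>
    L2_inner M (\<lambda>z. f z + g z) h = L2_inner M f h + L2_inner M g h"
  using integrable_L2_inner[of M f h] integrable_L2_inner[of M g h]
  by (simp add: L2_inner_def distrib_right)

lemma L2_inner_diff_left:
  "square_integrable M f \<Longrightarrow> square_integrable M g \<Longrightarrow> square_integrable M h \<Longrightarrow>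
    L2_inner M (\<lambda>z. f z - g z) h = L2_inner M f h - L2_inner M g h"
  using integrable_L2_inner[of M f h] integrable_L2_inner[of M g h]
  by (simp add: L2_inner_def left_diff_distrib)

lemma L2_inner_cmult_left: "L2_inner M (\<lambda>z. a * f z) h = a * L2_inner M f h"
  by (simp add: L2_inner_def mult.assoc)

lemma L2_inner_commute: "L2_inner M f g = cnj (L2_inner M g f)"
proof -
  have "(\<integral>z. f z * cnj (g z) \<partial>M) = (\<integral>z. cnj (g z * cnj (f z)) \<partial>M)"
    by (simp add: mult.commute)
  also have "\<dots> = cnj (\<integral>z. g z * cnj (f z) \<partial>M)" by (rule Bochner_Integration.integral_cnj)
  finally show ?thesis unfolding L2_inner_def .
qed

lemma norm_L2_inner_commute: "cmod (L2_inner M f g) = cmod (L2_inner M g f)"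
  by (subst L2_inner_commute) simp

lemma L2_inner_cmult_right: "L2_inner M f (\<lambda>z. a * h z) = cnj a * L2_inner M f h"
  by (metis L2_inner_cmult_left L2_inner_commute complex_cnj_mult)

lemma L2_inner_sum_left:
  assumes "\<And>i. i \<in> I \<Longrightarrow> square_integrable M (f i)" "square_integrable M h"
  shows "L2_inner M (\<lambda>z. \<Sum>i\<in>I. f i z) h = (\<Sum>i\<in>I. L2_inner M (f i) h)"
  using integrable_L2_inner[OF assms(1) assms(2)]
  by (simp add: L2_inner_def sum_distrib_right)

lemma L2_inner_sum_right:
  assumes "\<And>i. i \<in> I \<Longrightarrow> square_integrable M (f i)" "square_integrable M h"
  shows "L2_inner M h (\<lambda>z. \<Sum>i\<in>I. f i z) = (\<Sum>i\<in>I. L2_inner M h (f i))"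
proof -
  have "L2_inner M h (\<lambda>z. \<Sum>i\<in>I. f i z) = cnj (\<Sum>i\<in>I. L2_inner M (f i) h)"
    by (subst L2_inner_commute, subst L2_inner_sum_left) (auto simp: assms)
  also have "\<dots> = (\<Sum>i\<in>I. L2_inner M h (f i))"
    by (simp flip: L2_inner_commute)
  finally show ?thesis .
qed

lemma L2_inner_add_right:
  assumes "square_integrable M f" "square_integrable M g" "square_integrable M h"
  shows "L2_inner M h (\<lambda>z. f z + g z) = L2_inner M h f + L2_inner M h g"
proof -
  have "L2_inner M h (\<lambda>z. f z + g z) = cnj (L2_inner M f h + L2_inner M g h)"
    by (subst L2_inner_commute, subst L2_inner_add_left) (auto simp: assms)
  also have "\<dots> = L2_inner M h f + L2_inner M h g"
    by (simp flip: L2_inner_commute)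
  finally show ?thesis .
qed

lemma L2_inner_self: "L2_inner M f f = of_real (L2_normsq M f)"
  by (simp add: L2_inner_def L2_normsq_def complex_norm_square[symmetric] del: of_real_power)

lemma L2_normsq_nonneg: "L2_normsq M f \<ge> 0"
  by (simp add: L2_normsq_def)

lemma L2_normsq_add:
  assumes "square_integrable M f" "square_integrable M g"
  shows "L2_normsq M (\<lambda>z. f z + g z) = L2_normsq M f + L2_normsq M g + 2 * Re (L2_inner M f g)"
proof -
  note sq = assms square_integrable_add[OF assms]
  have "complex_of_real (L2_normsq M (\<lambda>z. f z + g z)) =
    of_real (L2_normsq M f) + of_real (L2_normsq M g) + (L2_inner M f g + cnj (L2_inner M f g))"
    unfolding L2_inner_self[symmetric] L2_inner_commute[of M g f, symmetric]
    by (simp add: L2_inner_add_left L2_inner_add_right sq)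
  then have "Re (complex_of_real (L2_normsq M (\<lambda>z. f z + g z))) =
    Re (of_real (L2_normsq M f) + of_real (L2_normsq M g) + (L2_inner M f g + cnj (L2_inner M f g)))"
    by (rule arg_cong)
  then show ?thesis by simp
qed

lemma L2_normsq_cmult: "L2_normsq M (\<lambda>z. a * f z) = (cmod a)\<^sup>2 * L2_normsq M f"
  by (simp add: L2_normsq_def norm_mult power_mult_distrib)

text \<open>A version of the Cauchy-Schwarz inequality with a free parameter, which suffices for
  passing to limits.\<close>

lemma L2_inner_le:
  assumes "square_integrable M f" "square_integrable M g" "\<epsilon> > 0"
  shows "cmod (L2_inner M f g) \<le> \<epsilon> * L2_normsq M f + L2_normsq M g / \<epsilon>"
proof -
  have "cmod (L2_inner M f g) \<le> (\<integral>z. \<epsilon> * (cmod (f z))\<^sup>2 + (cmod (g z))\<^sup>2 / \<epsilon> \<partial>M)"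
    unfolding L2_inner_def
  proof (rule integral_norm_bound[THEN order_trans, OF integral_mono])
    show "integrable M (\<lambda>z. norm (f z * cnj (g z)))"
      using integrable_L2_inner[OF assms(1,2)] by simp
    show "integrable M (\<lambda>z. \<epsilon> * (cmod (f z))\<^sup>2 + (cmod (g z))\<^sup>2 / \<epsilon>)"
      using assms by (simp add: square_integrable_def)
    fix z
    have "0 \<le> (\<epsilon> * cmod (f z) - cmod (g z))\<^sup>2 + (\<epsilon> * cmod (f z))\<^sup>2 + (cmod (g z))\<^sup>2" by simp
    then have "\<epsilon> * (cmod (f z) * cmod (g z)) \<le> \<epsilon> * (\<epsilon> * (cmod (f z))\<^sup>2) + (cmod (g z))\<^sup>2"
      by (simp add: power2_diff power_mult_distrib power2_eq_square[of \<epsilon>] mult_ac)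
    also have "\<dots> = \<epsilon> * (\<epsilon> * (cmod (f z))\<^sup>2 + (cmod (g z))\<^sup>2 / \<epsilon>)"
      using assms(3) by (simp add: distrib_left)
    finally have "cmod (f z) * cmod (g z) \<le> \<epsilon> * (cmod (f z))\<^sup>2 + (cmod (g z))\<^sup>2 / \<epsilon>"
      using assms(3) by simp
    then show "norm (f z * cnj (g z)) \<le> \<epsilon> * (cmod (f z))\<^sup>2 + (cmod (g z))\<^sup>2 / \<epsilon>"
      using assms(3) by (simp add: norm_mult)
  qed
  also have "\<dots> = \<epsilon> * L2_normsq M f + L2_normsq M g / \<epsilon>"
    using assms by (simp add: L2_normsq_def square_integrable_def)
  finally show ?thesis .
qed

lemma L2_inner_eq_0:
  assumes "square_integrable M f" "square_integrable M g" "L2_normsq M g = 0"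
  shows "L2_inner M f g = 0"
proof -
  have "cmod (L2_inner M f g) \<le> 0 + \<epsilon>" if "\<epsilon> > 0" for \<epsilon>
  proof -
    have d: "\<epsilon> / (1 + L2_normsq M f) > 0" using that L2_normsq_nonneg[of M f] by simp
    have "cmod (L2_inner M f g) \<le> \<epsilon> / (1 + L2_normsq M f) * L2_normsq M f"
      using L2_inner_le[OF assms(1,2) d] assms(3) by simp
    also have "\<dots> \<le> \<epsilon>" using that L2_normsq_nonneg[of M f] by (simp add: field_simps)
    finally show ?thesis by simp
  qed
  then have "cmod (L2_inner M f g) \<le> 0" by (rule field_le_epsilon)
  then show ?thesis by simp
qed

lemma orthonormal_on_L2_inner_sum:
  assumes "orthonormal_on M I e" "finite I" "J \<subseteq> I" "k \<in> I"
  shows "L2_inner M (\<lambda>z. \<Sum>i\<in>J. a i * e i z) (e k) = (if k \<in> J then a k else 0)"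
proof -
  have "L2_inner M (\<lambda>z. \<Sum>i\<in>J. a i * e i z) (e k) = (\<Sum>i\<in>J. a i * L2_inner M (e i) (e k))"
    using assms by (subst L2_inner_sum_left)
      (auto simp: orthonormal_on_def L2_inner_cmult_left intro!: square_integrable_cmult)
  also have "\<dots> = (\<Sum>i\<in>J. if i = k then a i else 0)"
    using assms by (intro sum.cong) (auto simp: orthonormal_on_def subset_eq)
  finally show ?thesis using finite_subset[OF assms(3,2)] by simp
qed

lemma orthonormal_on_normsq_sum:
  assumes "orthonormal_on M I e" "finite I"
  shows "L2_normsq M (\<lambda>z. \<Sum>i\<in>I. a i * e i z) = (\<Sum>i\<in>I. (cmod (a i))\<^sup>2)"
proof -
  let ?f = "\<lambda>z. \<Sum>i\<in>I. a i * e i z"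
  have sq: "square_integrable M (e i)" if "i \<in> I" for i using assms that by (simp add: orthonormal_on_def)
  have "complex_of_real (L2_normsq M ?f) = (\<Sum>i\<in>I. cnj (a i) * L2_inner M ?f (e i))"
    unfolding L2_inner_self[symmetric]
    by (subst L2_inner_sum_right) (auto simp: L2_inner_cmult_right sq intro!: square_integrable_intros)
  also have "\<dots> = (\<Sum>i\<in>I. cnj (a i) * a i)"
    using assms by (simp add: orthonormal_on_L2_inner_sum)
  also have "\<dots> = complex_of_real (\<Sum>i\<in>I. (cmod (a i))\<^sup>2)"
    by (simp add: complex_norm_square mult.commute del: of_real_power)
  finally show ?thesis by (simp only: of_real_eq_iff)
qed

lemma bessel_inequality:
  assumes e: "orthonormal_on M I e" "finite I" and g: "square_integrable M g"
  shows "(\<Sum>i\<in>I. (cmod (L2_inner M g (e i)))\<^sup>2) \<le> L2_normsq M g"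
proof -
  define S where "S z = (\<Sum>i\<in>I. L2_inner M g (e i) * e i z)" for z
  define u where "u z = g z - S z" for z
  have sq: "square_integrable M (e i)" if "i \<in> I" for i using e that by (simp add: orthonormal_on_def)
  have S: "square_integrable M S" unfolding S_def using sq by (intro square_integrable_intros)
  have u: "square_integrable M u" unfolding u_def using g S by (intro square_integrable_intros)
  have "L2_inner M u (e i) = 0" if "i \<in> I" for i
  proof -
    have "L2_inner M S (e i) = L2_inner M g (e i)"
      unfolding S_def using orthonormal_on_L2_inner_sum[OF e order_refl that] that by simp
    then show ?thesis
      unfolding u_def using that sq g S by (subst L2_inner_diff_left) auto
  qed
  then have "L2_inner M u S = 0"
    unfolding S_def using u sq
    by (subst L2_inner_sum_right) (auto simp: L2_inner_cmult_right intro!: square_integrable_intros)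
  then have "L2_normsq M (\<lambda>z. u z + S z) = L2_normsq M u + L2_normsq M S"
    using L2_normsq_add[OF u S] by simp
  moreover have "(\<lambda>z. u z + S z) = g" by (simp add: u_def)
  moreover have "L2_normsq M S = (\<Sum>i\<in>I. (cmod (L2_inner M g (e i)))\<^sup>2)"
    unfolding S_def by (rule orthonormal_on_normsq_sum) fact+
  ultimately show ?thesis using L2_normsq_nonneg[of M u] by simp
qed

text \<open>The left-hand side is the sum of the squared coefficients, with respect to \<open>v\<close>, of the
  function with coordinates \<open>cnj (w k)\<close> in \<open>e\<close>. So this is the Bessel inequality for \<open>v\<close>.\<close>

lemma orthonormal_change_of_basis_contraction:
  assumes e: "orthonormal_on M I e" "finite I" and v: "orthonormal_on M J v" "finite J"
    and U: "\<And>j. j \<in> J \<Longrightarrow> v j = (\<lambda>z. \<Sum>k\<in>I. U j k * e k z)"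
  shows "(\<Sum>j\<in>J. (cmod (\<Sum>k\<in>I. U j k * w k))\<^sup>2) \<le> (\<Sum>k\<in>I. (cmod (w k))\<^sup>2)"
proof -
  define f where "f z = (\<Sum>k\<in>I. cnj (w k) * e k z)" for z
  have sq: "square_integrable M (e i)" if "i \<in> I" for i using e that by (simp add: orthonormal_on_def)
  have f: "square_integrable M f" unfolding f_def using sq by (intro square_integrable_intros)
  have "L2_inner M (v j) f = (\<Sum>k\<in>I. U j k * w k)" if "j \<in> J" for j
  proof -
    have "L2_inner M (v j) f = (\<Sum>k\<in>I. w k * L2_inner M (v j) (e k))"
      unfolding f_def using that sq v(1)
      by (subst L2_inner_sum_right)
        (auto simp: L2_inner_cmult_right orthonormal_on_def intro!: square_integrable_intros)
    also have "\<dots> = (\<Sum>k\<in>I. w k * U j k)"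
      using e that by (simp add: U orthonormal_on_L2_inner_sum)
    finally show ?thesis by (simp add: mult.commute)
  qed
  then have "(\<Sum>j\<in>J. (cmod (\<Sum>k\<in>I. U j k * w k))\<^sup>2) = (\<Sum>j\<in>J. (cmod (L2_inner M f (v j)))\<^sup>2)"
    by (intro sum.cong) (auto simp: norm_L2_inner_commute[of M f])
  also have "\<dots> \<le> L2_normsq M f" by (rule bessel_inequality[OF v f])
  also have "\<dots> = (\<Sum>k\<in>I. (cmod (w k))\<^sup>2)"
    unfolding f_def using e by (simp add: orthonormal_on_normsq_sum)
  finally show ?thesis .
qed

text \<open>Trades a first moment for a second one.\<close>

lemma le_add_square_divide:
  fixes x \<epsilon> :: real
  assumes "\<epsilon> > 0"
  shows "x \<le> \<epsilon> + x\<^sup>2 / \<epsilon>"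
proof (cases "x \<le> \<epsilon>")
  case True
  then show ?thesis using assms by (simp add: add_increasing2)
next
  case False
  then have "x * \<epsilon> \<le> x * x" using assms by (intro mult_left_mono) auto
  then have "x \<le> x\<^sup>2 / \<epsilon>" using assms by (simp add: field_simps power2_eq_square)
  then show ?thesis using assms by simp
qed

text \<open>The heart of the proof. Under the probability measure \<open>\<bar>v\<^sub>j\<bar>\<^sup>2 dM\<close> the function \<open>\<sigma>\<close> has
  mean \<open>ev j\<close>, and its variance is the squared norm of \<open>q\<^sub>j = \<sigma> v\<^sub>j - ev j v\<^sub>j\<close>. So for
  Lipschitz \<open>f\<close> the value \<open>f (ev j)\<close> differs from the mean of \<open>f \<circ> \<sigma>\<close> by at most
  \<open>L (\<epsilon> + variance / \<epsilon>)\<close>. The function \<open>q\<^sub>j\<close> is the error of the best approximation to \<open>\<sigma> v\<^sub>j\<close>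
  in the span of \<open>e\<close>, hence no larger than the error of any linear approximation \<open>e\<^sub>k \<mapsto> h\<^sub>k\<close> to
  multiplication by \<open>\<sigma>\<close>; summed over \<open>j\<close>, the latter is controlled in the basis \<open>e\<close> because the
  change of basis is a contraction. For the same reason the densities \<open>\<Sum>\<bar>v\<^sub>j\<bar>\<^sup>2 \<le> \<Sum>\<bar>e\<^sub>k\<bar>\<^sup>2\<close> have
  equal mass and therefore agree almost everywhere.\<close>

lemma eigenvalue_sum_near_weighted_average:
  fixes \<sigma> :: "'a \<Rightarrow> real" and f :: "real \<Rightarrow> real"
  assumes e: "orthonormal_on M I e" "finite I" and v: "orthonormal_on M I v"
    and U: "\<And>j. j \<in> I \<Longrightarrow> v j = (\<lambda>z. \<Sum>k\<in>I. U j k * e k z)"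
    and \<sigma>: "\<sigma> \<in> borel_measurable M" "\<And>z. z \<in> space M \<Longrightarrow> \<bar>\<sigma> z\<bar> \<le> S"
    and eig: "\<And>j a. j \<in> I \<Longrightarrow>
      L2_inner M (\<lambda>z. of_real (\<sigma> z) * v j z - of_real (ev j) * v j z) (\<lambda>z. \<Sum>k\<in>I. a k * e k z) = 0"
    and h: "\<And>k. k \<in> I \<Longrightarrow> h k = (\<lambda>z. \<Sum>l\<in>I. H k l * e l z)"
    and f: "f \<in> borel_measurable borel" "\<And>x. \<bar>f x\<bar> \<le> B" "\<And>x y. \<bar>f x - f y\<bar> \<le> L * \<bar>x - y\<bar>" "L \<ge> 0"
    and \<epsilon>: "\<epsilon> > 0"
  shows "\<bar>(\<Sum>j\<in>I. f (ev j)) - (\<Sum>k\<in>I. \<integral>z. f (\<sigma> z) * (cmod (e k z))\<^sup>2 \<partial>M)\<bar> \<le>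
    L * (real (card I) * \<epsilon> + (\<Sum>k\<in>I. L2_normsq M (\<lambda>z. of_real (\<sigma> z) * e k z - h k z)) / \<epsilon>)"
proof -
  have sqe: "square_integrable M (e i)" "square_integrable M (v i)" if "i \<in> I" for i
    using e v that by (auto simp: orthonormal_on_def)
  have sqs: "square_integrable M (\<lambda>z. of_real (\<sigma> z) * g z)" if "square_integrable M g" for g
    using that \<sigma> by (intro square_integrable_mult_bounded[where K = S]) auto
  have sqh: "square_integrable M (h k)" if "k \<in> I" for k
    unfolding h[OF that] by (intro square_integrable_intros sqe)
  have norm1: "L2_normsq M (e i) = 1" "L2_normsq M (v i) = 1" if "i \<in> I" for i
    using e v that L2_inner_self[of M "e i"] L2_inner_self[of M "v i"]
    by (auto simp: orthonormal_on_def)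
  have int2: "integrable M (\<lambda>z. (cmod (g z))\<^sup>2)" if "square_integrable M g" for g
    using that by (simp add: square_integrable_def)
  have fs [measurable]: "(\<lambda>z. f (\<sigma> z)) \<in> borel_measurable M"
    using measurable_compose[OF \<sigma>(1) f(1)] .
  have intf: "integrable M (\<lambda>z. f (\<sigma> z) * (cmod (g z))\<^sup>2)" if "square_integrable M g" for g
  proof (rule Bochner_Integration.integrable_bound)
    show "integrable M (\<lambda>z. B * (cmod (g z))\<^sup>2)" using int2[OF that] by simp
    show "AE z in M. norm (f (\<sigma> z) * (cmod (g z))\<^sup>2) \<le> norm (B * (cmod (g z))\<^sup>2)"
      by (auto simp: abs_mult intro!: mult_right_mono order_trans[OF f(2)])
  qed (use that in \<open>auto simp: square_integrable_def\<close>)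
  \<comment> \<open>The two densities are comparable pointwise and have the same mass.\<close>
  define D where "D z = (\<Sum>k\<in>I. (cmod (e k z))\<^sup>2) - (\<Sum>j\<in>I. (cmod (v j z))\<^sup>2)" for z
  have D0: "D z \<ge> 0" for z
  proof -
    have "(\<Sum>j\<in>I. (cmod (v j z))\<^sup>2) = (\<Sum>j\<in>I. (cmod (\<Sum>k\<in>I. U j k * e k z))\<^sup>2)"
      by (intro sum.cong) (auto simp: U)
    also have "\<dots> \<le> (\<Sum>k\<in>I. (cmod (e k z))\<^sup>2)"
      by (rule orthonormal_change_of_basis_contraction[OF e v e(2) U])
    finally show ?thesis by (simp add: D_def)
  qed
  have intD: "integrable M D" unfolding D_def using int2 sqe by auto
  have "(\<integral>z. D z \<partial>M) = 0"
    unfolding D_def using int2 sqe norm1 by (simp add: L2_normsq_def)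
  have intfD: "integrable M (\<lambda>z. f (\<sigma> z) * D z)"
    unfolding D_def right_diff_distrib sum_distrib_left using intf sqe by auto
  have "\<bar>\<integral>z. f (\<sigma> z) * D z \<partial>M\<bar> \<le> (\<integral>z. B * D z \<partial>M)"
    using intD f(2) D0
    by (intro integral_abs_bound[THEN order_trans] integral_mono[OF integrable_abs[OF intfD]])
      (auto simp: abs_mult intro!: mult_right_mono)
  then have "(\<integral>z. f (\<sigma> z) * D z \<partial>M) = 0"
    using \<open>(\<integral>z. D z \<partial>M) = 0\<close> by simp
  then have swap: "(\<Sum>k\<in>I. \<integral>z. f (\<sigma> z) * (cmod (e k z))\<^sup>2 \<partial>M) = (\<Sum>j\<in>I. \<integral>z. f (\<sigma> z) * (cmod (v j z))\<^sup>2 \<partial>M)"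
    unfolding D_def right_diff_distrib sum_distrib_left using intf sqe by simp
  define q where "q j z = of_real (\<sigma> z) * v j z - of_real (ev j) * v j z" for j z
  have sqq: "square_integrable M (q j)" if "j \<in> I" for j
    unfolding q_def using that by (intro square_integrable_intros sqs sqe)
  have step: "\<bar>f (ev j) - (\<integral>z. f (\<sigma> z) * (cmod (v j z))\<^sup>2 \<partial>M)\<bar> \<le> L * (\<epsilon> + L2_normsq M (q j) / \<epsilon>)" if j: "j \<in> I" for j
  proof -
    have "f (ev j) - (\<integral>z. f (\<sigma> z) * (cmod (v j z))\<^sup>2 \<partial>M) = (\<integral>z. f (ev j) * (cmod (v j z))\<^sup>2 - f (\<sigma> z) * (cmod (v j z))\<^sup>2 \<partial>M)"
      using intf[OF sqe(2)[OF j]] int2[OF sqe(2)[OF j]] norm1(2)[OF j]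
      by (simp add: L2_normsq_def)
    also have "\<bar>\<dots>\<bar> \<le> (\<integral>z. L * (\<epsilon> * (cmod (v j z))\<^sup>2 + (cmod (q j z))\<^sup>2 / \<epsilon>) \<partial>M)"
    proof (rule integral_abs_bound[THEN order_trans, OF integral_mono])
      show "integrable M (\<lambda>z. \<bar>f (ev j) * (cmod (v j z))\<^sup>2 - f (\<sigma> z) * (cmod (v j z))\<^sup>2\<bar>)"
        using intf[OF sqe(2)[OF j]] int2[OF sqe(2)[OF j]] by auto
      show "integrable M (\<lambda>z. L * (\<epsilon> * (cmod (v j z))\<^sup>2 + (cmod (q j z))\<^sup>2 / \<epsilon>))"
        using int2[OF sqe(2)[OF j]] int2[OF sqq[OF j]] by auto
      fix z
      let ?d = "\<bar>ev j - \<sigma> z\<bar>"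
      have d: "?d \<le> \<epsilon> + ?d\<^sup>2 / \<epsilon>"
        using \<epsilon> by (rule le_add_square_divide)
      have q: "cmod (q j z) = ?d * cmod (v j z)"
        unfolding q_def by (simp flip: left_diff_distrib of_real_diff add: norm_mult abs_minus_commute)
      have "\<bar>f (ev j) * (cmod (v j z))\<^sup>2 - f (\<sigma> z) * (cmod (v j z))\<^sup>2\<bar> = \<bar>f (ev j) - f (\<sigma> z)\<bar> * (cmod (v j z))\<^sup>2"
        by (simp add: abs_mult flip: left_diff_distrib)
      also have "\<dots> \<le> L * (\<epsilon> + ?d\<^sup>2 / \<epsilon>) * (cmod (v j z))\<^sup>2"
        using f(3)[of "ev j" "\<sigma> z"] mult_left_mono[OF d f(4)] by (intro mult_right_mono) auto
      also have "\<dots> = L * (\<epsilon> * (cmod (v j z))\<^sup>2 + (cmod (q j z))\<^sup>2 / \<epsilon>)"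
        unfolding q by (simp add: power_mult_distrib algebra_simps)
      finally show "\<bar>f (ev j) * (cmod (v j z))\<^sup>2 - f (\<sigma> z) * (cmod (v j z))\<^sup>2\<bar> \<le> L * (\<epsilon> * (cmod (v j z))\<^sup>2 + (cmod (q j z))\<^sup>2 / \<epsilon>)" .
    qed
    also have "\<dots> = L * (\<epsilon> + L2_normsq M (q j) / \<epsilon>)"
      using int2[OF sqe(2)[OF j]] int2[OF sqq[OF j]] norm1(2)[OF j] by (simp add: L2_normsq_def)
    finally show ?thesis .
  qed
  define r where "r k z = of_real (\<sigma> z) * e k z - h k z" for k z
  have sqr: "square_integrable M (r k)" if "k \<in> I" for k
    unfolding r_def using that by (intro square_integrable_intros sqs sqe sqh)
  have best: "L2_normsq M (q j) \<le> (\<integral>z. (cmod (\<Sum>k\<in>I. U j k * r k z))\<^sup>2 \<partial>M)" if j: "j \<in> I" for j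
  proof -
    \<comment> \<open>The part of the linear approximation error that lies in the span, hence orthogonal to \<open>q j\<close>.\<close>
    define p where "p z = (\<Sum>l\<in>I. (of_real (ev j) * U j l - (\<Sum>k\<in>I. U j k * H k l)) * e l z)" for z
    have p: "square_integrable M p" unfolding p_def by (intro square_integrable_intros sqe)
    have "(\<Sum>k\<in>I. U j k * r k z) = q j z + p z" for z
    proof -
      have "(\<Sum>k\<in>I. U j k * r k z) = of_real (\<sigma> z) * v j z - (\<Sum>k\<in>I. U j k * h k z)"
        unfolding r_def U[OF j] right_diff_distrib sum_subtractf sum_distrib_left by (simp add: mult_ac)
      also have "(\<Sum>k\<in>I. U j k * h k z) = (\<Sum>l\<in>I. (\<Sum>k\<in>I. U j k * H k l) * e l z)"
        unfolding sum_distrib_right by (subst sum.swap) (simp add: h sum_distrib_left mult_ac)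
      finally show ?thesis
        unfolding q_def p_def U[OF j] left_diff_distrib sum_subtractf sum_distrib_left by (simp add: mult_ac)
    qed
    moreover have "L2_inner M (q j) p = 0"
      unfolding q_def p_def by (rule eig[OF j])
    ultimately show ?thesis
      using L2_normsq_add[OF sqq[OF j] p] L2_normsq_nonneg[of M p] by (simp add: L2_normsq_def)
  qed
  have "(\<Sum>j\<in>I. L2_normsq M (q j)) \<le> (\<Sum>j\<in>I. \<integral>z. (cmod (\<Sum>k\<in>I. U j k * r k z))\<^sup>2 \<partial>M)"
    by (intro sum_mono best)
  also have "\<dots> = (\<integral>z. (\<Sum>j\<in>I. (cmod (\<Sum>k\<in>I. U j k * r k z))\<^sup>2) \<partial>M)"
    by (rule Bochner_Integration.integral_sum[symmetric]) (intro int2 square_integrable_intros sqr)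
  also have "\<dots> \<le> (\<integral>z. (\<Sum>k\<in>I. (cmod (r k z))\<^sup>2) \<partial>M)"
    by (intro integral_mono orthonormal_change_of_basis_contraction[OF e v e(2) U]
        Bochner_Integration.integrable_sum int2 square_integrable_intros sqr)
  also have "\<dots> = (\<Sum>k\<in>I. L2_normsq M (r k))"
    unfolding L2_normsq_def by (rule Bochner_Integration.integral_sum) (intro int2 sqr)
  finally have total: "(\<Sum>j\<in>I. L2_normsq M (q j)) \<le> (\<Sum>k\<in>I. L2_normsq M (r k))" .
  have "\<bar>(\<Sum>j\<in>I. f (ev j)) - (\<Sum>k\<in>I. \<integral>z. f (\<sigma> z) * (cmod (e k z))\<^sup>2 \<partial>M)\<bar> \<le>
    (\<Sum>j\<in>I. \<bar>f (ev j) - (\<integral>z. f (\<sigma> z) * (cmod (v j z))\<^sup>2 \<partial>M)\<bar>)"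
    unfolding swap sum_subtractf[symmetric] by (rule sum_abs)
  also have "\<dots> \<le> (\<Sum>j\<in>I. L * (\<epsilon> + L2_normsq M (q j) / \<epsilon>))"
    by (intro sum_mono step)
  also have "\<dots> = L * (real (card I) * \<epsilon> + (\<Sum>j\<in>I. L2_normsq M (q j)) / \<epsilon>)"
    by (simp add: sum.distrib sum_distrib_left[symmetric] sum_divide_distrib[symmetric])
  also have "\<dots> \<le> L * (real (card I) * \<epsilon> + (\<Sum>k\<in>I. L2_normsq M (r k)) / \<epsilon>)"
    using total f(4) \<epsilon> by (intro mult_left_mono add_left_mono divide_right_mono) auto
  finally show ?thesis unfolding r_def .
qed

section \<open>The space of analytic functions and its projections\<close>

lemma L2_inner_tendsto_0:
  assumes u: "square_integrable M u" and f: "\<And>n. square_integrable M (f n)"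
    and lim: "(\<lambda>n. L2_normsq M (f n)) \<longlonglongrightarrow> 0"
  shows "(\<lambda>n. L2_inner M u (f n)) \<longlonglongrightarrow> 0"
proof (rule LIMSEQ_I)
  fix r :: real assume r: "r > 0"
  define \<epsilon> where "\<epsilon> = r / (2 * (1 + L2_normsq M u))"
  have \<epsilon>: "\<epsilon> > 0" "\<epsilon> * L2_normsq M u \<le> r / 2"
    using r L2_normsq_nonneg[of M u] by (auto simp: \<epsilon>_def field_simps)
  have "\<forall>\<^sub>F n in sequentially. L2_normsq M (f n) < \<epsilon> * (r / 2)"
    using lim by (rule order_tendstoD(2)) (use r \<epsilon> in simp)
  then obtain n0 where n0: "\<And>n. n \<ge> n0 \<Longrightarrow> L2_normsq M (f n) < \<epsilon> * (r / 2)"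
    unfolding eventually_sequentially by blast
  show "\<exists>n0. \<forall>n\<ge>n0. norm (L2_inner M u (f n) - 0) < r"
  proof (intro exI[of _ n0] allI impI)
    fix n assume "n \<ge> n0"
    then have "L2_normsq M (f n) / \<epsilon> < r / 2"
      using n0[of n] \<epsilon> by (simp add: field_simps)
    with L2_inner_le[OF u f \<epsilon>(1), of n] \<epsilon>(2)
    show "norm (L2_inner M u (f n) - 0) < r" unfolding diff_zero by linarith
  qed
qed

text \<open>Uniqueness of the projection as a function, and not merely up to null sets, rests on the
  definiteness of the norm on \<open>S\<close>.\<close>

lemma orth_proj_eqI:
  assumes f: "f \<in> S" and orth: "\<And>h. h \<in> S \<Longrightarrow> L2_inner M (\<lambda>z. g z - f z) h = 0"
    and g: "square_integrable M g" and S: "\<And>u. u \<in> S \<Longrightarrow> square_integrable M u"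
    and diff: "\<And>u v. u \<in> S \<Longrightarrow> v \<in> S \<Longrightarrow> (\<lambda>z. u z - v z) \<in> S"
    and def: "\<And>u. u \<in> S \<Longrightarrow> L2_normsq M u = 0 \<Longrightarrow> u = (\<lambda>z. 0)"
  shows "orth_proj M S g = f"
  unfolding orth_proj_def L2_inner_def[symmetric]
proof (rule the_equality)
  fix f' assume f': "f' \<in> S \<and> (\<forall>h\<in>S. L2_inner M (\<lambda>z. g z - f' z) h = 0)"
  define d where "d z = f z - f' z" for z
  have d: "d \<in> S" unfolding d_def using f f' diff by blast
  have dd: "(\<lambda>z. (g z - f' z) - (g z - f z)) = d" by (simp add: d_def fun_eq_iff)
  have "complex_of_real (L2_normsq M d) = L2_inner M (\<lambda>z. (g z - f' z) - (g z - f z)) d"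
    unfolding dd by (rule L2_inner_self[symmetric])
  also have "\<dots> = L2_inner M (\<lambda>z. g z - f' z) d - L2_inner M (\<lambda>z. g z - f z) d"
    using g S f f' d by (intro L2_inner_diff_left square_integrable_intros) auto
  also have "\<dots> = 0" using orth[OF d] f' d by simp
  finally have "d = (\<lambda>z. 0)" using def[OF d] by simp
  then show "f' = f" by (auto simp: d_def fun_eq_iff)
qed (use f orth in auto)

lemma cfun_sum_apply: "(\<Sum>i\<in>I. f i) z = (\<Sum>i\<in>I. f i z)" for f :: "'i \<Rightarrow> complex \<Rightarrow> complex"
  by (induction I rule: infinite_finite_induct) auto

text \<open>The Gram-Schmidt process for functions, where definiteness of the inner product is
  available only on the span.\<close>

lemma gram_schmidt_functions:
  assumes "finite B" "cfun.independent B"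
    and "\<And>u. u \<in> cfun.span B \<Longrightarrow> square_integrable M u"
    and "\<And>u. u \<in> cfun.span B \<Longrightarrow> L2_normsq M u = 0 \<Longrightarrow> u = (\<lambda>z. 0)"
    and "finite J" "card J = card B"
  shows "\<exists>w. (\<forall>j\<in>J. w j \<in> cfun.span B) \<and> orthonormal_on M J w"
  using assms
proof (induction B arbitrary: J rule: finite_induct)
  case empty
  have "J = {}" using empty.prems(4,5) by simp
  then show ?case by (simp add: orthonormal_on_def)
next
  case (insert b B)
  have ind: "cfun.independent B" and b: "b \<notin> cfun.span B"
    using insert.prems(1) insert.hyps by (simp_all add: cfun.independent_insert)
  have sub: "u \<in> cfun.span (insert b B)" if "u \<in> cfun.span B" for u
    using that cfun.span_mono[of B "insert b B"] by auto
  have cardJ: "finite J" "card J = Suc (card B)" using insert.prems(4,5) insert.hyps by simp_all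
  then have "J \<noteq> {}" by auto
  then obtain j0 where j0: "j0 \<in> J" by blast
  define J' where "J' = J - {j0}"
  have J: "J = insert j0 J'" "j0 \<notin> J'" "finite J'" "card J' = card B"
    using j0 cardJ by (auto simp: J'_def)
  have "\<exists>w. (\<forall>j\<in>J'. w j \<in> cfun.span B) \<and> orthonormal_on M J' w"
    by (rule insert.IH[OF ind insert.prems(2)[OF sub] insert.prems(3)[OF sub] J(3,4)])
  then obtain w where w: "\<And>j. j \<in> J' \<Longrightarrow> w j \<in> cfun.span B" "orthonormal_on M J' w"
    by blast
  define p where "p z = (\<Sum>j\<in>J'. L2_inner M b (w j) * w j z)" for z
  have "p = (\<Sum>j\<in>J'. cscale (L2_inner M b (w j)) (w j))"
    by (rule ext) (simp add: p_def cfun_sum_apply cscale_def)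
  then have p: "p \<in> cfun.span B"
    by (auto intro!: cfun.span_sum cfun.span_scale w(1))
  define u where "u z = b z - p z" for z
  have u_eq: "u = b - p" by (rule ext) (simp add: u_def)
  have bs: "b \<in> cfun.span (insert b B)" by (intro cfun.span_base) simp
  have us: "u \<in> cfun.span (insert b B)"
    unfolding u_eq by (intro cfun.span_diff bs sub p)
  have "u \<noteq> (\<lambda>z. 0)"
  proof
    assume "u = (\<lambda>z. 0)"
    then have "b = p" by (auto simp: u_def fun_eq_iff)
    with b p show False by simp
  qed
  then have "L2_normsq M u \<noteq> 0" using insert.prems(3)[OF us] by blast
  then have n0: "L2_normsq M u > 0" using L2_normsq_nonneg[of M u] by simp
  have sq: "square_integrable M b" "square_integrable M p" "square_integrable M u"
    by (rule insert.prems(2)[OF bs] insert.prems(2)[OF sub[OF p]] insert.prems(2)[OF us])+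
  have sqw: "square_integrable M (w j)" if "j \<in> J'" for j
    by (rule insert.prems(2)[OF sub[OF w(1)[OF that]]])
  have uw: "L2_inner M u (w j) = 0" if "j \<in> J'" for j
  proof -
    have "L2_inner M p (w j) = L2_inner M b (w j)"
      unfolding p_def using orthonormal_on_L2_inner_sum[OF w(2) J(3) order_refl that] that by simp
    then show ?thesis
      unfolding u_def using sq sqw[OF that] by (subst L2_inner_diff_left) auto
  qed
  define s where "s = complex_of_real (1 / sqrt (L2_normsq M u))"
  define w' where "w' j = (if j = j0 then (\<lambda>z. s * u z) else w j)" for j
  have su: "(\<lambda>z. s * u z) = cscale s u" by (simp add: cscale_def)
  have "s * cnj s * L2_normsq M u = 1"
    using n0 by (simp add: s_def flip: of_real_mult)
  then have self: "L2_inner M (\<lambda>z. s * u z) (\<lambda>z. s * u z) = 1"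
    by (simp add: L2_inner_cmult_left L2_inner_cmult_right L2_inner_self mult.assoc)
  have wu: "L2_inner M (w j) u = 0" if "j \<in> J'" for j
    using uw[OF that] by (subst L2_inner_commute) simp
  have "orthonormal_on M J w'"
    unfolding orthonormal_on_def
  proof (intro conjI ballI)
    fix i assume i: "i \<in> J"
    show "square_integrable M (w' i)"
      using i sqw sq(3) by (cases "i = j0") (auto simp: w'_def J(1) intro: square_integrable_cmult)
    fix j assume j: "j \<in> J"
    consider "i = j0" "j = j0" | "i = j0" "j \<in> J'" "j \<noteq> j0" | "i \<in> J'" "i \<noteq> j0" "j = j0"
      | "i \<in> J'" "i \<noteq> j0" "j \<in> J'" "j \<noteq> j0"
      using i j J(1,2) by blast
    then show "L2_inner M (w' i) (w' j) = (if i = j then 1 else 0)"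
    proof cases
      case 1
      then show ?thesis using self by (simp add: w'_def)
    next
      case 2
      then show ?thesis using uw[of j] by (simp add: w'_def L2_inner_cmult_left)
    next
      case 3
      then show ?thesis using wu[of i] by (simp add: w'_def L2_inner_cmult_right)
    next
      case 4
      then show ?thesis using w(2) by (simp add: w'_def orthonormal_on_def)
    qed
  qed
  moreover have "w' j \<in> cfun.span (insert b B)" if "j \<in> J" for j
  proof (cases "j = j0")
    case True
    then show ?thesis using cfun.span_scale[OF us, of s] by (simp add: w'_def su)
  next
    case False
    then show ?thesis using that w(1)[of j] sub J(1) by (simp add: w'_def)
  qed
  ultimately show ?case by blast
qed

context radial_weight begin

abbreviation "e \<equiv> onb c R"

lemma onb_borel [measurable]: "e n \<in> borel_measurable borel"
  unfolding onb_def by measurable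

lemma cmod_onb: "z \<in> disc R \<Longrightarrow> (cmod (e n z))\<^sup>2 = cmod z ^ (2 * n) / c (2 * n + 1)"
  using c_pos[of "2 * n + 1"]
  by (simp add: onb_def norm_divide norm_power power_divide mult.commute flip: power_mult)

lemma square_integrable_onb: "square_integrable M (e n)"
  unfolding square_integrable_def
proof
  have "integrable M (\<lambda>z. (cmod (e n z))\<^sup>2) \<longleftrightarrow> integrable M (\<lambda>z. cmod z ^ (2 * n) / c (2 * n + 1))"
    by (rule Bochner_Integration.integrable_cong) (auto simp: cmod_onb)
  then show "integrable M (\<lambda>z. (cmod (e n z))\<^sup>2)"
    using has_bochner_integral_cmod_power[of "2 * n"] by (simp add: has_bochner_integral_iff)
qed (rule borel_imp_M, simp)

lemma orthonormal_onb: "orthonormal_on M I e"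
proof -
  have "L2_inner M (e j) (e k) = (if j = k then 1 else 0)" for j k
  proof -
    have "L2_inner M (e j) (e k) =
      (\<integral>z. (z ^ j * cnj z ^ k) / of_real (sqrt (c (2 * j + 1)) * sqrt (c (2 * k + 1))) \<partial>M)"
      unfolding L2_inner_def
      by (rule Bochner_Integration.integral_cong) (auto simp: onb_def)
    also have "\<dots> = (\<integral>z. z ^ j * cnj z ^ k \<partial>M) / of_real (sqrt (c (2 * j + 1)) * sqrt (c (2 * k + 1)))"
      by (rule integral_divide_zero)
    also have "\<dots> = (if j = k then 1 else 0)"
      unfolding integral_monomials using c_pos[of "2 * k + 1"] by (auto simp flip: of_real_mult)
    finally show ?thesis .
  qed
  then show ?thesis using square_integrable_onb by (auto simp: orthonormal_on_def)
qed

lemma KN_iff: "f \<in> KN c R N \<longleftrightarrow> (\<exists>a. f = (\<lambda>z. \<Sum>k\<in>{0..N}. a k * e k z))"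
proof
  let ?S = "{f. \<exists>a. f = (\<lambda>z. \<Sum>k\<in>{0..N}. a k * e k z)}"
  have "cfun.subspace ?S"
    unfolding cfun.subspace_def
  proof (intro conjI ballI allI)
    show "0 \<in> ?S" by (auto intro!: exI[of _ "\<lambda>_. 0"])
    fix f g assume "f \<in> ?S" "g \<in> ?S"
    then obtain a b where "f = (\<lambda>z. \<Sum>k\<in>{0..N}. a k * e k z)" "g = (\<lambda>z. \<Sum>k\<in>{0..N}. b k * e k z)"
      by blast
    then show "f + g \<in> ?S"
      by (auto intro!: exI[of _ "\<lambda>k. a k + b k"] simp: fun_eq_iff distrib_right sum.distrib)
  next
    fix x f assume "f \<in> ?S"
    then obtain a where "f = (\<lambda>z. \<Sum>k\<in>{0..N}. a k * e k z)" by blast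
    then show "cscale x f \<in> ?S"
      by (auto intro!: exI[of _ "\<lambda>k. x * a k"] simp: fun_eq_iff cscale_def sum_distrib_left mult.assoc)
  qed
  moreover have "e ` {0..N} \<subseteq> ?S"
  proof
    fix f assume "f \<in> e ` {0..N}"
    then obtain n where n: "n \<le> N" "f = e n" by auto
    have "f = (\<lambda>z. \<Sum>k\<in>{0..N}. (if k = n then 1 else 0) * e k z)"
      using n by (simp add: fun_eq_iff if_distrib[of "\<lambda>x. x * _"] cong: if_cong)
    then show "f \<in> ?S" by (intro CollectI exI[of _ "\<lambda>k. if k = n then 1 else 0"])
  qed
  ultimately have "KN c R N \<subseteq> ?S" unfolding KN_def by (rule cfun.span_minimal[rotated])
  then show "f \<in> KN c R N \<Longrightarrow> \<exists>a. f = (\<lambda>z. \<Sum>k\<in>{0..N}. a k * e k z)" by blast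
next
  assume "\<exists>a. f = (\<lambda>z. \<Sum>k\<in>{0..N}. a k * e k z)"
  then obtain a where "f = (\<lambda>z. \<Sum>k\<in>{0..N}. a k * e k z)" by blast
  then have "f = (\<Sum>k\<in>{0..N}. cscale (a k) (e k))"
    by (simp add: fun_eq_iff cfun_sum_apply cscale_def)
  then show "f \<in> KN c R N"
    unfolding KN_def by (simp only:) (intro cfun.span_sum cfun.span_scale cfun.span_base imageI)
qed

text \<open>The coefficients are taken with respect to the orthonormal basis instead of the monomials,
  which turns the weighted square sum into a plain one.\<close>

lemma Hc_iff:
  "f \<in> Hc c R \<longleftrightarrow> (\<forall>z. z \<notin> disc R \<longrightarrow> f z = 0) \<and>
     (\<exists>b. summable (\<lambda>n. (cmod (b n))\<^sup>2) \<and> (\<forall>z\<in>disc R. (\<lambda>n. b n * e n z) sums f z))"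
proof -
  have s: "sqrt (c n) \<noteq> 0" for n using c_pos[of n] by simp
  have "(\<exists>a. (\<forall>z\<in>disc R. (\<lambda>n. a n * z ^ n) sums f z) \<and> summable (\<lambda>n. (cmod (a n))\<^sup>2 * c (2 * n + 1))) \<longleftrightarrow>
     (\<exists>b. summable (\<lambda>n. (cmod (b n))\<^sup>2) \<and> (\<forall>z\<in>disc R. (\<lambda>n. b n * e n z) sums f z))"
    (is "(\<exists>a. ?P a) \<longleftrightarrow> (\<exists>b. ?Q b)")
  proof
    assume "\<exists>a. ?P a"
    then obtain a where a: "?P a" by blast
    show "\<exists>b. ?Q b"
    proof (rule exI)
      show "?Q (\<lambda>n. a n * of_real (sqrt (c (2 * n + 1))))"
      using a s by (simp add: onb_def norm_mult power_mult_distrib c_pos less_imp_le)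
    qed
  next
    assume "\<exists>b. ?Q b"
    then obtain b where b: "?Q b" by blast
    show "\<exists>a. ?P a"
    proof (rule exI)
      show "?P (\<lambda>n. b n / of_real (sqrt (c (2 * n + 1))))"
      using b s by (simp add: onb_def norm_divide power_divide c_pos less_imp_le)
    qed
  qed
  then show ?thesis unfolding Hc_def by simp
qed

text \<open>By the moment bound \<open>\<bar>e\<^sub>n z\<bar>\<^sup>2\<close> is dominated by a geometric series as soon as
  \<open>\<bar>z\<bar> < \<rho> < R\<close>.\<close>

lemma onb_series_summable:
  assumes b: "summable (\<lambda>n. (cmod (b n))\<^sup>2)" and z: "z \<in> disc R"
  shows "summable (\<lambda>n. b n * e n z)"
proof -
  obtain \<rho> where \<rho>: "cmod z < \<rho>" "ereal \<rho> < R"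
    using z ereal_dense2[of "ereal (cmod z)" R] by (auto simp: disc_def)
  then have \<rho>0: "\<rho> > 0" using norm_ge_zero[of z] by linarith
  obtain \<kappa> where \<kappa>: "\<kappa> > 0" "\<And>n. c n \<ge> \<kappa> * \<rho> ^ n"
    using moment_lower_bound[of \<rho>] \<rho> \<rho>0 by auto
  have "summable (\<lambda>n. ((cmod z / \<rho>)\<^sup>2) ^ n / (\<kappa> * \<rho>))"
    using \<rho> \<rho>0 by (intro summable_divide summable_geometric) (simp add: abs_square_less_1)
  then have "summable (\<lambda>n. (cmod (e n z))\<^sup>2)"
  proof (rule summable_comparison_test'[where N = 0])
    fix n
    have "(cmod (e n z))\<^sup>2 = cmod z ^ (2 * n) / c (2 * n + 1)" by (rule cmod_onb[OF z])
    also have "\<dots> \<le> cmod z ^ (2 * n) / (\<kappa> * \<rho> ^ (2 * n + 1))"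
      using \<kappa>(1) \<kappa>(2)[of "2 * n + 1"] \<rho>0 c_pos by (intro divide_left_mono) auto
    also have "\<dots> = ((cmod z / \<rho>)\<^sup>2) ^ n / (\<kappa> * \<rho>)"
      by (simp add: power_mult power_divide)
    finally show "norm ((cmod (e n z))\<^sup>2) \<le> ((cmod z / \<rho>)\<^sup>2) ^ n / (\<kappa> * \<rho>)" by simp
  qed
  with b have "summable (\<lambda>n. (cmod (b n))\<^sup>2 + (cmod (e n z))\<^sup>2)" by (rule summable_add)
  then show ?thesis
  proof (rule summable_comparison_test'[where N = 0])
    fix n
    have "0 \<le> (cmod (b n) - cmod (e n z))\<^sup>2 + (cmod (b n))\<^sup>2 + (cmod (e n z))\<^sup>2" by simp
    then show "norm (b n * e n z) \<le> (cmod (b n))\<^sup>2 + (cmod (e n z))\<^sup>2"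
      by (simp add: norm_mult power2_diff)
  qed
qed

text \<open>The pointwise sum is also the sum in \<open>L\<^sup>2\<close>: by Fatou the error of the \<open>n\<close>-th partial sum
  is at most the limit of the errors between partial sums, which orthonormality identifies with
  tails of \<open>\<Sum>\<bar>b\<^sub>k\<bar>\<^sup>2\<close>.\<close>

lemma onb_series_L2:
  assumes f0: "\<And>z. z \<notin> disc R \<Longrightarrow> f z = 0"
    and b: "summable (\<lambda>n. (cmod (b n))\<^sup>2)"
    and f: "\<And>z. z \<in> disc R \<Longrightarrow> (\<lambda>n. b n * e n z) sums f z"
  shows "square_integrable M f"
    and "(\<lambda>n. L2_normsq M (\<lambda>z. f z - (\<Sum>k<n. b k * e k z))) \<longlonglongrightarrow> 0"
proof -
  define S where "S n z = (\<Sum>k<n. b k * e k z)" for n z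
  have sqS: "square_integrable M (S n)" for n
    unfolding S_def by (intro square_integrable_intros square_integrable_onb)
  have [measurable]: "S n \<in> borel_measurable borel" for n unfolding S_def by measurable
  have lim: "(\<lambda>n. S n z) \<longlonglongrightarrow> f z" for z
  proof (cases "z \<in> disc R")
    case True
    then show ?thesis using f[of z] by (simp add: sums_def S_def)
  next
    case False
    then show ?thesis by (simp add: S_def onb_def f0)
  qed
  have [measurable]: "f \<in> borel_measurable borel"
    by (rule borel_measurable_LIMSEQ_metric[of S]) (use lim in auto)
  define T where "T n = (\<Sum>k. (cmod (b k))\<^sup>2) - (\<Sum>k<n. (cmod (b k))\<^sup>2)" for n
  have T0: "T n \<ge> 0" for n
    unfolding T_def using sum_le_suminf[OF b, of "{..<n}"] by simp
  have step: "(\<integral>\<^sup>+z. ennreal ((cmod (S m z - S n z))\<^sup>2) \<partial>M) \<le> ennreal (T n)" if "n \<le> m" for n m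
  proof -
    have SS: "S m z - S n z = (\<Sum>k\<in>{n..<m}. b k * e k z)" for z
      unfolding S_def using that by (simp add: sum_diff_nat_ivl lessThan_atLeast0)
    have "square_integrable M (\<lambda>z. S m z - S n z)" by (intro square_integrable_intros sqS)
    then have "(\<integral>\<^sup>+z. ennreal ((cmod (S m z - S n z))\<^sup>2) \<partial>M) = ennreal (L2_normsq M (\<lambda>z. S m z - S n z))"
      unfolding L2_normsq_def square_integrable_def by (subst nn_integral_eq_integral) auto
    also have "L2_normsq M (\<lambda>z. S m z - S n z) = (\<Sum>k\<in>{n..<m}. (cmod (b k))\<^sup>2)"
      unfolding SS by (rule orthonormal_on_normsq_sum[OF orthonormal_onb]) simp
    also have "\<dots> = (\<Sum>k<m. (cmod (b k))\<^sup>2) - (\<Sum>k<n. (cmod (b k))\<^sup>2)"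
      using that by (simp add: sum_diff_nat_ivl lessThan_atLeast0)
    also have "\<dots> \<le> T n"
      unfolding T_def using sum_le_suminf[OF b, of "{..<m}"] by simp
    finally show ?thesis by (simp add: ennreal_leI)
  qed
  have fatou: "(\<integral>\<^sup>+z. ennreal ((cmod (f z - S n z))\<^sup>2) \<partial>M) \<le> ennreal (T n)" for n
  proof -
    have "(\<integral>\<^sup>+z. ennreal ((cmod (f z - S n z))\<^sup>2) \<partial>M) = (\<integral>\<^sup>+z. liminf (\<lambda>m. ennreal ((cmod (S m z - S n z))\<^sup>2)) \<partial>M)"
    proof (rule nn_integral_cong)
      fix z
      have "(\<lambda>m. ennreal ((cmod (S m z - S n z))\<^sup>2)) \<longlonglongrightarrow> ennreal ((cmod (f z - S n z))\<^sup>2)"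
        by (intro tendsto_ennrealI tendsto_intros lim)
      then show "ennreal ((cmod (f z - S n z))\<^sup>2) = liminf (\<lambda>m. ennreal ((cmod (S m z - S n z))\<^sup>2))"
        by (rule lim_imp_Liminf[OF trivial_limit_sequentially, symmetric])
    qed
    also have "\<dots> \<le> liminf (\<lambda>m. \<integral>\<^sup>+z. ennreal ((cmod (S m z - S n z))\<^sup>2) \<partial>M)"
      by (rule nn_integral_liminf, rule borel_imp_M) measurable
    also have "\<dots> \<le> liminf (\<lambda>m. ennreal (T n))"
      using step by (intro Liminf_mono eventually_sequentiallyI[of n])
    also have "\<dots> = ennreal (T n)" by (simp add: Liminf_const)
    finally show ?thesis .
  qed
  have sqd: "square_integrable M (\<lambda>z. f z - S n z)" for n
    unfolding square_integrable_def
  proof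
    show "(\<lambda>z. f z - S n z) \<in> borel_measurable M" by (rule borel_imp_M) measurable
    show "integrable M (\<lambda>z. (cmod (f z - S n z))\<^sup>2)"
    proof (rule integrableI_bounded)
      show "(\<lambda>z. (cmod (f z - S n z))\<^sup>2) \<in> borel_measurable M" by (rule borel_imp_M) measurable
      show "(\<integral>\<^sup>+z. ennreal (norm ((cmod (f z - S n z))\<^sup>2)) \<partial>M) < \<infinity>"
        using fatou[of n] by (simp add: order_le_less_trans)
    qed
  qed
  show "square_integrable M f"
    using square_integrable_add[OF sqd[of 0] sqS[of 0]] by simp
  have le: "L2_normsq M (\<lambda>z. f z - S n z) \<le> T n" for n
  proof -
    have "ennreal (L2_normsq M (\<lambda>z. f z - S n z)) \<le> ennreal (T n)"
      using fatou[of n] sqd[of n] unfolding L2_normsq_def square_integrable_def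
      by (subst (asm) nn_integral_eq_integral) auto
    then show ?thesis using T0 by simp
  qed
  have "T \<longlonglongrightarrow> (\<Sum>k. (cmod (b k))\<^sup>2) - (\<Sum>k. (cmod (b k))\<^sup>2)"
    unfolding T_def by (intro tendsto_diff tendsto_const summable_LIMSEQ b)
  then have "T \<longlonglongrightarrow> 0" by simp
  then show "(\<lambda>n. L2_normsq M (\<lambda>z. f z - (\<Sum>k<n. b k * e k z))) \<longlonglongrightarrow> 0"
    unfolding S_def[symmetric]
    by (rule tendsto_sandwich[OF _ _ tendsto_const, rotated 2]) (auto simp: le L2_normsq_nonneg)
qed

lemma square_integrable_Hc: "f \<in> Hc c R \<Longrightarrow> square_integrable M f"
  using onb_series_L2(1) unfolding Hc_iff by blast

lemma L2_inner_Hc_eq_0: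
  assumes u: "square_integrable M u" "\<And>k. L2_inner M u (e k) = 0" and f: "f \<in> Hc c R"
  shows "L2_inner M u f = 0"
proof -
  obtain b where b: "\<And>z. z \<notin> disc R \<Longrightarrow> f z = 0" "summable (\<lambda>n. (cmod (b n))\<^sup>2)"
    "\<And>z. z \<in> disc R \<Longrightarrow> (\<lambda>n. b n * e n z) sums f z"
    using f unfolding Hc_iff by blast
  define S where "S n z = (\<Sum>k<n. b k * e k z)" for n z
  have sqS: "square_integrable M (S n)" for n
    unfolding S_def by (intro square_integrable_intros square_integrable_onb)
  have sqd: "square_integrable M (\<lambda>z. f z - S n z)" for n
    by (intro square_integrable_intros square_integrable_Hc f sqS)
  have "L2_inner M u (S n) = 0" for n
    unfolding S_def using u
    by (subst L2_inner_sum_right) (auto simp: L2_inner_cmult_right intro!: square_integrable_cmult square_integrable_onb)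
  then have "L2_inner M u (\<lambda>z. (f z - S n z) + S n z) = L2_inner M u (\<lambda>z. f z - S n z)" for n
    using sqd[of n] sqS[of n] u(1) by (subst L2_inner_add_right) auto
  then have eq: "L2_inner M u f = L2_inner M u (\<lambda>z. f z - S n z)" for n by simp
  have "(\<lambda>n. L2_inner M u (\<lambda>z. f z - S n z)) \<longlonglongrightarrow> 0"
    using onb_series_L2(2)[OF b] by (intro L2_inner_tendsto_0 u sqd) (simp add: S_def)
  then show ?thesis unfolding eq[symmetric] by (simp add: LIMSEQ_const_iff)
qed

lemma L2_inner_onb_series:
  assumes b: "\<And>z. z \<notin> disc R \<Longrightarrow> f z = 0" "summable (\<lambda>n. (cmod (b n))\<^sup>2)"
    "\<And>z. z \<in> disc R \<Longrightarrow> (\<lambda>n. b n * e n z) sums f z"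
  shows "L2_inner M f (e k) = b k"
proof -
  define S where "S n z = (\<Sum>k<n. b k * e k z)" for n z
  have sqf: "square_integrable M f" by (rule onb_series_L2(1)[OF b])
  have sqS: "square_integrable M (S n)" for n
    unfolding S_def by (intro square_integrable_intros square_integrable_onb)
  have sqd: "square_integrable M (\<lambda>z. f z - S n z)" for n
    by (intro square_integrable_intros sqf sqS)
  have "L2_inner M (S n) (e k) = b k" if "n > k" for n
    unfolding S_def using that orthonormal_on_L2_inner_sum[OF orthonormal_onb, of "{..<n}" "{..<n}" k b] by simp
  then have eq: "L2_inner M f (e k) - b k = cnj (L2_inner M (e k) (\<lambda>z. f z - S n z))" if "n > k" for n
    using that sqf sqS[of n] square_integrable_onb[of k]
    by (simp add: L2_inner_diff_left flip: L2_inner_commute)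
  have "\<forall>\<^sub>F n in sequentially. cnj (L2_inner M (e k) (\<lambda>z. f z - S n z)) = L2_inner M f (e k) - b k"
    by (intro eventually_sequentiallyI[of "Suc k"], rule eq[symmetric]) simp
  moreover have "(\<lambda>n. cnj (L2_inner M (e k) (\<lambda>z. f z - S n z))) \<longlonglongrightarrow> cnj 0"
    using onb_series_L2(2)[OF b]
    by (intro tendsto_cnj L2_inner_tendsto_0 square_integrable_onb sqd) (simp add: S_def)
  ultimately have "(\<lambda>n::nat. L2_inner M f (e k) - b k) \<longlonglongrightarrow> cnj 0"
    by (rule Lim_transform_eventually[rotated])
  then show ?thesis by (simp add: LIMSEQ_const_iff)
qed

lemma Hc_normsq_eq_0:
  assumes f: "f \<in> Hc c R" and n: "L2_normsq M f = 0"
  shows "f = (\<lambda>z. 0)"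
proof -
  obtain b where b: "\<And>z. z \<notin> disc R \<Longrightarrow> f z = 0" "summable (\<lambda>n. (cmod (b n))\<^sup>2)"
    "\<And>z. z \<in> disc R \<Longrightarrow> (\<lambda>n. b n * e n z) sums f z"
    using f unfolding Hc_iff by blast
  have "b k = 0" for k
  proof -
    have "L2_inner M (e k) f = 0"
      by (rule L2_inner_eq_0[OF square_integrable_onb square_integrable_Hc[OF f] n])
    then show ?thesis
      using L2_inner_onb_series[OF b, of k] by (subst (asm) L2_inner_commute) simp
  qed
  then have "f z = 0" for z
    using b(1)[of z] b(3)[of z] sums_unique2[of "\<lambda>n. 0" "f z" 0] by (cases "z \<in> disc R") auto
  then show ?thesis by auto
qed

lemma Hc_diff:
  assumes f: "f \<in> Hc c R" and g: "g \<in> Hc c R"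
  shows "(\<lambda>z. f z - g z) \<in> Hc c R"
proof -
  obtain a where a: "\<And>z. z \<notin> disc R \<Longrightarrow> f z = 0" "summable (\<lambda>n. (cmod (a n))\<^sup>2)"
    "\<And>z. z \<in> disc R \<Longrightarrow> (\<lambda>n. a n * e n z) sums f z"
    using f unfolding Hc_iff by blast
  obtain b where b: "\<And>z. z \<notin> disc R \<Longrightarrow> g z = 0" "summable (\<lambda>n. (cmod (b n))\<^sup>2)"
    "\<And>z. z \<in> disc R \<Longrightarrow> (\<lambda>n. b n * e n z) sums g z"
    using g unfolding Hc_iff by blast
  have "summable (\<lambda>n. (cmod (a n - b n))\<^sup>2)"
  proof (rule summable_comparison_test'[where N = 0])
    show "summable (\<lambda>n. 2 * (cmod (a n))\<^sup>2 + 2 * (cmod (b n))\<^sup>2)"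
      using a(2) b(2) by (intro summable_add summable_mult)
    fix n
    have "(cmod (a n - b n))\<^sup>2 \<le> (cmod (a n) + cmod (b n))\<^sup>2"
      by (intro power_mono norm_triangle_ineq4) simp
    moreover have "0 \<le> (cmod (a n) - cmod (b n))\<^sup>2" by simp
    ultimately show "norm ((cmod (a n - b n))\<^sup>2) \<le> 2 * (cmod (a n))\<^sup>2 + 2 * (cmod (b n))\<^sup>2"
      by (simp add: power2_diff power2_sum)
  qed
  moreover have "(\<lambda>n. (a n - b n) * e n z) sums (f z - g z)" if "z \<in> disc R" for z
    using sums_diff[OF a(3) b(3), OF that that] by (simp add: left_diff_distrib)
  ultimately show ?thesis unfolding Hc_iff using a(1) b(1) by auto
qed

lemma KN_subset_Hc: "KN c R N \<subseteq> Hc c R"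
proof
  fix f assume "f \<in> KN c R N"
  then obtain a where a: "f = (\<lambda>z. \<Sum>k\<in>{0..N}. a k * e k z)" unfolding KN_iff by blast
  define b where "b k = (if k \<le> N then a k else 0)" for k
  have "summable (\<lambda>n. (cmod (b n))\<^sup>2)"
    by (rule summable_finite[of "{0..N}"]) (auto simp: b_def)
  moreover have "(\<lambda>n. b n * e n z) sums f z" for z
  proof -
    have "(\<lambda>n. b n * e n z) sums (\<Sum>n\<in>{0..N}. b n * e n z)"
      by (rule sums_finite) (auto simp: b_def)
    then show ?thesis by (simp add: a b_def)
  qed
  moreover have "f z = 0" if "z \<notin> disc R" for z using that by (simp add: a onb_def)
  ultimately show "f \<in> Hc c R" unfolding Hc_iff by blast
qed

lemma KN_subspace: "cfun.subspace (KN c R N)"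
  unfolding KN_def by (rule cfun.subspace_span)

lemma KN_diff: "f \<in> KN c R N \<Longrightarrow> g \<in> KN c R N \<Longrightarrow> (\<lambda>z. f z - g z) \<in> KN c R N"
  using cfun.subspace_diff[OF KN_subspace, of f N g] by (simp add: fun_diff_def)

lemma onb_in_KN: "k \<le> N \<Longrightarrow> e k \<in> KN c R N"
  unfolding KN_def by (intro cfun.span_base) auto

text \<open>The projection exists because the Bessel inequality makes the series with coefficients
  \<open>\<langle>g, e\<^sub>k\<rangle>\<close> an element of the space.\<close>

lemma Hc_projection:
  assumes g: "square_integrable M g"
  shows "orth_proj M (Hc c R) g \<in> Hc c R"
    and "\<And>h. h \<in> Hc c R \<Longrightarrow> L2_inner M (\<lambda>z. g z - orth_proj M (Hc c R) g z) h = 0"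
proof -
  define b where "b k = L2_inner M g (e k)" for k
  have "summable (\<lambda>n. (cmod (b n))\<^sup>2)"
    unfolding b_def
    by (rule summableI_nonneg_bounded, simp, rule bessel_inequality[OF orthonormal_onb _ g], simp)
  note b = this
  define f where "f z = (if z \<in> disc R then (\<Sum>n. b n * e n z) else 0)" for z
  have f: "\<And>z. z \<notin> disc R \<Longrightarrow> f z = 0" "summable (\<lambda>n. (cmod (b n))\<^sup>2)"
    "\<And>z. z \<in> disc R \<Longrightarrow> (\<lambda>n. b n * e n z) sums f z"
    using b onb_series_summable[OF b] by (auto simp: f_def summable_sums)
  have fH: "f \<in> Hc c R" unfolding Hc_iff using f by blast
  have sq: "square_integrable M (\<lambda>z. g z - f z)"
    by (intro square_integrable_intros g square_integrable_Hc fH)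
  have "L2_inner M (\<lambda>z. g z - f z) (e k) = 0" for k
    using L2_inner_onb_series[OF f, of k]
    by (subst L2_inner_diff_left) (auto simp: g fH square_integrable_Hc square_integrable_onb b_def)
  then have orth: "L2_inner M (\<lambda>z. g z - f z) h = 0" if "h \<in> Hc c R" for h
    by (rule L2_inner_Hc_eq_0[OF sq _ that])
  have "orth_proj M (Hc c R) g = f"
    by (rule orth_proj_eqI[OF fH orth g]) (assumption | fact square_integrable_Hc Hc_diff Hc_normsq_eq_0)+
  then show "orth_proj M (Hc c R) g \<in> Hc c R"
    "\<And>h. h \<in> Hc c R \<Longrightarrow> L2_inner M (\<lambda>z. g z - orth_proj M (Hc c R) g z) h = 0"
    using fH orth by auto
qed

lemma square_integrable_KN: "f \<in> KN c R N \<Longrightarrow> square_integrable M f"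
  using KN_subset_Hc square_integrable_Hc by blast

lemma KN_normsq_eq_0: "f \<in> KN c R N \<Longrightarrow> L2_normsq M f = 0 \<Longrightarrow> f = (\<lambda>z. 0)"
  using KN_subset_Hc Hc_normsq_eq_0 by blast

lemma PN_projection:
  assumes g: "square_integrable M g"
  shows "PN c \<mu> R N g \<in> KN c R N"
    and "\<And>h. h \<in> KN c R N \<Longrightarrow> L2_inner M (\<lambda>z. g z - PN c \<mu> R N g z) h = 0"
proof -
  define f where "f z = (\<Sum>k\<in>{0..N}. L2_inner M g (e k) * e k z)" for z
  have f: "f \<in> KN c R N" unfolding KN_iff by (intro exI ext) (rule f_def)
  have sq: "square_integrable M (\<lambda>z. g z - f z)"
    by (intro square_integrable_intros g square_integrable_KN[OF f])
  have fk: "L2_inner M (\<lambda>z. g z - f z) (e k) = 0" if "k \<in> {0..N}" for k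
  proof -
    have "L2_inner M f (e k) = L2_inner M g (e k)"
      unfolding f_def using orthonormal_on_L2_inner_sum[OF orthonormal_onb finite_atLeastAtMost order_refl that] that
      by simp
    then show ?thesis
      by (subst L2_inner_diff_left) (auto simp: g square_integrable_KN[OF f] square_integrable_onb)
  qed
  have orth: "L2_inner M (\<lambda>z. g z - f z) h = 0" if h: "h \<in> KN c R N" for h
  proof -
    obtain a where a: "h = (\<lambda>z. \<Sum>k\<in>{0..N}. a k * e k z)" using h unfolding KN_iff by blast
    show ?thesis unfolding a using fk
      by (subst L2_inner_sum_right) (auto simp: sq L2_inner_cmult_right intro!: square_integrable_cmult square_integrable_onb)
  qed
  have "PN c \<mu> R N g = f" unfolding PN_def
    by (rule orth_proj_eqI[OF f orth g]) (assumption | fact square_integrable_KN KN_diff KN_normsq_eq_0)+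
  then show "PN c \<mu> R N g \<in> KN c R N" "\<And>h. h \<in> KN c R N \<Longrightarrow> L2_inner M (\<lambda>z. g z - PN c \<mu> R N g z) h = 0"
    using f orth by auto
qed

lemma PN_KN:
  assumes f: "f \<in> KN c R N"
  shows "PN c \<mu> R N f = f"
  unfolding PN_def
proof (rule orth_proj_eqI[OF f])
  show "L2_inner M (\<lambda>z. f z - f z) h = 0" for h by (simp add: L2_inner_def)
qed (fact square_integrable_KN[OF f] square_integrable_KN KN_diff KN_normsq_eq_0)+

end

section \<open>Eigenbases of the truncated operators\<close>

lemma L2_normsq_add_le:
  assumes "square_integrable M f" "square_integrable M g"
  shows "L2_normsq M (\<lambda>z. f z + g z) \<le> 2 * L2_normsq M f + 2 * L2_normsq M g"
proof -
  have "0 \<le> L2_normsq M (\<lambda>z. f z + (- 1) * g z)" by (rule L2_normsq_nonneg)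
  also have "\<dots> = L2_normsq M f + L2_normsq M g - 2 * Re (L2_inner M f g)"
    unfolding L2_normsq_add[OF assms(1) square_integrable_cmult[OF assms(2)]]
      L2_normsq_cmult L2_inner_cmult_right by simp
  finally have "0 \<le> L2_normsq M f + L2_normsq M g - 2 * Re (L2_inner M f g)" .
  then show ?thesis using L2_normsq_add[OF assms] by linarith
qed

context radial_weight begin

lemma AE_M_nonzero: "AE z in M. z \<noteq> 0"
  unfolding disc_measure_def using AE_lborel_singleton[of "0 :: complex"]
  by (subst AE_density) (auto simp: AE_restrict_space_iff AE_completion_iff elim!: eventually_mono)

lemma KN_mono: "m \<le> n \<Longrightarrow> KN c R m \<subseteq> KN c R n"
  unfolding KN_def by (intro cfun.span_mono) auto

lemma KN_add: "f \<in> KN c R N \<Longrightarrow> g \<in> KN c R N \<Longrightarrow> (\<lambda>z. f z + g z) \<in> KN c R N"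
  using cfun.subspace_add[OF KN_subspace, of f N g] by (simp add: plus_fun_def)

lemma KN_cmult: "f \<in> KN c R N \<Longrightarrow> (\<lambda>z. a * f z) \<in> KN c R N"
  using cfun.subspace_scale[OF KN_subspace, of f N a] by (simp add: cscale_def)

end

locale radial_symbol = radial_weight +
  fixes \<sigma> :: "complex \<Rightarrow> real" and S :: real
  assumes sigma_M: "\<sigma> \<in> borel_measurable M"
    and sigma_bound: "\<And>z. z \<in> disc R \<Longrightarrow> \<bar>\<sigma> z\<bar> \<le> S"
begin

lemma square_integrable_symbol:
  "square_integrable M f \<Longrightarrow> square_integrable M (\<lambda>z. of_real (\<sigma> z) * f z)"
  using sigma_M sigma_bound by (intro square_integrable_mult_bounded[where K = S]) auto

lemma L2_inner_symbol_commute: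
  "L2_inner M (\<lambda>z. of_real (\<sigma> z) * f z) g = cnj (L2_inner M (\<lambda>z. of_real (\<sigma> z) * g z) f)"
proof -
  have "L2_inner M (\<lambda>z. of_real (\<sigma> z) * f z) g = L2_inner M f (\<lambda>z. of_real (\<sigma> z) * g z)"
    by (simp add: L2_inner_def mult_ac)
  then show ?thesis by (simp flip: L2_inner_commute)
qed

text \<open>The operator is the compression of multiplication by \<open>\<sigma>\<close> to the finite-dimensional space:
  the intermediate projection onto the space of analytic functions disappears when tested
  against polynomials.\<close>

lemma truncated_toeplitz_weak:
  assumes f: "f \<in> KN c R N"
  shows "truncated_toeplitz c \<mu> R \<sigma> N f \<in> KN c R N"
    and "\<And>h. h \<in> KN c R N \<Longrightarrow>
      L2_inner M (\<lambda>z. of_real (\<sigma> z) * f z - truncated_toeplitz c \<mu> R \<sigma> N f z) h = 0"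
proof -
  define g where "g = toeplitz c \<mu> R \<sigma> f"
  have A: "truncated_toeplitz c \<mu> R \<sigma> N f = PN c \<mu> R N g"
    by (simp add: truncated_toeplitz_def g_def PN_KN[OF f])
  have sf: "square_integrable M (\<lambda>z. of_real (\<sigma> z) * f z)"
    by (intro square_integrable_symbol square_integrable_KN[OF f])
  have g: "g \<in> Hc c R" "\<And>h. h \<in> Hc c R \<Longrightarrow> L2_inner M (\<lambda>z. of_real (\<sigma> z) * f z - g z) h = 0"
    unfolding g_def toeplitz_def using Hc_projection[OF sf] by auto
  have sg: "square_integrable M g" using g(1) by (rule square_integrable_Hc)
  show in_KN: "truncated_toeplitz c \<mu> R \<sigma> N f \<in> KN c R N"
    unfolding A by (rule PN_projection(1)[OF sg])
  fix h assume h: "h \<in> KN c R N"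
  note sq = sf sg square_integrable_KN[OF in_KN] square_integrable_KN[OF h]
  have "L2_inner M (\<lambda>z. of_real (\<sigma> z) * f z) h - L2_inner M g h = 0"
    using g(2)[of h] h KN_subset_Hc sq by (simp add: L2_inner_diff_left subset_eq)
  moreover have "L2_inner M g h - L2_inner M (truncated_toeplitz c \<mu> R \<sigma> N f) h = 0"
    using PN_projection(2)[OF sg h] sq unfolding A by (simp add: L2_inner_diff_left)
  ultimately show "L2_inner M (\<lambda>z. of_real (\<sigma> z) * f z - truncated_toeplitz c \<mu> R \<sigma> N f z) h = 0"
    using sq by (simp add: L2_inner_diff_left)
qed

text \<open>The eigenspace expressed by multiplication and the inner product alone; in this form it is
  visibly a linear subspace.\<close>

definition weak_eigenspace :: "nat \<Rightarrow> complex \<Rightarrow> (complex \<Rightarrow> complex) set" where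
  "weak_eigenspace N x = {f \<in> KN c R N. \<forall>h\<in>KN c R N. L2_inner M (\<lambda>z. of_real (\<sigma> z) * f z - x * f z) h = 0}"

lemma eigenspace_weak:
  "{f \<in> KN c R N. truncated_toeplitz c \<mu> R \<sigma> N f = cscale x f} = weak_eigenspace N x"
proof (intro set_eqI iffI)
  fix f assume "f \<in> {f \<in> KN c R N. truncated_toeplitz c \<mu> R \<sigma> N f = cscale x f}"
  then show "f \<in> weak_eigenspace N x"
    using truncated_toeplitz_weak(2)[of f N] by (auto simp: weak_eigenspace_def cscale_def)
next
  fix f assume "f \<in> weak_eigenspace N x"
  then have f: "f \<in> KN c R N"
    and orth: "\<And>h. h \<in> KN c R N \<Longrightarrow> L2_inner M (\<lambda>z. of_real (\<sigma> z) * f z - x * f z) h = 0"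
    by (auto simp: weak_eigenspace_def)
  define d where "d z = truncated_toeplitz c \<mu> R \<sigma> N f z - x * f z" for z
  have d: "d \<in> KN c R N"
    unfolding d_def by (intro KN_diff KN_cmult truncated_toeplitz_weak f)
  have sq: "square_integrable M (\<lambda>z. of_real (\<sigma> z) * f z - x * f z)"
    "square_integrable M (\<lambda>z. of_real (\<sigma> z) * f z - truncated_toeplitz c \<mu> R \<sigma> N f z)"
    "square_integrable M d"
    by (intro square_integrable_diff square_integrable_cmult square_integrable_symbol
        square_integrable_KN[OF f] square_integrable_KN[OF d]
        square_integrable_KN[OF truncated_toeplitz_weak(1)[OF f]])+
  have dd: "(\<lambda>z. (of_real (\<sigma> z) * f z - x * f z) -
     (of_real (\<sigma> z) * f z - truncated_toeplitz c \<mu> R \<sigma> N f z)) = d"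
    by (simp add: d_def fun_eq_iff)
  have "L2_inner M d d = 0"
    using L2_inner_diff_left[OF sq] orth[OF d] truncated_toeplitz_weak(2)[OF f d] unfolding dd by simp
  then have "d = (\<lambda>z. 0)" using KN_normsq_eq_0[OF d] by (simp add: L2_inner_self)
  then show "f \<in> {f \<in> KN c R N. truncated_toeplitz c \<mu> R \<sigma> N f = cscale x f}"
    using f by (auto simp: d_def fun_eq_iff cscale_def)
qed

lemma weak_eigenspace_subspace: "cfun.subspace (weak_eigenspace N x)"
  unfolding cfun.subspace_def
proof (intro conjI ballI allI)
  show "0 \<in> weak_eigenspace N x"
    using cfun.subspace_0[OF KN_subspace] by (simp add: weak_eigenspace_def L2_inner_def)
  fix f g assume fg: "f \<in> weak_eigenspace N x" "g \<in> weak_eigenspace N x"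
  have sq: "square_integrable M (\<lambda>z. of_real (\<sigma> z) * f z - x * f z)" if "f \<in> weak_eigenspace N x" for f
  proof -
    have "f \<in> KN c R N" using that by (simp add: weak_eigenspace_def)
    then show ?thesis
      by (intro square_integrable_diff square_integrable_cmult square_integrable_symbol
          square_integrable_KN[of f N])
  qed
  have eq: "(\<lambda>z. of_real (\<sigma> z) * (f + g) z - x * (f + g) z) =
    (\<lambda>z. (of_real (\<sigma> z) * f z - x * f z) + (of_real (\<sigma> z) * g z - x * g z))"
    by (simp add: fun_eq_iff algebra_simps)
  have "L2_inner M (\<lambda>z. of_real (\<sigma> z) * (f + g) z - x * (f + g) z) h = 0" if "h \<in> KN c R N" for h
    unfolding eq using fg that
    by (subst L2_inner_add_left[OF sq[OF fg(1)] sq[OF fg(2)] square_integrable_KN[OF that]])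
      (simp add: weak_eigenspace_def)
  moreover have "f + g \<in> KN c R N"
    using fg by (auto simp: weak_eigenspace_def intro: cfun.subspace_add[OF KN_subspace])
  ultimately show "f + g \<in> weak_eigenspace N x" by (simp add: weak_eigenspace_def)
next
  fix a f assume f: "f \<in> weak_eigenspace N x"
  have eq: "(\<lambda>z. of_real (\<sigma> z) * cscale a f z - x * cscale a f z) = (\<lambda>z. a * (of_real (\<sigma> z) * f z - x * f z))"
    by (simp add: fun_eq_iff algebra_simps cscale_def)
  have "L2_inner M (\<lambda>z. of_real (\<sigma> z) * cscale a f z - x * cscale a f z) h = 0" if "h \<in> KN c R N" for h
    unfolding eq L2_inner_cmult_left using f that by (simp add: weak_eigenspace_def)
  moreover have "cscale a f \<in> KN c R N"
    using f by (auto simp: weak_eigenspace_def intro: cfun.subspace_scale[OF KN_subspace])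
  ultimately show "cscale a f \<in> weak_eigenspace N x" by (simp add: weak_eigenspace_def)
qed

lemma weak_eigenspace_KN: "f \<in> weak_eigenspace N x \<Longrightarrow> f \<in> KN c R N"
  by (simp add: weak_eigenspace_def)

lemma weak_eigenspace_inner:
  assumes f: "f \<in> weak_eigenspace N x" and h: "h \<in> KN c R N"
  shows "L2_inner M (\<lambda>z. of_real (\<sigma> z) * f z) h = x * L2_inner M f h"
proof -
  note sq = square_integrable_KN[OF weak_eigenspace_KN[OF f]]
  have "L2_inner M (\<lambda>z. of_real (\<sigma> z) * f z - x * f z) h = 0"
    using f h by (simp add: weak_eigenspace_def)
  then show ?thesis
    unfolding L2_inner_diff_left[OF square_integrable_symbol[OF sq] square_integrable_cmult[OF sq]
        square_integrable_KN[OF h]] L2_inner_cmult_left by simp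
qed

text \<open>Since \<open>\<sigma>\<close> is real, \<open>\<langle>\<sigma> f, g\<rangle> = \<langle>f, \<sigma> g\<rangle>\<close>.\<close>

lemma weak_eigenspaces_orthogonal:
  assumes f: "f \<in> weak_eigenspace N (of_real x)" and g: "g \<in> weak_eigenspace N (of_real y)"
    and "x \<noteq> y"
  shows "L2_inner M f g = 0"
proof -
  note 1 = weak_eigenspace_inner[OF f weak_eigenspace_KN[OF g]]
  note 2 = weak_eigenspace_inner[OF g weak_eigenspace_KN[OF f]]
  have "of_real x * L2_inner M f g = of_real y * L2_inner M f g"
    using 1 2 L2_inner_symbol_commute[of f g] by (auto simp flip: L2_inner_commute)
  then show ?thesis using \<open>x \<noteq> y\<close> by simp
qed

text \<open>The list \<open>ev\<close> has \<open>N + 1\<close> entries and repeats each number as often as the dimension of its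
  eigenspace. So orthonormal bases of the eigenspaces, indexed by the positions of the
  eigenvalue in the list, fit together to an orthonormal family indexed by \<open>{0..N}\<close>; the
  spectral theorem is already contained in the list.\<close>

lemma orthonormal_eigenbasis:
  assumes ev: "eigenvalues_with_mult (truncated_toeplitz c \<mu> R \<sigma> N) (KN c R N) N ev"
  obtains v where "orthonormal_on M {0..N} v"
    "\<And>j. j \<in> {0..N} \<Longrightarrow> v j \<in> weak_eigenspace N (of_real (ev j))"
proof -
  have card: "card {j \<in> {0..N}. complex_of_real (ev j) = x} = cfun.dim (weak_eigenspace N x)" for x
    using ev unfolding eigenvalues_with_mult_def eigenspace_weak by blast
  have "\<exists>w. (\<forall>j\<in>{j \<in> {0..N}. ev j = x}. w j \<in> weak_eigenspace N (of_real x)) \<and>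
    orthonormal_on M {j \<in> {0..N}. ev j = x} w" for x
  proof (cases "{j \<in> {0..N}. ev j = x} = {}")
    case True
    then show ?thesis by (auto simp: orthonormal_on_def)
  next
    case False
    obtain B where B: "B \<subseteq> weak_eigenspace N (of_real x)" "cfun.independent B"
      "card B = cfun.dim (weak_eigenspace N (of_real x))"
      by (rule cfun.basis_exists[of "weak_eigenspace N (of_real x)"]) blast
    have sub: "u \<in> weak_eigenspace N (of_real x)" if "u \<in> cfun.span B" for u
      using cfun.span_minimal[OF B(1) weak_eigenspace_subspace] that by blast
    have cardB: "card {j \<in> {0..N}. ev j = x} = card B"
      using card[of "of_real x"] B(3) by simp
    moreover have "card {j \<in> {0..N}. ev j = x} > 0" using False by (simp add: card_gt_0_iff)
    ultimately have "finite B" by (simp add: card_ge_0_finite)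
    have "\<exists>w. (\<forall>j\<in>{j \<in> {0..N}. ev j = x}. w j \<in> cfun.span B) \<and>
      orthonormal_on M {j \<in> {0..N}. ev j = x} w"
    proof (rule gram_schmidt_functions[OF \<open>finite B\<close> B(2) _ _ _ cardB])
      fix u assume "u \<in> cfun.span B"
      then have u: "u \<in> KN c R N" using sub weak_eigenspace_KN by blast
      show "square_integrable M u" by (rule square_integrable_KN[OF u])
      show "L2_normsq M u = 0 \<Longrightarrow> u = (\<lambda>z. 0)" by (rule KN_normsq_eq_0[OF u])
    qed simp
    then show ?thesis using sub by blast
  qed
  then have "\<forall>x. \<exists>w. (\<forall>j\<in>{j \<in> {0..N}. ev j = x}. w j \<in> weak_eigenspace N (of_real x)) \<and>
    orthonormal_on M {j \<in> {0..N}. ev j = x} w" by blast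
  from choice[OF this] obtain W where W: "\<And>x j. j \<in> {0..N} \<Longrightarrow> ev j = x \<Longrightarrow> W x j \<in> weak_eigenspace N (of_real x)"
    "\<And>x. orthonormal_on M {j \<in> {0..N}. ev j = x} (W x)"
    by blast
  define v where "v j = W (ev j) j" for j
  have v: "v j \<in> weak_eigenspace N (of_real (ev j))" if "j \<in> {0..N}" for j
    unfolding v_def using that by (rule W(1)) simp
  have "orthonormal_on M {0..N} v"
    unfolding orthonormal_on_def
  proof (intro conjI ballI)
    fix i assume i: "i \<in> {0..N}"
    show "square_integrable M (v i)"
      using v[OF i] by (intro square_integrable_KN weak_eigenspace_KN)
    fix j assume j: "j \<in> {0..N}"
    show "L2_inner M (v i) (v j) = (if i = j then 1 else 0)"
    proof (cases "ev i = ev j")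
      case True
      then show ?thesis
        using W(2)[of "ev j"] i j unfolding orthonormal_on_def v_def by auto
    next
      case False
      then show ?thesis using weak_eigenspaces_orthogonal[OF v[OF i] v[OF j]] by auto
    qed
  qed
  then show ?thesis using v that by blast
qed

end

section \<open>Trigonometric polynomials act as shifts\<close>

text \<open>Laurent polynomials as functions on the unit circle. The inductive form lets closure under
  products, and the approximation property below, be proved on monomials and carried over sums.\<close>

inductive trig_poly :: "(complex \<Rightarrow> complex) \<Rightarrow> bool" where
  monom: "trig_poly (\<lambda>w. a * w powi i)"
| add: "trig_poly s \<Longrightarrow> trig_poly t \<Longrightarrow> trig_poly (\<lambda>w. s w + t w)"

lemma trig_poly_borel: "trig_poly t \<Longrightarrow> t \<in> borel_measurable borel"
proof (induction rule: trig_poly.induct)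
  case (monom a i)
  show ?case unfolding power_int_def by measurable
qed simp

lemma trig_poly_bounded:
  assumes "trig_poly t"
  obtains K where "\<And>w. cmod (t (sgn w)) \<le> K"
  using assms
proof (induction arbitrary: thesis rule: trig_poly.induct)
  case (monom a i)
  show ?case
  proof (rule monom)
    fix w :: complex
    have "cmod (sgn w powi i) \<le> 1"
      by (cases "w = 0") (auto simp: norm_power_int norm_sgn power_int_0_left_if)
    then show "cmod (a * sgn w powi i) \<le> cmod a"
      by (simp add: norm_mult mult_left_le)
  qed
next
  case (add s t)
  obtain K K' where "\<And>w. cmod (s (sgn w)) \<le> K" "\<And>w. cmod (t (sgn w)) \<le> K'"
    using add.IH by metis
  then have "cmod (s (sgn w) + t (sgn w)) \<le> K + K'" for w
    by (intro norm_triangle_mono)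
  then show ?case by (rule add.prems)
qed

lemma trig_poly_mult_sphere:
  assumes "trig_poly s" "trig_poly t"
  shows "\<exists>u. trig_poly u \<and> (\<forall>w\<in>sphere 0 1. u w = s w * t w)"
  using assms(1)
proof (induction rule: trig_poly.induct)
  case (monom a i)
  show ?case using assms(2)
  proof (induction rule: trig_poly.induct)
    case (monom b j)
    have "\<forall>w\<in>sphere 0 1. (a * b) * w powi (i + j) = (a * w powi i) * (b * w powi j)"
    proof
      fix w :: complex assume "w \<in> sphere 0 1"
      then have "w \<noteq> 0" by auto
      then show "(a * b) * w powi (i + j) = (a * w powi i) * (b * w powi j)"
        by (simp add: power_int_add)
    qed
    then show ?case using trig_poly.monom[of "a * b" "i + j"] by blast
  next
    case (add s t)
    then obtain u v where "trig_poly u" "trig_poly v"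
      "\<forall>w\<in>sphere 0 1. u w = (a * w powi i) * s w" "\<forall>w\<in>sphere 0 1. v w = (a * w powi i) * t w"
      by blast
    then show ?case
      by (intro exI[of _ "\<lambda>w. u w + v w"]) (auto intro: trig_poly.add simp: distrib_left)
  qed
next
  case (add s s')
  then obtain u v where "trig_poly u" "trig_poly v"
    "\<forall>w\<in>sphere 0 1. u w = s w * t w" "\<forall>w\<in>sphere 0 1. v w = s' w * t w"
    by blast
  then show ?case
    by (intro exI[of _ "\<lambda>w. u w + v w"]) (auto intro: trig_poly.add simp: distrib_right)
qed

text \<open>The algebra for the Stone-Weierstrass theorem. Membership is a condition on the circle
  only, where \<open>w powi (- 1) = cnj w\<close>.\<close>

definition real_trig_polys :: "(complex \<Rightarrow> real) set" where
  "real_trig_polys = {g. \<exists>t. trig_poly t \<and> (\<forall>w\<in>sphere 0 1. t w = of_real (g w))}"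

lemma continuous_on_trig_poly: "trig_poly t \<Longrightarrow> continuous_on (sphere 0 1) t"
proof (induction rule: trig_poly.induct)
  case (monom a i)
  show ?case by (intro continuous_intros) auto
qed (intro continuous_intros)

interpretation real_trig_polys: function_ring_on real_trig_polys "sphere 0 1"
proof
  show "compact (sphere 0 1 :: complex set)" by simp
next
  fix g assume "g \<in> real_trig_polys"
  then obtain t where t: "trig_poly t" "\<forall>w\<in>sphere 0 1. t w = of_real (g w)"
    unfolding real_trig_polys_def by blast
  have "continuous_on (sphere 0 1) (\<lambda>w. Re (t w))"
    by (intro continuous_intros continuous_on_trig_poly t)
  then show "continuous_on (sphere 0 1) g"
    by (rule continuous_on_eq) (use t in auto)
next
  fix f g assume "f \<in> real_trig_polys" "g \<in> real_trig_polys"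
  then obtain s t where st: "trig_poly s" "\<forall>w\<in>sphere 0 1. s w = of_real (f w)"
    "trig_poly t" "\<forall>w\<in>sphere 0 1. t w = of_real (g w)"
    unfolding real_trig_polys_def by blast
  show "(\<lambda>x. f x + g x) \<in> real_trig_polys"
    unfolding real_trig_polys_def using st
    by (intro CollectI exI[of _ "\<lambda>w. s w + t w"]) (auto intro: trig_poly.add)
  show "(\<lambda>x. f x * g x) \<in> real_trig_polys"
    unfolding real_trig_polys_def using trig_poly_mult_sphere[OF st(1,3)] st(2,4) by auto
next
  fix a :: real
  show "(\<lambda>_. a) \<in> real_trig_polys"
    unfolding real_trig_polys_def using trig_poly.monom[of "of_real a" 0] by auto
next
  fix x y :: complex assume xy: "x \<in> sphere 0 1" "y \<in> sphere 0 1" "x \<noteq> y"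
  have inv: "w powi (- 1) = cnj w" if "w \<in> sphere 0 1" for w :: complex
  proof -
    have "w * cnj w = 1" using that complex_norm_square[of w] by simp
    then show ?thesis by (simp add: power_int_minus inverse_unique)
  qed
  have Re: "Re \<in> real_trig_polys"
    unfolding real_trig_polys_def
  proof (intro CollectI exI conjI ballI)
    show "trig_poly (\<lambda>w. (1/2) * w powi 1 + (1/2) * w powi (- 1))" by (intro trig_poly.intros)
    show "(1/2) * w powi 1 + (1/2) * w powi (- 1) = of_real (Re w)" if "w \<in> sphere 0 1" for w
      unfolding inv[OF that] by (simp add: complex_eq_iff)
  qed
  have Im: "Im \<in> real_trig_polys"
    unfolding real_trig_polys_def
  proof (intro CollectI exI conjI ballI)
    show "trig_poly (\<lambda>w. (-\<i>/2) * w powi 1 + (\<i>/2) * w powi (- 1))" by (intro trig_poly.intros)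
    show "(-\<i>/2) * w powi 1 + (\<i>/2) * w powi (- 1) = of_real (Im w)" if "w \<in> sphere 0 1" for w
      unfolding inv[OF that] by (simp add: complex_eq_iff)
  qed
  show "\<exists>f\<in>real_trig_polys. f x \<noteq> f y"
    using Re Im xy(3) complex_eq_iff by blast
qed

context radial_weight begin

text \<open>Multiplication of \<open>e\<^sub>k\<close> by \<open>t (z / \<bar>z\<bar>)\<close> is asymptotically indistinguishable from a
  polynomial of degree at most \<open>k + m\<close>.\<close>

definition shift_approximable :: "(complex \<Rightarrow> complex) \<Rightarrow> (nat \<Rightarrow> complex \<Rightarrow> complex) \<Rightarrow> nat \<Rightarrow> bool" where
  "shift_approximable t h m \<longleftrightarrow> (\<forall>k\<ge>m. h k \<in> KN c R (k + m)) \<and>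
     (\<lambda>k. L2_normsq M (\<lambda>z. t (sgn z) * e k z - h k z)) \<longlonglongrightarrow> 0"

text \<open>For negative \<open>i\<close> this is the quotient condition read from the larger index to the smaller
  one.\<close>

lemma c_quotient_shift:
  "(\<lambda>k. c (k + nat (int k + i) + 1) / (sqrt (c (2 * nat (int k + i) + 1)) * sqrt (c (2 * k + 1)))) \<longlonglongrightarrow> 1"
proof (cases "i \<ge> 0")
  case True
  then have "k + nat (int k + i) + 1 = 2 * k + nat i + 1"
    "2 * nat (int k + i) + 1 = 2 * k + 2 * nat i + 1" for k
    by auto
  then show ?thesis using c_quotient[of "nat i"] by (simp only:)
next
  case False
  define n where "n = nat (- i)"
  have "filterlim (\<lambda>k::nat. k - n) at_top sequentially"
    by (rule filterlim_minus_const_nat_at_top)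
  from filterlim_compose[OF c_quotient[of n] this]
  have "(\<lambda>k. c (2 * (k - n) + n + 1) / (sqrt (c (2 * (k - n) + 2 * n + 1)) * sqrt (c (2 * (k - n) + 1)))) \<longlonglongrightarrow> 1" .
  moreover have "\<forall>\<^sub>F k in sequentially. c (2 * (k - n) + n + 1) / (sqrt (c (2 * (k - n) + 2 * n + 1)) * sqrt (c (2 * (k - n) + 1))) =
    c (k + nat (int k + i) + 1) / (sqrt (c (2 * nat (int k + i) + 1)) * sqrt (c (2 * k + 1)))"
  proof (rule eventually_sequentiallyI[of n])
    fix k assume k: "n \<le> k"
    then have "nat (int k + i) = k - n" using False by (simp add: n_def)
    moreover have "2 * (k - n) + n + 1 = k + (k - n) + 1" "2 * (k - n) + 2 * n + 1 = 2 * k + 1"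
      using k by auto
    ultimately show "c (2 * (k - n) + n + 1) / (sqrt (c (2 * (k - n) + 2 * n + 1)) * sqrt (c (2 * (k - n) + 1))) =
    c (k + nat (int k + i) + 1) / (sqrt (c (2 * nat (int k + i) + 1)) * sqrt (c (2 * k + 1)))"
      by (simp add: mult.commute)
  qed
  ultimately show ?thesis by (rule Lim_transform_eventually)
qed

text \<open>The functions \<open>(z / \<bar>z\<bar>)\<^sup>i e\<^sub>k\<close> and \<open>e\<^sub>l\<close> with \<open>l = k + i\<close> have the same phase, so the
  square of their distance is a radial integral. It equals \<open>2 - 2 Q k\<close>, where \<open>Q k\<close> is the
  quotient of moments that tends to \<open>1\<close>.\<close>

lemma monom_shift_approximable:
  "shift_approximable (\<lambda>w. a * w powi i) (\<lambda>k z. a * e (nat (int k + i)) z) (nat \<bar>i\<bar>)"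
  unfolding shift_approximable_def
proof (intro conjI allI impI)
  fix k assume "nat \<bar>i\<bar> \<le> k"
  then show "(\<lambda>z. a * e (nat (int k + i)) z) \<in> KN c R (k + nat \<bar>i\<bar>)"
    by (intro KN_cmult onb_in_KN) linarith
next
  define Q where "Q k = c (k + nat (int k + i) + 1) / (sqrt (c (2 * nat (int k + i) + 1)) * sqrt (c (2 * k + 1)))" for k
  have eq: "L2_normsq M (\<lambda>z. a * sgn z powi i * e k z - a * e (nat (int k + i)) z) = (cmod a)\<^sup>2 * (2 - 2 * Q k)"
    if k: "k \<ge> nat \<bar>i\<bar>" for k
  proof -
    define l where "l = nat (int k + i)"
    have l: "int l = int k + i" using k by (simp add: l_def)
    define A B where "A = sqrt (c (2 * k + 1))" and "B = sqrt (c (2 * l + 1))"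
    have AB: "A > 0" "B > 0" "A\<^sup>2 = c (2 * k + 1)" "B\<^sup>2 = c (2 * l + 1)"
      using c_pos by (auto simp: A_def B_def less_imp_le)
    have m: "integrable M (\<lambda>z. cmod z ^ n)" "(\<integral>z. cmod z ^ n \<partial>M) = c (n + 1)" for n
      using has_bochner_integral_cmod_power[of n] by (auto simp: has_bochner_integral_iff)
    have pt: "(cmod (sgn z powi i * e k z - e l z))\<^sup>2 =
       cmod z ^ (2 * k) / A\<^sup>2 + cmod z ^ (2 * l) / B\<^sup>2 - 2 / (A * B) * cmod z ^ (k + l)"
      if z: "z \<in> disc R" "z \<noteq> 0" for z
    proof -
      have zs: "z = of_real (cmod z) * sgn z" using z by (simp add: sgn_div_norm scaleR_conv_of_real)
      have "sgn z powi i * z ^ k = of_real (cmod z ^ k) * (sgn z powi i * sgn z ^ k)"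
        by (subst (2) zs) (simp add: power_mult_distrib mult_ac)
      also have "sgn z powi i * sgn z ^ k = sgn z ^ l"
        using z l power_int_add[of "sgn z" i "int k"] by (simp add: sgn_zero_iff add.commute flip: power_int_of_nat)
      finally have 1: "sgn z powi i * e k z = of_real (cmod z ^ k / A) * sgn z ^ l"
        using z by (simp add: onb_def A_def mult_ac)
      have "z ^ l = of_real (cmod z ^ l) * sgn z ^ l"
        by (subst (1) zs) (simp add: power_mult_distrib)
      then have 2: "e l z = of_real (cmod z ^ l / B) * sgn z ^ l"
        using z by (simp add: onb_def B_def)
      have "sgn z powi i * e k z - e l z = of_real (cmod z ^ k / A - cmod z ^ l / B) * sgn z ^ l"
        unfolding 1 2 by (simp only: left_diff_distrib of_real_diff)
      moreover have "cmod (sgn z ^ l) = 1" using z by (simp add: norm_power norm_sgn)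
      ultimately have "cmod (sgn z powi i * e k z - e l z) = \<bar>cmod z ^ k / A - cmod z ^ l / B\<bar>"
        by (simp only: norm_mult norm_of_real mult_1_right)
      then have "(cmod (sgn z powi i * e k z - e l z))\<^sup>2 = (cmod z ^ k / A - cmod z ^ l / B)\<^sup>2" by simp
      also have "\<dots> = cmod z ^ (2 * k) / A\<^sup>2 + cmod z ^ (2 * l) / B\<^sup>2 - 2 / (A * B) * cmod z ^ (k + l)"
        by (simp add: power2_diff power_divide power_add mult.commute[of 2] power_mult)
      finally show ?thesis .
    qed
    have "L2_normsq M (\<lambda>z. sgn z powi i * e k z - e l z) =
      (\<integral>z. cmod z ^ (2 * k) / A\<^sup>2 + cmod z ^ (2 * l) / B\<^sup>2 - 2 / (A * B) * cmod z ^ (k + l) \<partial>M)"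
      unfolding L2_normsq_def
    proof (rule integral_cong_AE)
      show "(\<lambda>z. (cmod (sgn z powi i * e k z - e l z))\<^sup>2) \<in> borel_measurable M"
        unfolding power_int_def by (rule borel_imp_M) measurable
      show "(\<lambda>z. cmod z ^ (2 * k) / A\<^sup>2 + cmod z ^ (2 * l) / B\<^sup>2 - 2 / (A * B) * cmod z ^ (k + l)) \<in> borel_measurable M"
        by (rule borel_imp_M) measurable
      show "AE z in M. (cmod (sgn z powi i * e k z - e l z))\<^sup>2 =
       cmod z ^ (2 * k) / A\<^sup>2 + cmod z ^ (2 * l) / B\<^sup>2 - 2 / (A * B) * cmod z ^ (k + l)"
        using AE_M_nonzero AE_space by eventually_elim (use pt in simp)
    qed
    also have "\<dots> = c (2 * k + 1) / A\<^sup>2 + c (2 * l + 1) / B\<^sup>2 - 2 / (A * B) * c (k + l + 1)"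
      by (subst Bochner_Integration.integral_diff Bochner_Integration.integral_add, (simp add: m)+)+
    also have "\<dots> = 2 - 2 * Q k"
    proof -
      have "Q k = c (k + l + 1) / (A * B)"
        unfolding Q_def l_def[symmetric] A_def B_def by (simp add: mult.commute)
      moreover have "c (2 * k + 1) / A\<^sup>2 = 1" "c (2 * l + 1) / B\<^sup>2 = 1"
        using c_pos[of "2 * k + 1"] c_pos[of "2 * l + 1"] by (simp_all add: AB(3,4))
      ultimately show ?thesis by (simp only:) simp
    qed
    finally have "L2_normsq M (\<lambda>z. a * (sgn z powi i * e k z - e l z)) = (cmod a)\<^sup>2 * (2 - 2 * Q k)"
      by (simp add: L2_normsq_cmult)
    then show ?thesis by (simp add: l_def right_diff_distrib mult.assoc)
  qed
  have "Q \<longlonglongrightarrow> 1" using c_quotient_shift[of i] unfolding Q_def .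
  then have "(\<lambda>k. (cmod a)\<^sup>2 * (2 - 2 * Q k)) \<longlonglongrightarrow> (cmod a)\<^sup>2 * (2 - 2 * 1)"
    by (intro tendsto_intros)
  then have "(\<lambda>k. (cmod a)\<^sup>2 * (2 - 2 * Q k)) \<longlonglongrightarrow> 0" by simp
  then show "(\<lambda>k. L2_normsq M (\<lambda>z. a * sgn z powi i * e k z - a * e (nat (int k + i)) z)) \<longlonglongrightarrow> 0"
    by (rule Lim_transform_eventually)
      (intro eventually_sequentiallyI[of "nat \<bar>i\<bar>"], rule eq[symmetric])
qed

lemma sgn_borel: "(sgn :: complex \<Rightarrow> complex) \<in> borel_measurable borel"
  unfolding sgn_div_norm[abs_def] by measurable

lemma square_integrable_trig_poly:
  assumes t: "trig_poly t" and g: "square_integrable M g"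
  shows "square_integrable M (\<lambda>z. t (sgn z) * g z)"
proof -
  obtain K where K: "\<And>w. cmod (t (sgn w)) \<le> K" using trig_poly_bounded[OF t] by blast
  have "(\<lambda>z. t (sgn z)) \<in> borel_measurable M"
    by (rule borel_imp_M, rule measurable_compose[OF sgn_borel trig_poly_borel[OF t]])
  then show ?thesis using K g by (intro square_integrable_mult_bounded[where K = K]) auto
qed

lemma trig_poly_shift_approximable:
  "trig_poly t \<Longrightarrow> \<exists>h m. shift_approximable t h m"
proof (induction rule: trig_poly.induct)
  case (monom a i)
  show ?case using monom_shift_approximable by blast
next
  case (add s t)
  obtain h m h' m' where h: "shift_approximable s h m" and h': "shift_approximable t h' m'"
    using add.IH by blast
  define H where "H k = (\<lambda>z. h k z + h' k z)" for k
  have in_KN: "H k \<in> KN c R (k + max m m')" if "k \<ge> max m m'" for k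
  proof -
    have "h k \<in> KN c R (k + m)" "h' k \<in> KN c R (k + m')"
      using h h' that unfolding shift_approximable_def by auto
    then have "h k \<in> KN c R (k + max m m')" "h' k \<in> KN c R (k + max m m')"
      using KN_mono[of "k + m" "k + max m m'"] KN_mono[of "k + m'" "k + max m m'"] by auto
    then show ?thesis unfolding H_def by (rule KN_add)
  qed
  define x where "x k = 2 * L2_normsq M (\<lambda>z. s (sgn z) * e k z - h k z) +
    2 * L2_normsq M (\<lambda>z. t (sgn z) * e k z - h' k z)" for k
  have "x \<longlonglongrightarrow> 2 * 0 + 2 * 0"
    unfolding x_def using h h' by (intro tendsto_intros) (auto simp: shift_approximable_def)
  then have "x \<longlonglongrightarrow> 0" by simp
  moreover have "L2_normsq M (\<lambda>z. (s (sgn z) + t (sgn z)) * e k z - H k z) \<le> x k" if k: "k \<ge> max m m'" for k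
  proof -
    have "h k \<in> KN c R (k + m)" "h' k \<in> KN c R (k + m')"
      using h h' k unfolding shift_approximable_def by auto
    then have "square_integrable M (\<lambda>z. s (sgn z) * e k z - h k z)" "square_integrable M (\<lambda>z. t (sgn z) * e k z - h' k z)"
      using square_integrable_trig_poly[OF add.hyps(1) square_integrable_onb[of k]]
        square_integrable_trig_poly[OF add.hyps(2) square_integrable_onb[of k]]
      by (auto intro!: square_integrable_diff intro: square_integrable_KN)
    from L2_normsq_add_le[OF this] show ?thesis
      by (simp add: x_def H_def algebra_simps)
  qed
  ultimately have "(\<lambda>k. L2_normsq M (\<lambda>z. (s (sgn z) + t (sgn z)) * e k z - H k z)) \<longlonglongrightarrow> 0"
    by (intro tendsto_sandwich[OF _ _ tendsto_const \<open>x \<longlonglongrightarrow> 0\<close>] eventually_sequentiallyI[of "max m m'"])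
      (auto simp: L2_normsq_nonneg)
  then have "shift_approximable (\<lambda>w. s w + t w) H (max m m')"
    unfolding shift_approximable_def using in_KN by blast
  then show ?case by blast
qed

end

section \<open>Density of the trigonometric polynomials\<close>

text \<open>A loop as a map on the circle; \<open>Arg2pi\<close> itself jumps at \<open>1\<close>.\<close>

lemma continuous_on_sphere_Arg2pi:
  fixes G :: "real \<Rightarrow> real"
  assumes "continuous_on UNIV G" "G 0 = G (2 * pi)"
  shows "continuous_on (sphere 0 1) (\<lambda>w. G (Arg2pi w))"
proof -
  define \<gamma> where "\<gamma> x = G (2 * pi * x)" for x
  have "path \<gamma>" unfolding path_def \<gamma>_def
    by (intro continuous_on_compose2[OF assms(1)] continuous_intros) auto
  then have "homotopic_loops UNIV \<gamma> \<gamma>"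
    using assms(2) by (simp add: homotopic_loops_refl pathfinish_def pathstart_def \<gamma>_def)
  from homotopic_with_imp_continuous[OF homotopic_loops_imp_homotopic_circlemaps[OF this]]
  have "continuous_on (sphere 0 1) (\<gamma> \<circ> (\<lambda>z. Arg2pi z / (2 * pi)))" by blast
  then show ?thesis by (simp add: \<gamma>_def o_def)
qed

lemma Arg2pi_cis: "0 \<le> t \<Longrightarrow> t < 2 * pi \<Longrightarrow> Arg2pi (cis t) = t"
  by (rule Arg2pi_unique[of 1]) (auto simp: cis_conv_exp)

lemma trig_poly_near_periodic:
  assumes G: "continuous_on UNIV G" "G 0 = G (2 * pi)" and "\<epsilon> > 0"
  obtains t where "trig_poly t"
    "\<And>x. 0 \<le> x \<Longrightarrow> x < 2 * pi \<Longrightarrow> cmod (of_real (G x) - t (cis x)) < \<epsilon>"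
proof -
  obtain g where g: "g \<in> real_trig_polys" "\<forall>w\<in>sphere 0 1. \<bar>G (Arg2pi w) - g w\<bar> < \<epsilon>"
    using real_trig_polys.Stone_Weierstrass_basic[OF continuous_on_sphere_Arg2pi[OF G] \<open>\<epsilon> > 0\<close>] by blast
  then obtain t where t: "trig_poly t" "\<forall>w\<in>sphere 0 1. t w = of_real (g w)"
    unfolding real_trig_polys_def by blast
  have "cmod (of_real (G x) - t (cis x)) < \<epsilon>" if "0 \<le> x" "x < 2 * pi" for x
  proof -
    have c: "cis x \<in> sphere 0 1" by simp
    then have "t (cis x) = of_real (g (cis x))" using t(2) by blast
    moreover have "\<bar>G x - g (cis x)\<bar> < \<epsilon>" using g(2) c Arg2pi_cis[OF that] by metis
    ultimately show ?thesis by (simp flip: of_real_diff)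
  qed
  with t(1) show ?thesis by (rule that)
qed

text \<open>\<open>F\<close> is the limit almost everywhere of continuous functions. Clipping these at height \<open>B\<close>
  and multiplying them by a plateau that vanishes at \<open>0\<close> and \<open>2 pi\<close> makes them bounded and
  periodic without changing the limit; periodic continuous functions are uniform limits of
  trigonometric polynomials.\<close>

lemma trig_poly_dense_L2:
  fixes F :: "real \<Rightarrow> real"
  assumes F: "F \<in> borel_measurable (lebesgue_on {0..<2 * pi})"
    and B: "AE x in lebesgue_on {0..<2 * pi}. \<bar>F x\<bar> \<le> B" and \<eta>: "\<eta> > 0"
  obtains t where "trig_poly t"
    "(\<integral>x. (cmod (of_real (F x) - t (cis x)))\<^sup>2 \<partial>lebesgue_on {0..<2 * pi}) < \<eta>"
proof -
  let ?I = "{0..<2 * pi}"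
  let ?L = "lebesgue_on ?I"
  have meas_L: "measure ?L (space ?L) = 2 * pi" "emeasure ?L (space ?L) < \<infinity>"
    by (simp_all add: space_restrict_space emeasure_restrict_space measure_restrict_space)
  interpret L: finite_measure ?L by standard (use meas_L in simp)
  have "(\<lambda>x. indicator ?I x *\<^sub>R F x) \<in> borel_measurable lebesgue"
    using F by (subst (asm) borel_measurable_restrict_space_iff) auto
  then have "(\<lambda>x. indicator ?I x *\<^sub>R F x) measurable_on UNIV"
    by (rule lebesgue_measurable_imp_measurable_on) simp
  then obtain N g where N: "negligible N" and g: "\<And>n. continuous_on UNIV (g n)"
    and gF: "\<And>x. x \<notin> N \<Longrightarrow> (\<lambda>n. g n x) \<longlonglongrightarrow> indicator ?I x *\<^sub>R F x"
    unfolding measurable_on_def by auto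
  define G where "G n x = max (- \<bar>B\<bar>) (min \<bar>B\<bar> (g n x)) *
    (max 0 (min 1 (real n * x)) * max 0 (min 1 (real n * (2 * pi - x))))" for n :: nat and x :: real
  have G: "continuous_on UNIV (G n)" "G n 0 = G n (2 * pi)" for n
    unfolding G_def by (intro continuous_intros g) simp
  have GB: "\<bar>G n x\<bar> \<le> \<bar>B\<bar>" for n x
  proof -
    have "\<bar>G n x\<bar> \<le> \<bar>B\<bar> * (1 * 1)"
      unfolding G_def abs_mult by (intro mult_mono) auto
    then show ?thesis by simp
  qed
  have GL: "G n \<in> borel_measurable ?L" for n
    using borel_measurable_continuous_onI[OF G(1), of n]
    by (intro measurable_restrict_space1 measurable_completion) simp
  have cut: "(\<lambda>n. max 0 (min 1 (real n * y))) \<longlonglongrightarrow> 1" if "y > 0" for y :: real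
  proof (rule tendsto_eventually)
    obtain n0 :: nat where n0: "1 / y < real n0" using reals_Archimedean2[of "1 / y"] by auto
    have "1 \<le> real n * y" if "n \<ge> n0" for n
    proof -
      have "1 / y \<le> real n" using n0 that by linarith
      then show ?thesis using \<open>y > 0\<close> by (simp add: field_simps)
    qed
    then show "\<forall>\<^sub>F n in sequentially. max 0 (min 1 (real n * y)) = 1"
      by (intro eventually_sequentiallyI[of n0]) auto
  qed
  have GF: "AE x in ?L. (\<lambda>n. G n x) \<longlonglongrightarrow> F x"
  proof -
    have "AE x in lebesgue. x \<notin> N"
      using N by (intro AE_not_in) (simp add: negligible_iff_null_sets)
    then have "AE x in ?L. x \<notin> N" by (auto simp: AE_restrict_space_iff elim!: eventually_mono)
    moreover have "AE x in lebesgue. x \<noteq> (0 :: real)"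
      using AE_lborel_singleton[of "0::real"] by (simp add: AE_completion_iff)
    then have "AE x in ?L. x \<noteq> 0" by (auto simp: AE_restrict_space_iff elim!: eventually_mono)
    ultimately show ?thesis
      using B AE_space
    proof eventually_elim
      case (elim x)
      then have x: "0 < x" "x < 2 * pi" "\<bar>F x\<bar> \<le> \<bar>B\<bar>" by (auto simp: space_restrict_space)
      have "(\<lambda>n. g n x) \<longlonglongrightarrow> F x" using gF[OF elim(1)] x by simp
      then have "(\<lambda>n. G n x) \<longlonglongrightarrow> max (- \<bar>B\<bar>) (min \<bar>B\<bar> (F x)) * (1 * 1)"
        unfolding G_def using x by (intro tendsto_intros cut) auto
      then show ?case using x(3) by simp
    qed
  qed
  have "(\<lambda>n. \<integral>x. (F x - G n x)\<^sup>2 \<partial>?L) \<longlonglongrightarrow> (\<integral>x. 0 \<partial>?L)"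
  proof (rule integral_dominated_convergence[where w = "\<lambda>_. (2 * \<bar>B\<bar>)\<^sup>2"])
    show "AE x in ?L. (\<lambda>n. (F x - G n x)\<^sup>2) \<longlonglongrightarrow> 0"
      using GF
    proof eventually_elim
      case (elim x)
      then have "(\<lambda>n. (F x - G n x)\<^sup>2) \<longlonglongrightarrow> (F x - F x)\<^sup>2" by (intro tendsto_intros)
      then show ?case by simp
    qed
    show "AE x in ?L. norm ((F x - G n x)\<^sup>2) \<le> (2 * \<bar>B\<bar>)\<^sup>2" for n
      using B
    proof eventually_elim
      case (elim x)
      then have "\<bar>F x - G n x\<bar> \<le> 2 * \<bar>B\<bar>" using GB[of n x] by linarith
      then have "\<bar>F x - G n x\<bar>\<^sup>2 \<le> (2 * \<bar>B\<bar>)\<^sup>2" by (intro power_mono) auto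
      then show ?case by simp
    qed
  qed (use F GL in auto)
  then have "\<forall>\<^sub>F n in sequentially. (\<integral>x. (F x - G n x)\<^sup>2 \<partial>?L) < \<eta> / 4"
    by (rule order_tendstoD(2)) (use \<eta> in simp)
  then obtain n where n: "(\<integral>x. (F x - G n x)\<^sup>2 \<partial>?L) < \<eta> / 4"
    by (auto dest: eventually_happens)
  define \<epsilon> where "\<epsilon> = sqrt (\<eta> / (8 * pi))"
  have \<epsilon>: "\<epsilon> > 0" "\<epsilon>\<^sup>2 = \<eta> / (8 * pi)" using \<eta> by (auto simp: \<epsilon>_def)
  obtain t where t: "trig_poly t"
    "\<And>x. 0 \<le> x \<Longrightarrow> x < 2 * pi \<Longrightarrow> cmod (of_real (G n x) - t (cis x)) < \<epsilon>"
    using trig_poly_near_periodic[OF G \<epsilon>(1)] by blast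
  have int1: "integrable ?L (\<lambda>x. (F x - G n x)\<^sup>2)"
  proof (rule L.integrable_const_bound[where B = "(2 * \<bar>B\<bar>)\<^sup>2"])
    show "AE x in ?L. norm ((F x - G n x)\<^sup>2) \<le> (2 * \<bar>B\<bar>)\<^sup>2"
      using B
    proof eventually_elim
      case (elim x)
      then have "\<bar>F x - G n x\<bar> \<le> 2 * \<bar>B\<bar>" using GB[of n x] by linarith
      then have "\<bar>F x - G n x\<bar>\<^sup>2 \<le> (2 * \<bar>B\<bar>)\<^sup>2" by (intro power_mono) auto
      then show ?case by simp
    qed
  qed (use F GL in measurable)
  have "(\<integral>x. (cmod (of_real (F x) - t (cis x)))\<^sup>2 \<partial>?L) \<le> (\<integral>x. 2 * (F x - G n x)\<^sup>2 + 2 * \<epsilon>\<^sup>2 \<partial>?L)"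
  proof (rule integral_mono_AE')
    show "integrable ?L (\<lambda>x. 2 * (F x - G n x)\<^sup>2 + 2 * \<epsilon>\<^sup>2)" using int1 by auto
    show "AE x in ?L. (cmod (of_real (F x) - t (cis x)))\<^sup>2 \<le> 2 * (F x - G n x)\<^sup>2 + 2 * \<epsilon>\<^sup>2"
    proof (rule AE_I2)
      fix x assume "x \<in> space ?L"
      then have "cmod (of_real (G n x) - t (cis x)) \<le> \<epsilon>"
        using t(2)[of x] by (simp add: space_restrict_space)
      moreover have "cmod (of_real (F x) - t (cis x)) \<le> cmod (of_real (F x) - of_real (G n x)) + cmod (of_real (G n x) - t (cis x))"
        using norm_triangle_ineq[of "of_real (F x) - of_real (G n x)" "of_real (G n x) - t (cis x)"] by simp
      moreover have "cmod (of_real (F x) - of_real (G n x)) = \<bar>F x - G n x\<bar>"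
        by (simp flip: of_real_diff)
      ultimately have "cmod (of_real (F x) - t (cis x)) \<le> \<bar>F x - G n x\<bar> + \<epsilon>" by linarith
      then have "(cmod (of_real (F x) - t (cis x)))\<^sup>2 \<le> (\<bar>F x - G n x\<bar> + \<epsilon>)\<^sup>2" by (intro power_mono) auto
      also have "\<dots> \<le> 2 * (F x - G n x)\<^sup>2 + 2 * \<epsilon>\<^sup>2"
        using zero_le_power2[of "\<bar>F x - G n x\<bar> - \<epsilon>"] by (simp add: power2_sum power2_diff)
      finally show "(cmod (of_real (F x) - t (cis x)))\<^sup>2 \<le> 2 * (F x - G n x)\<^sup>2 + 2 * \<epsilon>\<^sup>2" .
    qed
  qed auto
  also have "\<dots> = 2 * (\<integral>x. (F x - G n x)\<^sup>2 \<partial>?L) + 2 * \<epsilon>\<^sup>2 * (2 * pi)"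
    using int1 meas_L by simp
  also have "2 * \<epsilon>\<^sup>2 * (2 * pi) = \<eta> / 2" by (simp add: \<epsilon>(2))
  also have "2 * (\<integral>x. (F x - G n x)\<^sup>2 \<partial>?L) + \<eta> / 2 < \<eta>" using n by simp
  finally show ?thesis using t(1) that by blast
qed

lemma cesaro_mean_tendsto:
  fixes a :: "nat \<Rightarrow> real"
  assumes "a \<longlonglongrightarrow> L"
  shows "(\<lambda>N. (\<Sum>k\<in>{0..N}. a k) / (real N + 1)) \<longlonglongrightarrow> L"
proof (rule LIMSEQ_I)
  fix r :: real assume "r > 0"
  then obtain K where K: "\<And>k. k \<ge> K \<Longrightarrow> \<bar>a k - L\<bar> < r / 2"
    using LIMSEQ_D[OF assms, of "r / 2"] by auto
  define C where "C = (\<Sum>k<K. \<bar>a k - L\<bar>)"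
  obtain n0 :: nat where n0: "2 * C / r < real n0" using reals_Archimedean2[of "2 * C / r"] by auto
  show "\<exists>n0. \<forall>N\<ge>n0. norm ((\<Sum>k\<in>{0..N}. a k) / (real N + 1) - L) < r"
  proof (intro exI[of _ n0] allI impI)
    fix N assume N: "n0 \<le> N"
    have "(\<Sum>k\<in>{0..N}. a k) / (real N + 1) - L = (\<Sum>k\<in>{0..N}. a k - L) / (real N + 1)"
      by (simp add: sum_subtractf field_simps)
    also have "\<bar>\<dots>\<bar> \<le> (\<Sum>k\<in>{0..N}. \<bar>a k - L\<bar>) / (real N + 1)"
      by (simp add: divide_right_mono sum_abs)
    also have "(\<Sum>k\<in>{0..N}. \<bar>a k - L\<bar>) \<le> (\<Sum>k\<in>{0..N}. (if k < K then \<bar>a k - L\<bar> else 0) + r / 2)"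
      using K \<open>r > 0\<close> by (intro sum_mono) (auto simp: not_less less_imp_le)
    also have "\<dots> = (\<Sum>k\<in>{0..N} \<inter> {..<K}. \<bar>a k - L\<bar>) + (real N + 1) * (r / 2)"
      by (simp add: sum.distrib sum.inter_restrict lessThan_def)
    also have "(\<Sum>k\<in>{0..N} \<inter> {..<K}. \<bar>a k - L\<bar>) \<le> C"
      unfolding C_def by (intro sum_mono2) auto
    finally have "\<bar>(\<Sum>k\<in>{0..N}. a k) / (real N + 1) - L\<bar> \<le> (C + (real N + 1) * (r / 2)) / (real N + 1)"
      by (simp add: divide_right_mono)
    also have "\<dots> = C / (real N + 1) + r / 2" by (simp add: field_simps)
    also have "C / (real N + 1) < r / 2"
    proof -
      have "2 * C / r < real N + 1" using n0 N by linarith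
      then show ?thesis using \<open>r > 0\<close> by (simp add: field_simps)
    qed
    finally show "norm ((\<Sum>k\<in>{0..N}. a k) / (real N + 1) - L) < r" by simp
  qed
qed

section \<open>The limit of eigenvalue means\<close>

context radial_symbol begin

text \<open>Take a trigonometric polynomial \<open>t\<close> close to the radial limit in \<open>L\<^sup>2\<close> of the circle. The
  mass of \<open>e\<^sub>k\<close> moves to the boundary, so the squared distance from \<open>\<sigma> e\<^sub>k\<close> to \<open>t (z / \<bar>z\<bar>) e\<^sub>k\<close>
  tends to the mean of \<open>\<bar>\<sigma>' - t\<bar>\<^sup>2\<close>, and \<open>t (z / \<bar>z\<bar>) e\<^sub>k\<close> is asymptotically a polynomial.\<close>

lemma symbol_near_shifts:
  assumes \<sigma>: "\<sigma> \<in> borel_measurable (lebesgue_on (disc R))"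
    and lim: "AE t in lebesgue_on {0..<2 * pi}. ((\<lambda>r. \<sigma> (rcis r t)) \<longlongrightarrow> \<sigma>' t) (to_radius R)"
    and "\<eta> > 0"
  obtains h m K where "\<And>k. k \<ge> m \<Longrightarrow> h k \<in> KN c R (k + m)"
    "\<And>k. k \<ge> K \<Longrightarrow> L2_normsq M (\<lambda>z. of_real (\<sigma> z) * e k z - h k z) < \<eta>"
proof -
  let ?L = "lebesgue_on {0..<2 * pi}"
  have \<sigma>': "\<sigma>' \<in> borel_measurable ?L"
    by (rule radial_limit_measurable[OF \<sigma> sigma_bound lim])
  have nontriv: "to_radius R \<noteq> bot"
    by (simp add: to_radius_def trivial_limit_at_left_real)
  have pos: "\<forall>\<^sub>F r in to_radius R. 0 < r \<and> ereal r < R"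
  proof (cases R)
    case (real x)
    then show ?thesis using R_pos eventually_at_left[of 0 x] by (auto simp: to_radius_def)
  next
    case PInf
    then show ?thesis by (simp add: to_radius_def eventually_gt_at_top)
  qed (use R_pos in auto)
  have "AE t in ?L. \<bar>\<sigma>' t\<bar> \<le> S"
    using lim
  proof eventually_elim
    case (elim t)
    have "((\<lambda>r. \<bar>\<sigma> (rcis r t)\<bar>) \<longlongrightarrow> \<bar>\<sigma>' t\<bar>) (to_radius R)" using elim by (rule tendsto_rabs)
    moreover have "\<forall>\<^sub>F r in to_radius R. \<bar>\<sigma> (rcis r t)\<bar> \<le> S"
      using pos by eventually_elim (auto intro!: sigma_bound simp: disc_def)
    ultimately show ?case using nontriv by (rule tendsto_upperbound)
  qed
  then obtain t where t: "trig_poly t"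
    "(\<integral>x. (cmod (of_real (\<sigma>' x) - t (cis x)))\<^sup>2 \<partial>?L) < \<eta> / 4"
    using trig_poly_dense_L2[OF \<sigma>', of S "\<eta> / 4"] \<open>\<eta> > 0\<close> by auto
  obtain T where T: "\<And>w. cmod (t (sgn w)) \<le> T" using trig_poly_bounded[OF t(1)] by blast
  obtain h m where h: "shift_approximable t h m" using trig_poly_shift_approximable[OF t(1)] by blast
  define F where "F z = (cmod (of_real (\<sigma> z) - t (sgn z)))\<^sup>2" for z
  define F' where "F' x = (cmod (of_real (\<sigma>' x) - t (cis x)))\<^sup>2" for x
  have tm: "(\<lambda>z. t (sgn z)) \<in> borel_measurable (lebesgue_on (disc R))"
    using measurable_compose[OF sgn_borel trig_poly_borel[OF t(1)]]
    by (intro measurable_restrict_space1 measurable_completion) simp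
  have Fm: "F \<in> borel_measurable (lebesgue_on (disc R))"
    unfolding F_def using \<sigma> tm by measurable
  have FB: "\<bar>F z\<bar> \<le> (S + T)\<^sup>2" if "z \<in> disc R" for z
  proof -
    have "cmod (of_real (\<sigma> z) - t (sgn z)) \<le> S + T"
      using sigma_bound[OF that] T[of z] norm_triangle_ineq4[of "of_real (\<sigma> z)" "t (sgn z)"] by simp
    then show ?thesis unfolding F_def by (simp add: power_mono)
  qed
  have Flim: "AE x in ?L. ((\<lambda>r. F (rcis r x)) \<longlongrightarrow> F' x) (to_radius R)"
    using lim
  proof eventually_elim
    case (elim x)
    have "((\<lambda>r. (cmod (of_real (\<sigma> (rcis r x)) - t (cis x)))\<^sup>2) \<longlongrightarrow> F' x) (to_radius R)"
      unfolding F'_def using elim by (intro tendsto_intros)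
    moreover have "\<forall>\<^sub>F r in to_radius R. (cmod (of_real (\<sigma> (rcis r x)) - t (cis x)))\<^sup>2 = F (rcis r x)"
      using pos
    proof eventually_elim
      case (elim r)
      then have "sgn (rcis r x) = cis x" by (simp add: sgn_eq rcis_def norm_mult)
      then show ?case by (simp add: F_def)
    qed
    ultimately show ?case by (rule Lim_transform_eventually)
  qed
  have "(\<lambda>k. (\<integral>z. F z * cmod z ^ (2 * k) \<partial>M) / c (2 * k + 1)) \<longlonglongrightarrow> (\<integral>x. F' x \<partial>?L) / (2 * pi)"
    by (rule disc_average_tendsto(2)[OF Fm FB Flim])
  moreover have "(\<integral>z. F z * cmod z ^ (2 * k) \<partial>M) / c (2 * k + 1) =
    L2_normsq M (\<lambda>z. of_real (\<sigma> z) * e k z - t (sgn z) * e k z)" for k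
  proof -
    have "(\<integral>z. F z * cmod z ^ (2 * k) \<partial>M) / c (2 * k + 1) = (\<integral>z. F z * cmod z ^ (2 * k) / c (2 * k + 1) \<partial>M)"
      by (rule integral_divide_zero[symmetric])
    also have "\<dots> = (\<integral>z. (cmod (of_real (\<sigma> z) * e k z - t (sgn z) * e k z))\<^sup>2 \<partial>M)"
      by (intro Bochner_Integration.integral_cong)
        (simp_all add: F_def norm_mult power_mult_distrib cmod_onb flip: left_diff_distrib)
    finally show ?thesis by (simp add: L2_normsq_def)
  qed
  ultimately have lim1: "(\<lambda>k. L2_normsq M (\<lambda>z. of_real (\<sigma> z) * e k z - t (sgn z) * e k z)) \<longlonglongrightarrow> (\<integral>x. F' x \<partial>?L) / (2 * pi)"
    by simp
  have lim2: "(\<lambda>k. L2_normsq M (\<lambda>z. t (sgn z) * e k z - h k z)) \<longlonglongrightarrow> 0"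
    using h by (simp add: shift_approximable_def)
  have "(\<lambda>k. 2 * L2_normsq M (\<lambda>z. of_real (\<sigma> z) * e k z - t (sgn z) * e k z) +
    2 * L2_normsq M (\<lambda>z. t (sgn z) * e k z - h k z)) \<longlonglongrightarrow> 2 * ((\<integral>x. F' x \<partial>?L) / (2 * pi)) + 2 * 0"
    by (intro tendsto_intros lim1 lim2)
  moreover have "2 * ((\<integral>x. F' x \<partial>?L) / (2 * pi)) + 2 * 0 < \<eta>"
  proof -
    have "(\<integral>x. F' x \<partial>?L) \<ge> 0" unfolding F'_def by simp
    then have "(\<integral>x. F' x \<partial>?L) / pi \<le> (\<integral>x. F' x \<partial>?L) / 1"
      using pi_ge_two by (intro divide_left_mono) auto
    then show ?thesis using t(2) \<open>\<eta> > 0\<close> unfolding F'_def by simp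
  qed
  ultimately have "\<forall>\<^sub>F k in sequentially. 2 * L2_normsq M (\<lambda>z. of_real (\<sigma> z) * e k z - t (sgn z) * e k z) +
    2 * L2_normsq M (\<lambda>z. t (sgn z) * e k z - h k z) < \<eta>"
    by (rule order_tendstoD(2))
  then obtain K where K: "\<And>k. k \<ge> K \<Longrightarrow> 2 * L2_normsq M (\<lambda>z. of_real (\<sigma> z) * e k z - t (sgn z) * e k z) +
    2 * L2_normsq M (\<lambda>z. t (sgn z) * e k z - h k z) < \<eta>"
    unfolding eventually_sequentially by blast
  have hK: "h k \<in> KN c R (k + m)" if "k \<ge> m" for k
    using h that by (simp add: shift_approximable_def)
  have "L2_normsq M (\<lambda>z. of_real (\<sigma> z) * e k z - h k z) < \<eta>" if k: "k \<ge> max K m" for k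
  proof -
    have sq: "square_integrable M (\<lambda>z. of_real (\<sigma> z) * e k z - t (sgn z) * e k z)"
      "square_integrable M (\<lambda>z. t (sgn z) * e k z - h k z)"
      using hK[of k] k
      by (auto intro!: square_integrable_diff square_integrable_symbol square_integrable_trig_poly
          square_integrable_onb t(1) intro: square_integrable_KN)
    have "L2_normsq M (\<lambda>z. of_real (\<sigma> z) * e k z - h k z) \<le>
      2 * L2_normsq M (\<lambda>z. of_real (\<sigma> z) * e k z - t (sgn z) * e k z) +
      2 * L2_normsq M (\<lambda>z. t (sgn z) * e k z - h k z)"
      using L2_normsq_add_le[OF sq] by simp
    also have "\<dots> < \<eta>" using K[of k] k by simp
    finally show ?thesis .
  qed
  with hK show ?thesis by (rule that)
qed

lemma normsq_symbol_onb: "L2_normsq M (\<lambda>z. of_real (\<sigma> z) * e k z) \<le> S\<^sup>2"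
proof -
  have "L2_normsq M (\<lambda>z. of_real (\<sigma> z) * e k z) \<le> (\<integral>z. S\<^sup>2 * (cmod (e k z))\<^sup>2 \<partial>M)"
    unfolding L2_normsq_def
  proof (rule integral_mono)
    show "integrable M (\<lambda>z. (cmod (of_real (\<sigma> z) * e k z))\<^sup>2)"
      using square_integrable_symbol[OF square_integrable_onb] by (simp add: square_integrable_def)
    show "integrable M (\<lambda>z. S\<^sup>2 * (cmod (e k z))\<^sup>2)"
      using square_integrable_onb by (simp add: square_integrable_def)
    fix z assume "z \<in> space M"
    then have "\<bar>\<sigma> z\<bar>\<^sup>2 \<le> S\<^sup>2" using sigma_bound[of z] by (intro power_mono) auto
    then show "(cmod (of_real (\<sigma> z) * e k z))\<^sup>2 \<le> S\<^sup>2 * (cmod (e k z))\<^sup>2"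
      by (simp add: norm_mult power_mult_distrib mult_right_mono)
  qed
  also have "\<dots> = S\<^sup>2"
  proof -
    have "complex_of_real (L2_normsq M (e k)) = 1"
      using orthonormal_onb[of "{k}"] unfolding L2_inner_self[symmetric] orthonormal_on_def by simp
    then show ?thesis by (simp add: L2_normsq_def)
  qed
  finally show ?thesis .
qed

text \<open>The eigenvalue mean is compared with the mean of \<open>a\<^sub>k = \<integral> f (\<sigma>) \<bar>e\<^sub>k\<bar>\<^sup>2\<close>, which converges
  since \<open>a\<^sub>k\<close> does. In the comparison \<open>\<sigma> e\<^sub>k\<close> is approximated by \<open>h k\<close> for all \<open>k\<close> except
  boundedly many at either end of \<open>{0..N}\<close>, where \<open>0\<close> is used instead; the loss there is bounded
  and disappears after division by \<open>N + 1\<close>.\<close>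

theorem eigenvalue_mean_tendsto:
  fixes f :: "real \<Rightarrow> real"
  assumes \<sigma>: "\<sigma> \<in> borel_measurable (lebesgue_on (disc R))"
    and lim: "AE t in lebesgue_on {0..<2 * pi}. ((\<lambda>r. \<sigma> (rcis r t)) \<longlongrightarrow> \<sigma>' t) (to_radius R)"
    and ev: "\<And>N. eigenvalues_with_mult (truncated_toeplitz c \<mu> R \<sigma> N) (KN c R N) N (ev N)"
    and f: "\<And>x. \<bar>f x\<bar> \<le> B" "\<And>x y. \<bar>f x - f y\<bar> \<le> L * \<bar>x - y\<bar>"
  shows "(\<lambda>N. (\<Sum>j\<in>{0..N}. f (ev N j)) / (real N + 1))
    \<longlonglongrightarrow> (\<integral>t. f (\<sigma>' t) \<partial>lebesgue_on {0..<2 * pi}) / (2 * pi)"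
proof -
  have L0: "L \<ge> 0" using f(2)[of 0 1] by (auto intro: order_trans[OF abs_ge_zero])
  have "continuous_on UNIV f"
  proof (rule lipschitz_on_continuous_on[where L = L], rule lipschitz_onI)
    show "dist (f x) (f y) \<le> L * dist x y" for x y using f(2) by (simp add: dist_real_def)
  qed (rule L0)
  then have contf: "isCont f x" for x by (simp add: continuous_on_eq_continuous_at)
  have fm: "f \<in> borel_measurable borel"
    using \<open>continuous_on UNIV f\<close> by (rule borel_measurable_continuous_onI)
  define a where "a k = (\<integral>z. f (\<sigma> z) * (cmod (e k z))\<^sup>2 \<partial>M)" for k
  have "a \<longlonglongrightarrow> (\<integral>t. f (\<sigma>' t) \<partial>lebesgue_on {0..<2 * pi}) / (2 * pi)"
  proof -
    have "(\<lambda>k. (\<integral>z. f (\<sigma> z) * cmod z ^ (2 * k) \<partial>M) / c (2 * k + 1)) \<longlonglongrightarrow> (\<integral>t. f (\<sigma>' t) \<partial>lebesgue_on {0..<2 * pi}) / (2 * pi)"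
    proof (rule disc_average_tendsto(2))
      show "(\<lambda>z. f (\<sigma> z)) \<in> borel_measurable (lebesgue_on (disc R))"
        by (rule measurable_compose[OF \<sigma> fm])
      show "AE t in lebesgue_on {0..<2 * pi}. ((\<lambda>r. f (\<sigma> (rcis r t))) \<longlongrightarrow> f (\<sigma>' t)) (to_radius R)"
        using lim by eventually_elim (rule isCont_tendsto_compose[OF contf])
    qed (rule f(1))
    also have "(\<lambda>k. (\<integral>z. f (\<sigma> z) * cmod z ^ (2 * k) \<partial>M) / c (2 * k + 1)) = a"
    proof
      fix k
      have "(\<integral>z. f (\<sigma> z) * cmod z ^ (2 * k) \<partial>M) / c (2 * k + 1) = (\<integral>z. f (\<sigma> z) * cmod z ^ (2 * k) / c (2 * k + 1) \<partial>M)"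
        by (rule integral_divide_zero[symmetric])
      also have "\<dots> = a k"
        unfolding a_def by (intro Bochner_Integration.integral_cong) (simp_all add: cmod_onb)
      finally show "(\<integral>z. f (\<sigma> z) * cmod z ^ (2 * k) \<partial>M) / c (2 * k + 1) = a k" .
    qed
    finally show ?thesis .
  qed
  then have mean: "(\<lambda>N. (\<Sum>k\<in>{0..N}. a k) / (real N + 1)) \<longlonglongrightarrow> (\<integral>t. f (\<sigma>' t) \<partial>lebesgue_on {0..<2 * pi}) / (2 * pi)"
    by (rule cesaro_mean_tendsto)
  have "(\<lambda>N. (\<Sum>j\<in>{0..N}. f (ev N j)) / (real N + 1) - (\<Sum>k\<in>{0..N}. a k) / (real N + 1)) \<longlonglongrightarrow> 0"
  proof (rule LIMSEQ_I)
    fix r :: real assume "r > 0"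
    \<comment> \<open>Mean squared error \<open>\<epsilon>\<^sup>2\<close> and parameter \<open>\<epsilon>\<close> contribute \<open>L \<epsilon>\<close> each; \<open>C\<close> collects the exceptional indices.\<close>
    define \<epsilon> where "\<epsilon> = r / (4 * (L + 1))"
    have \<epsilon>: "\<epsilon> > 0" "L * \<epsilon> \<le> r / 4" using \<open>r > 0\<close> L0 by (auto simp: \<epsilon>_def field_simps)
    obtain h m K where h: "\<And>k. k \<ge> m \<Longrightarrow> h k \<in> KN c R (k + m)"
      "\<And>k. k \<ge> K \<Longrightarrow> L2_normsq M (\<lambda>z. of_real (\<sigma> z) * e k z - h k z) < \<epsilon>\<^sup>2"
      by (rule symbol_near_shifts[OF \<sigma> lim, of "\<epsilon>\<^sup>2"]) (use \<epsilon>(1) in auto)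
    define C where "C = L * (real (max K m + m) * S\<^sup>2) / \<epsilon>"
    obtain n0 :: nat where n0: "4 * C / r < real n0" using reals_Archimedean2[of "4 * C / r"] by auto
    show "\<exists>n0. \<forall>N\<ge>n0. norm ((\<Sum>j\<in>{0..N}. f (ev N j)) / (real N + 1) - (\<Sum>k\<in>{0..N}. a k) / (real N + 1) - 0) < r"
    proof (intro exI[of _ n0] allI impI)
      fix N assume N: "n0 \<le> N"
      \<comment> \<open>For \<open>k + m > N\<close> the approximant \<open>h k\<close> may leave the truncated space.\<close>
      define h' where "h' k = (if max K m \<le> k \<and> k + m \<le> N then h k else (\<lambda>z. 0))" for k
      have h'K: "h' k \<in> KN c R N" for k
      proof (cases "max K m \<le> k \<and> k + m \<le> N")
        case True
        then show ?thesis using h(1)[of k] KN_mono[of "k + m" N] by (auto simp: h'_def)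
      next
        case False
        then have "h' k = 0" by (auto simp: h'_def zero_fun_def)
        then show ?thesis using cfun.subspace_0[OF KN_subspace, of N] by simp
      qed
      then have "\<forall>k. \<exists>a. h' k = (\<lambda>z. \<Sum>l\<in>{0..N}. a l * e l z)" unfolding KN_iff by blast
      then obtain H where H: "\<And>k. h' k = (\<lambda>z. \<Sum>l\<in>{0..N}. H k l * e l z)" by metis
      obtain v where v: "orthonormal_on M {0..N} v"
        "\<And>j. j \<in> {0..N} \<Longrightarrow> v j \<in> weak_eigenspace N (of_real (ev N j))"
        using orthonormal_eigenbasis[OF ev[of N]] by blast
      have "\<forall>j\<in>{0..N}. \<exists>u. v j = (\<lambda>z. \<Sum>k\<in>{0..N}. u k * e k z)"
        using weak_eigenspace_KN[OF v(2)] unfolding KN_iff by blast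
      then obtain U where U: "\<And>j. j \<in> {0..N} \<Longrightarrow> v j = (\<lambda>z. \<Sum>k\<in>{0..N}. U j k * e k z)" by metis
      have eig: "L2_inner M (\<lambda>z. of_real (\<sigma> z) * v j z - of_real (ev N j) * v j z) (\<lambda>z. \<Sum>k\<in>{0..N}. b k * e k z) = 0"
        if "j \<in> {0..N}" for j b
      proof -
        have "(\<lambda>z. \<Sum>k\<in>{0..N}. b k * e k z) \<in> KN c R N" unfolding KN_iff by (intro exI) (rule refl)
        then show ?thesis using v(2)[OF that] unfolding weak_eigenspace_def by blast
      qed
      have sub: "{k \<in> {0..N}. \<not> (max K m \<le> k \<and> k + m \<le> N)} \<subseteq> {..<max K m} \<union> {N + 1 - m..<N + 1}"
        by auto
      have "card {k \<in> {0..N}. \<not> (max K m \<le> k \<and> k + m \<le> N)} \<le> card ({..<max K m} \<union> {N + 1 - m..<N + 1})"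
        by (rule card_mono[OF _ sub]) simp
      also have "\<dots> \<le> max K m + m"
        by (rule card_Un_le[THEN order_trans]) simp
      finally have card: "card {k \<in> {0..N}. \<not> (max K m \<le> k \<and> k + m \<le> N)} \<le> max K m + m" .
      have "(\<Sum>k\<in>{0..N}. L2_normsq M (\<lambda>z. of_real (\<sigma> z) * e k z - h' k z)) \<le>
        (\<Sum>k\<in>{0..N}. \<epsilon>\<^sup>2 + (if \<not> (max K m \<le> k \<and> k + m \<le> N) then S\<^sup>2 else 0))"
      proof (rule sum_mono)
        fix k
        show "L2_normsq M (\<lambda>z. of_real (\<sigma> z) * e k z - h' k z) \<le> \<epsilon>\<^sup>2 + (if \<not> (max K m \<le> k \<and> k + m \<le> N) then S\<^sup>2 else 0)"
          using h(2)[of k] normsq_symbol_onb[of k]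
          by (cases "max K m \<le> k \<and> k + m \<le> N") (auto simp: h'_def add_increasing less_imp_le)
      qed
      also have "\<dots> = (real N + 1) * \<epsilon>\<^sup>2 + real (card {k \<in> {0..N}. \<not> (max K m \<le> k \<and> k + m \<le> N)}) * S\<^sup>2"
        unfolding sum.distrib by (subst sum.inter_filter[symmetric]) auto
      also have "\<dots> \<le> (real N + 1) * \<epsilon>\<^sup>2 + real (max K m + m) * S\<^sup>2"
        by (intro add_left_mono mult_right_mono of_nat_mono card) simp
      finally have sum: "(\<Sum>k\<in>{0..N}. L2_normsq M (\<lambda>z. of_real (\<sigma> z) * e k z - h' k z)) \<le>
        (real N + 1) * \<epsilon>\<^sup>2 + real (max K m + m) * S\<^sup>2" .
      have "\<bar>(\<Sum>j\<in>{0..N}. f (ev N j)) - (\<Sum>k\<in>{0..N}. a k)\<bar> \<le>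
        L * (real (card {0..N}) * \<epsilon> + (\<Sum>k\<in>{0..N}. L2_normsq M (\<lambda>z. of_real (\<sigma> z) * e k z - h' k z)) / \<epsilon>)"
        unfolding a_def
      proof (rule eigenvalue_sum_near_weighted_average[where v = v and U = U and H = H and S = S and B = B])
        show "\<And>z. z \<in> space M \<Longrightarrow> \<bar>\<sigma> z\<bar> \<le> S" using sigma_bound by simp
        show "\<And>k. k \<in> {0..N} \<Longrightarrow> h' k = (\<lambda>z. \<Sum>l\<in>{0..N}. H k l * e l z)" by (rule H)
      qed (fact orthonormal_onb finite_atLeastAtMost v(1) U sigma_M eig fm f L0 \<epsilon>(1))+
      also have "\<dots> \<le> L * ((real N + 1) * \<epsilon> + ((real N + 1) * \<epsilon>\<^sup>2 + real (max K m + m) * S\<^sup>2) / \<epsilon>)"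
        using sum L0 \<epsilon>(1) by (intro mult_left_mono add_mono divide_right_mono) auto
      also have "\<dots> = (real N + 1) * (2 * (L * \<epsilon>)) + C"
        using \<epsilon>(1) by (simp add: C_def power2_eq_square field_simps)
      also have "\<dots> \<le> (real N + 1) * (r / 2) + C"
        using \<epsilon>(2) by (intro add_right_mono mult_left_mono) auto
      finally have "\<bar>(\<Sum>j\<in>{0..N}. f (ev N j)) - (\<Sum>k\<in>{0..N}. a k)\<bar> / (real N + 1) \<le> ((real N + 1) * (r / 2) + C) / (real N + 1)"
        by (intro divide_right_mono) auto
      also have "\<dots> = r / 2 + C / (real N + 1)" by (simp add: field_simps)
      also have "C / (real N + 1) < r / 2"
      proof -
        have "4 * C / r < real N + 1" using n0 N by linarith
        then have "4 * C < r * (real N + 1)" using \<open>r > 0\<close> by (simp add: field_simps)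
        moreover have "r * (real N + 1) > 0" using \<open>r > 0\<close> by simp
        ultimately show ?thesis by (simp add: divide_less_eq)
      qed
      finally have "\<bar>(\<Sum>j\<in>{0..N}. f (ev N j)) - (\<Sum>k\<in>{0..N}. a k)\<bar> / (real N + 1) < r" by simp
      moreover have "\<bar>(\<Sum>j\<in>{0..N}. f (ev N j)) - (\<Sum>k\<in>{0..N}. a k)\<bar> / (real N + 1) =
        \<bar>(\<Sum>j\<in>{0..N}. f (ev N j)) / (real N + 1) - (\<Sum>k\<in>{0..N}. a k) / (real N + 1)\<bar>"
        by (simp flip: diff_divide_distrib)
      ultimately show "norm ((\<Sum>j\<in>{0..N}. f (ev N j)) / (real N + 1) - (\<Sum>k\<in>{0..N}. a k) / (real N + 1) - 0) < r"
        by simp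
    qed
  qed
  from tendsto_add[OF this mean] show ?thesis by simp
qed

end

section \<open>Counting eigenvalues\<close>

lemma ratio_shift_tendsto:
  fixes c :: "nat \<Rightarrow> real"
  assumes c: "\<And>n. c n > 0" and lim: "(\<lambda>n. c (Suc n) / c n) \<longlonglongrightarrow> \<rho>"
  shows "(\<lambda>n. c (n + m) / c n) \<longlonglongrightarrow> \<rho> ^ m"
proof (induction m)
  case 0
  have "c n / c n = 1" for n using c[of n] by simp
  then show ?case by simp
next
  case (Suc m)
  have "(\<lambda>n. c (Suc (n + m)) / c (n + m)) \<longlonglongrightarrow> \<rho>"
    using LIMSEQ_ignore_initial_segment[OF lim, of m] by simp
  from tendsto_mult[OF this Suc.IH]
  have "(\<lambda>n. c (Suc (n + m)) / c (n + m) * (c (n + m) / c n)) \<longlonglongrightarrow> \<rho> ^ Suc m"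
    unfolding power_Suc .
  moreover have eq: "c (Suc (n + m)) / c (n + m) * (c (n + m) / c n) = c (n + Suc m) / c n" for n
    using c[of "n + m"] by simp
  ultimately show ?case unfolding eq by blast
qed

text \<open>After division of numerator and denominator by \<open>c (2 l + 1)\<close> the limit is
  \<open>\<rho>\<^sup>m / sqrt (\<rho>\<^sup>2\<^sup>m)\<close>.\<close>

lemma quotient_tendsto_finite_radius:
  fixes c :: "nat \<Rightarrow> real"
  assumes c: "\<And>n. c n > 0" and lim: "(\<lambda>n. c (Suc n) / c n) \<longlonglongrightarrow> \<rho>" and \<rho>: "\<rho> > 0"
  shows "(\<lambda>l. c (2 * l + m + 1) / (sqrt (c (2 * l + 2 * m + 1)) * sqrt (c (2 * l + 1)))) \<longlonglongrightarrow> 1"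
proof -
  have sub: "filterlim (\<lambda>l::nat. 2 * l + 1) at_top sequentially"
    by (rule filterlim_subseq) (auto simp: strict_mono_def)
  have 1: "(\<lambda>l. c (2 * l + 1 + m) / c (2 * l + 1)) \<longlonglongrightarrow> \<rho> ^ m"
    and 2: "(\<lambda>l. c (2 * l + 1 + 2 * m) / c (2 * l + 1)) \<longlonglongrightarrow> \<rho> ^ (2 * m)"
    using filterlim_compose[OF ratio_shift_tendsto[OF c lim] sub] by blast+
  have "(\<lambda>l. (c (2 * l + 1 + m) / c (2 * l + 1)) / sqrt (c (2 * l + 1 + 2 * m) / c (2 * l + 1))) \<longlonglongrightarrow> \<rho> ^ m / sqrt (\<rho> ^ (2 * m))"
    by (intro tendsto_divide tendsto_real_sqrt 1 2) (use \<rho> in simp)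
  also have "\<rho> ^ m / sqrt (\<rho> ^ (2 * m)) = 1"
    using \<rho> by (simp add: mult.commute[of 2] power_mult real_sqrt_unique)
  also have "(\<lambda>l. (c (2 * l + 1 + m) / c (2 * l + 1)) / sqrt (c (2 * l + 1 + 2 * m) / c (2 * l + 1))) =
    (\<lambda>l. c (2 * l + m + 1) / (sqrt (c (2 * l + 2 * m + 1)) * sqrt (c (2 * l + 1))))"
  proof
    fix l
    define x y where "x = sqrt (c (2 * l + 1))" and "y = sqrt (c (2 * l + 2 * m + 1))"
    have xy: "x > 0" "y > 0" "c (2 * l + 1) = x * x" using c by (auto simp: x_def y_def less_imp_le)
    have "2 * l + 1 + 2 * m = 2 * l + 2 * m + 1" "2 * l + 1 + m = 2 * l + m + 1" by auto
    then show "(c (2 * l + 1 + m) / c (2 * l + 1)) / sqrt (c (2 * l + 1 + 2 * m) / c (2 * l + 1)) =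
      c (2 * l + m + 1) / (sqrt (c (2 * l + 2 * m + 1)) * sqrt (c (2 * l + 1)))"
      unfolding real_sqrt_divide using xy by (simp add: x_def[symmetric] y_def[symmetric] xy(3) field_simps)
  qed
  finally show ?thesis .
qed

text \<open>Piecewise linear functions of slope \<open>n\<close> around the indicator of the interval: it lies
  below the indicator for \<open>s = 0\<close> and above it for \<open>s = 1\<close>.\<close>

definition trapezoid :: "real \<Rightarrow> real \<Rightarrow> real \<Rightarrow> real \<Rightarrow> real \<Rightarrow> real" where
  "trapezoid \<alpha> \<beta> s n x = max 0 (min 1 (s + n * min (x - \<alpha>) (\<beta> - x)))"

lemma trapezoid_bounds: "0 \<le> trapezoid \<alpha> \<beta> s n x" "trapezoid \<alpha> \<beta> s n x \<le> 1"
  by (auto simp: trapezoid_def)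

lemma trapezoid_lipschitz:
  assumes "n \<ge> 0"
  shows "\<bar>trapezoid \<alpha> \<beta> s n x - trapezoid \<alpha> \<beta> s n y\<bar> \<le> n * \<bar>x - y\<bar>"
proof -
  define d where "d z = min (z - \<alpha>) (\<beta> - z)" for z
  have "\<bar>trapezoid \<alpha> \<beta> s n x - trapezoid \<alpha> \<beta> s n y\<bar> \<le> \<bar>(s + n * d x) - (s + n * d y)\<bar>"
    unfolding trapezoid_def d_def[symmetric] by linarith
  also have "\<dots> = n * \<bar>d x - d y\<bar>" using assms by (simp add: abs_mult flip: right_diff_distrib)
  also have "\<bar>d x - d y\<bar> \<le> \<bar>x - y\<bar>" unfolding d_def by linarith
  finally show ?thesis using assms by (simp add: mult_left_mono)
qed

lemma trapezoid_0_le: "n \<ge> 0 \<Longrightarrow> trapezoid \<alpha> \<beta> 0 n x \<le> of_bool (\<alpha> < x \<and> x < \<beta>)"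
proof -
  assume "n \<ge> 0"
  show ?thesis
  proof (cases "\<alpha> < x \<and> x < \<beta>")
    case False
    then have "n * min (x - \<alpha>) (\<beta> - x) \<le> 0" using \<open>n \<ge> 0\<close> by (intro mult_nonneg_nonpos) auto
    then show ?thesis using False by (auto simp: trapezoid_def)
  qed (simp add: trapezoid_bounds)
qed

lemma trapezoid_1_ge: "n \<ge> 0 \<Longrightarrow> of_bool (\<alpha> < x \<and> x < \<beta>) \<le> trapezoid \<alpha> \<beta> 1 n x"
proof -
  assume "n \<ge> 0"
  show ?thesis
  proof (cases "\<alpha> < x \<and> x < \<beta>")
    case True
    then have "n * min (x - \<alpha>) (\<beta> - x) \<ge> 0" using \<open>n \<ge> 0\<close> by (intro mult_nonneg_nonneg) auto
    then show ?thesis using True by (auto simp: trapezoid_def)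
  qed (auto simp: trapezoid_bounds)
qed

lemma trapezoid_tendsto:
  assumes "x \<noteq> \<alpha>" "x \<noteq> \<beta>"
  shows "(\<lambda>n. trapezoid \<alpha> \<beta> s (real n) x) \<longlonglongrightarrow> of_bool (\<alpha> < x \<and> x < \<beta>)"
proof -
  define d where "d = min (x - \<alpha>) (\<beta> - x)"
  have d: "d \<noteq> 0" "d > 0 \<longleftrightarrow> \<alpha> < x \<and> x < \<beta>" using assms by (auto simp: d_def min_def)
  obtain n0 :: nat where n0: "(1 + \<bar>s\<bar>) / \<bar>d\<bar> < real n0" using reals_Archimedean2[of "(1 + \<bar>s\<bar>) / \<bar>d\<bar>"] by auto
  have "trapezoid \<alpha> \<beta> s (real n) x = of_bool (\<alpha> < x \<and> x < \<beta>)" if "n \<ge> n0" for n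
  proof -
    have "(1 + \<bar>s\<bar>) / \<bar>d\<bar> < real n" using n0 that by linarith
    then have *: "1 + \<bar>s\<bar> < real n * \<bar>d\<bar>" using d(1) by (simp add: field_simps)
    show ?thesis
    proof (cases "d > 0")
      case True
      then show ?thesis using * d(2) unfolding trapezoid_def d_def[symmetric] by auto
    next
      case False
      then have "s + real n * d < 0" using * by (simp add: abs_if split: if_splits)
      then show ?thesis using False d(2) unfolding trapezoid_def d_def[symmetric] by auto
    qed
  qed
  then show ?thesis by (intro tendsto_eventually eventually_sequentiallyI[of n0])
qed

context radial_symbol begin

text \<open>Squeezes the indicator of the interval between Lipschitz functions whose angular means
  have the same limit, because the radial limit avoids the end points almost everywhere.\<close>

theorem eigenvalue_count_tendsto:
  assumes \<sigma>: "\<sigma> \<in> borel_measurable (lebesgue_on (disc R))"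
    and lim: "AE t in lebesgue_on {0..<2 * pi}. ((\<lambda>r. \<sigma> (rcis r t)) \<longlongrightarrow> \<sigma>' t) (to_radius R)"
    and ev: "\<And>N. eigenvalues_with_mult (truncated_toeplitz c \<mu> R \<sigma> N) (KN c R N) N (ev N)"
    and null: "measure lebesgue {t\<in>{0..<2 * pi}. \<sigma>' t = \<alpha>} = 0"
      "measure lebesgue {t\<in>{0..<2 * pi}. \<sigma>' t = \<beta>} = 0"
  shows "(\<lambda>N. real (card {j\<in>{0..N}. \<alpha> < ev N j \<and> ev N j < \<beta>}) / (real N + 1))
           \<longlonglongrightarrow> measure lebesgue {t\<in>{0..<2 * pi}. \<alpha> < \<sigma>' t \<and> \<sigma>' t < \<beta>} / (2 * pi)"
proof -
  let ?L = "lebesgue_on {0..<2 * pi}"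
  have fin: "emeasure ?L (space ?L) < \<infinity>"
    by (simp add: space_restrict_space emeasure_restrict_space)
  interpret L: finite_measure ?L by standard (use fin in simp)
  have \<sigma>' [measurable]: "\<sigma>' \<in> borel_measurable ?L"
    by (rule radial_limit_measurable[OF \<sigma> sigma_bound lim])
  have space_L: "space ?L = {0..<2 * pi}" by (simp add: space_restrict_space)
  have meas_eq: "measure lebesgue {t\<in>{0..<2 * pi}. P t} = measure ?L {t \<in> space ?L. P t}" for P
    unfolding space_L by (subst measure_restrict_space) auto
  have AE_ne: "AE t in ?L. \<sigma>' t \<noteq> x" if "measure lebesgue {t\<in>{0..<2 * pi}. \<sigma>' t = x} = 0" for x
  proof -
    have "{t \<in> space ?L. \<sigma>' t = x} \<in> sets ?L" by measurable
    moreover have "emeasure ?L {t \<in> space ?L. \<sigma>' t = x} = 0"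
      using that unfolding meas_eq by (simp add: L.emeasure_eq_measure)
    ultimately show ?thesis by (subst AE_iff_measurable[OF _ refl]) auto
  qed
  define P where "P = measure lebesgue {t\<in>{0..<2 * pi}. \<alpha> < \<sigma>' t \<and> \<sigma>' t < \<beta>}"
  have P: "P = (\<integral>t. of_bool (\<alpha> < \<sigma>' t \<and> \<sigma>' t < \<beta>) \<partial>?L)"
  proof -
    have "(\<integral>t. of_bool (\<alpha> < \<sigma>' t \<and> \<sigma>' t < \<beta>) \<partial>?L) = (\<integral>t. indicator {t \<in> space ?L. \<alpha> < \<sigma>' t \<and> \<sigma>' t < \<beta>} t \<partial>?L :: real)"
      by (intro Bochner_Integration.integral_cong) (auto simp: indicator_def)
    also have "\<dots> = P" unfolding P_def meas_eq 
      by (subst Bochner_Integration.integral_indicator)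
        (auto simp: Int_def intro!: arg_cong[where f = "measure ?L"])
    finally show ?thesis ..
  qed
  define I where "I s n = (\<integral>t. trapezoid \<alpha> \<beta> s (real n) (\<sigma>' t) \<partial>?L)" for s and n :: nat
  have I_lim: "(\<lambda>n. I s n / (2 * pi)) \<longlonglongrightarrow> P / (2 * pi)" for s
  proof (intro tendsto_divide tendsto_const)
    show "I s \<longlonglongrightarrow> P"
      unfolding I_def P
    proof (rule integral_dominated_convergence[where w = "\<lambda>_. 1"])
      show "AE t in ?L. (\<lambda>n. trapezoid \<alpha> \<beta> s (real n) (\<sigma>' t)) \<longlonglongrightarrow> of_bool (\<alpha> < \<sigma>' t \<and> \<sigma>' t < \<beta>)"
        using AE_ne[OF null(1)] AE_ne[OF null(2)] by eventually_elim (rule trapezoid_tendsto)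
      show "(\<lambda>t. trapezoid \<alpha> \<beta> s (real n) (\<sigma>' t)) \<in> borel_measurable ?L" for n
        unfolding trapezoid_def by measurable
      show "(\<lambda>t. of_bool (\<alpha> < \<sigma>' t \<and> \<sigma>' t < \<beta>)) \<in> borel_measurable ?L"
        unfolding of_bool_def by measurable
    qed (use trapezoid_bounds in \<open>auto intro!: AE_I2\<close>)
  qed simp
  have mean: "(\<lambda>N. (\<Sum>j\<in>{0..N}. trapezoid \<alpha> \<beta> s (real n) (ev N j)) / (real N + 1)) \<longlonglongrightarrow> I s n / (2 * pi)" for s n
    unfolding I_def
    by (rule eigenvalue_mean_tendsto[OF \<sigma> lim ev, where B = 1 and L = "real n"])
      (auto simp: trapezoid_bounds trapezoid_lipschitz)
  define C where "C N = real (card {j\<in>{0..N}. \<alpha> < ev N j \<and> ev N j < \<beta>}) / (real N + 1)" for N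
  have C: "C N = (\<Sum>j\<in>{0..N}. of_bool (\<alpha> < ev N j \<and> ev N j < \<beta>)) / (real N + 1)" for N
    by (simp add: C_def of_bool_def sum.If_cases Int_def)
  have "C \<longlonglongrightarrow> P / (2 * pi)"
  proof (rule LIMSEQ_I)
    fix r :: real assume "r > 0"
    then have r: "r / 2 > 0" by simp
    have "\<forall>\<^sub>F n in sequentially. \<bar>I 0 n / (2 * pi) - P / (2 * pi)\<bar> < r / 2 \<and> \<bar>I 1 n / (2 * pi) - P / (2 * pi)\<bar> < r / 2"
      using tendstoD[OF I_lim[of 0] r] tendstoD[OF I_lim[of 1] r]
      by eventually_elim (simp add: dist_real_def)
    then obtain n where n: "\<bar>I 0 n / (2 * pi) - P / (2 * pi)\<bar> < r / 2" "\<bar>I 1 n / (2 * pi) - P / (2 * pi)\<bar> < r / 2"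
      by (auto dest: eventually_happens)
    have "\<forall>\<^sub>F N in sequentially. \<bar>C N - P / (2 * pi)\<bar> < r"
      using tendstoD[OF mean[of 0 n] r] tendstoD[OF mean[of 1 n] r]
    proof eventually_elim
      case (elim N)
      have "(\<Sum>j\<in>{0..N}. trapezoid \<alpha> \<beta> 0 (real n) (ev N j)) / (real N + 1) \<le> C N"
        unfolding C by (intro divide_right_mono sum_mono trapezoid_0_le) auto
      moreover have "C N \<le> (\<Sum>j\<in>{0..N}. trapezoid \<alpha> \<beta> 1 (real n) (ev N j)) / (real N + 1)"
        unfolding C by (intro divide_right_mono sum_mono trapezoid_1_ge) auto
      ultimately show "\<bar>C N - P / (2 * pi)\<bar> < r"
        using elim n unfolding dist_real_def by linarith
    qed
    then show "\<exists>n0. \<forall>N\<ge>n0. norm (C N - P / (2 * pi)) < r"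
      by (simp add: eventually_sequentially)
  qed
  then show ?thesis unfolding C_def P_def .
qed

end

theorem corollary3p5:
  fixes c :: "nat \<Rightarrow> real" and \<mu> :: "real \<Rightarrow> real" and R :: ereal
    and \<sigma> :: "complex \<Rightarrow> real" and \<sigma>' :: "real \<Rightarrow> real"
    and ev :: "nat \<Rightarrow> nat \<Rightarrow> real" and \<alpha> \<beta> :: real
  assumes c_pos: "\<And>n. c n > 0"
    and c_mono: "monoseq (\<lambda>n. c (Suc n) / c n)"
    and c_lim: "(\<lambda>n. ereal (c (Suc n) / c n)) \<longlonglongrightarrow> R"
    and R_pos: "0 < R"
    and mu_meas: "\<mu> \<in> borel_measurable lebesgue"
    and mu_nonneg: "\<And>r. \<mu> r \<ge> 0"
    and mu_supp: "measure_support (density lebesgue (\<lambda>r. ennreal (\<mu> r))) = {r. 0 \<le> r \<and> ereal r \<le> R}"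
    and moments: "\<And>n. has_bochner_integral (lebesgue_on {r. 0 \<le> r \<and> ereal r \<le> R})
                    (\<lambda>r. r ^ n * \<mu> r) (c n)"
    and c_asymp: "R = \<infinity> \<Longrightarrow> (\<And>m. (\<lambda>l. c (2 * l + m + 1) /
                    (sqrt (c (2 * l + 2 * m + 1)) * sqrt (c (2 * l + 1)))) \<longlonglongrightarrow> 1)"
    and sigma_meas: "\<sigma> \<in> borel_measurable (lebesgue_on (disc R))"
    and sigma_bdd: "bounded (\<sigma> ` disc R)"
    and radial_limit: "AE \<theta> in lebesgue_on {0..<2 * pi}.
                    ((\<lambda>r. \<sigma> (rcis r \<theta>)) \<longlongrightarrow> \<sigma>' \<theta>) (to_radius R)"
    and eigenvalues: "\<And>N. eigenvalues_with_mult (truncated_toeplitz c \<mu> R \<sigma> N) (KN c R N) N (ev N)"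
    and alpha_beta: "(INF z\<in>disc R. \<sigma> z) < \<alpha>" "\<alpha> < \<beta>" "\<beta> < (SUP z\<in>disc R. \<sigma> z)"
    and sign: "\<alpha> > 0 \<or> \<beta> < 0"
    and null_alpha: "measure lebesgue {\<theta>\<in>{0..<2 * pi}. \<sigma>' \<theta> = \<alpha>} = 0"
    and null_beta: "measure lebesgue {\<theta>\<in>{0..<2 * pi}. \<sigma>' \<theta> = \<beta>} = 0"
  shows "(\<lambda>N. real (card {j\<in>{0..N}. \<alpha> < ev N j \<and> ev N j < \<beta>}) / (real N + 1))
           \<longlonglongrightarrow> measure lebesgue {\<theta>\<in>{0..<2 * pi}. \<alpha> < \<sigma>' \<theta> \<and> \<sigma>' \<theta> < \<beta>} / (2 * pi)"
proof -
  have quotient: "(\<lambda>l. c (2 * l + m + 1) / (sqrt (c (2 * l + 2 * m + 1)) * sqrt (c (2 * l + 1)))) \<longlonglongrightarrow> 1" for m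
  proof (cases R)
    case (real \<rho>)
    then have "(\<lambda>n. c (Suc n) / c n) \<longlonglongrightarrow> \<rho>" "\<rho> > 0" using c_lim R_pos by auto
    then show ?thesis by (intro quotient_tendsto_finite_radius c_pos)
  next
    case PInf
    then show ?thesis by (rule c_asymp)
  qed (use R_pos in auto)
  interpret radial_weight c \<mu> R
    by standard (fact c_pos R_pos mu_meas mu_nonneg mu_supp moments quotient)+
  obtain S where S: "\<And>z. z \<in> disc R \<Longrightarrow> \<bar>\<sigma> z\<bar> \<le> S"
    using sigma_bdd unfolding bounded_iff by auto
  interpret radial_symbol c \<mu> R \<sigma> S
  proof
    show "\<sigma> \<in> borel_measurable (disc_measure \<mu> R)"
      using sigma_meas sets_M by (simp cong: measurable_cong_sets)
  qed (fact S)
  show ?thesis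
    by (rule eigenvalue_count_tendsto[OF sigma_meas radial_limit eigenvalues null_alpha null_beta])
qed

end
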